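(* Let $\boldsymbol p=(p,0)$ or $\boldsymbol p=(0,p)$ with $p\in\mathbb N=\{1,2,\dots\}$. The moduli space $\mathcal M_{\boldsymbol p}(\mathbb CP^2)$ of symbol correspondences $\mathcal B(\mathcal H_{\boldsymbol p})\to C^\infty_{\mathbb C}(\mathbb CP^2)$ is $(\mathbb R^\times)^p$; the identification assigns to a correspondence its characteristic numbers $(c_1,\dots,c_p)$.
   Context: For $\boldsymbol p=(p,q)\in\mathbb N_0^2$, $\mathcal H_{\boldsymbol p}$ carries the unitary irrep $\rho$ of $SU(3)$ with highest weight $p\varpi_1+q\varpi_2$ ($\varpi_1,\varpi_2$ the fundamental weights; $(1,0)$ is the defining representation). $\mathcal B(\mathcal H_{\boldsymbol p})$ carries the action $A^g=\rho(g)A\rho(g)^{-1}$. For $\boldsymbol p=(p,0)$ or $(0,p)$, $\mathcal B(\mathcal H_{\boldsymbol p})=\bigoplus_{n=0}^p(n,n)$ without multiplicity. $\mathbb CP^2\simeq SU(3)/H$, where $H=\{\mathrm{diag}(\det(U)^{-1},U):U\in U(2)\}$ is the isotropy group of $\mathrm x_0=[1:0:0]$, with the $SU(3)$-invariant integral of total mass $1$. For $K\in\mathcal B(\mathcal H_{\boldsymbol p})$ fixed by $H$, $K(g\mathrm x_0):=K^g$. A symbol correspondence $W:\mathcal B(\mathcal H_{\boldsymbol p})\to C^\infty_{\mathbb C}(\mathbb CP^2)$ is an injective linear map with: (1) $W_{A^g}=(W_A)^g$ for all $g\in SU(3)$, where $f^g(\mathrm x)=f(g^{-1}\mathrm x)$;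 (2) $W_{A^\dagger}=\overline{W_A}$; (3) $\int_{\mathbb CP^2}W_A\,d\mathrm x=\operatorname{tr}(A)/\dim(\boldsymbol p)$. Every symbol correspondence is of the form $W_A(\mathrm x)=\operatorname{tr}(AK(\mathrm x))$ for a unique $K\in\mathcal B(\mathcal H_{\boldsymbol p})$ fixed by $H$, called its operator kernel. The moduli space $\mathcal M_{\boldsymbol p}(\mathbb CP^2)\subset\mathcal B(\mathcal H_{\boldsymbol p})$ is the set of all operator kernels of symbol correspondences. Characteristic numbers: in each summand $(n,n)\subset\mathcal B(\mathcal H_{\boldsymbol p})$ the subspace fixed by $H$ is one-dimensional; let $E_n$ be a fixed Hermitian element of it with $\operatorname{tr}(E_n^2)=1$, with $E_0=\mathds 1/\sqrt{\dim\boldsymbol p}$. Every operator kernel is written uniquely as $K=\sum_{n=0}^pc_n\sqrt{(n+1)^3/\dim(\boldsymbol p)}\,E_n$ with real $c_n$ and $c_0=1$; the $c_n$ are its characteristic numbers. ($E_n$ is the element denoted $\boldsymbol e(n;(n,n,n),0)$ of a coupled Gelfand-Tsetlin basis of $\mathcal B(\mathcal H_{\boldsymbol p})$.) *)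

theory Defs
  imports "HOL-Probability.Probability"
begin

section \<open>Complex matrices and the group SU(3)\<close>

definition cadj :: "complex^'n^'m \<Rightarrow> complex^'m^'n" where
  "cadj A = (\<chi> i j. cnj (A $ j $ i))"

text \<open>\<^term>\<open>(*s)\<close> scales vectors by entries of their own scalar type; on matrices, viewed as
  vectors of rows, it does not provide complex scaling.\<close>
definition mscale :: "complex \<Rightarrow> complex^'n^'m \<Rightarrow> complex^'n^'m" where
  "mscale c A = (\<chi> i j. c * A $ i $ j)"

definition unitary_mat :: "complex^'n^'n \<Rightarrow> bool" where
  "unitary_mat A \<longleftrightarrow> cadj A ** A = mat 1 \<and> A ** cadj A = mat 1"

definition SU3 :: "(complex^3^3) set" where
  "SU3 = {g. unitary_mat g \<and> det g = 1}"

definition diag3 :: "complex \<Rightarrow> complex \<Rightarrow> complex \<Rightarrow> complex^3^3" where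
  "diag3 a b c = vector [vector [a, 0, 0], vector [0, b, 0], vector [0, 0, c]]"

definition torus :: "(complex^3^3) set" where
  "torus = {diag3 a b c | a b c. cmod a = 1 \<and> cmod b = 1 \<and> cmod c = 1 \<and> a * b * c = 1}"

definition isotropy :: "(complex^3^3) set" where
  "isotropy = {vector [vector [inverse (det U), 0, 0],
                       vector [0, U $ 1 $ 1, U $ 1 $ 2],
                       vector [0, U $ 2 $ 1, U $ 2 $ 2]] | U :: complex^2^2. unitary_mat U}"

section \<open>Irreducible representations and highest weights\<close>

text \<open>A representation space is a complex subspace \<open>V\<close> of a space with complex scaling \<open>s\<close>,
  on which \<open>g\<close> in SU(3) acts by \<open>\<pi> g\<close>.  The pair \<open>(a, b)\<close> stands for the integral weight
  \<open>a \<varpi>\<^sub>1 + b \<varpi>\<^sub>2\<close>, where \<open>\<varpi>\<^sub>1\<close> and \<open>\<varpi>\<^sub>2\<close> are the characters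
  \<open>diag(t\<^sub>1, t\<^sub>2, t\<^sub>3) \<mapsto> t\<^sub>1\<close> and \<open>diag(t\<^sub>1, t\<^sub>2, t\<^sub>3) \<mapsto> t\<^sub>1 t\<^sub>2\<close> of the diagonal torus.\<close>

definition weight_char :: "int \<times> int \<Rightarrow> complex^3^3 \<Rightarrow> complex" where
  "weight_char w t = (t $ 1 $ 1) powi (fst w) * (t $ 1 $ 1 * t $ 2 $ 2) powi (snd w)"

definition is_weight ::
  "(complex \<Rightarrow> 'v \<Rightarrow> 'v) \<Rightarrow> (complex^3^3 \<Rightarrow> 'v \<Rightarrow> 'v) \<Rightarrow> 'v::ab_group_add set \<Rightarrow> int \<times> int \<Rightarrow> bool" where
  "is_weight s \<pi> V w \<longleftrightarrow> (\<exists>v\<in>V. v \<noteq> 0 \<and> (\<forall>t\<in>torus. \<pi> t v = s (weight_char w t) v))"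

text \<open>The simple roots are \<open>\<alpha>\<^sub>1 = 2 \<varpi>\<^sub>1 - \<varpi>\<^sub>2\<close> and \<open>\<alpha>\<^sub>2 = 2 \<varpi>\<^sub>2 - \<varpi>\<^sub>1\<close>; every weight is
  obtained from the highest one by subtracting \<open>k \<alpha>\<^sub>1 + l \<alpha>\<^sub>2\<close> with natural \<open>k\<close>, \<open>l\<close>.\<close>
definition highest_weight ::
  "(complex \<Rightarrow> 'v \<Rightarrow> 'v) \<Rightarrow> (complex^3^3 \<Rightarrow> 'v \<Rightarrow> 'v) \<Rightarrow> 'v::ab_group_add set \<Rightarrow> int \<times> int \<Rightarrow> bool" where
  "highest_weight s \<pi> V w \<longleftrightarrow> is_weight s \<pi> V w \<and>
     (\<forall>a b. is_weight s \<pi> V (a, b) \<longrightarrow>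
        (\<exists>k l :: nat. a = fst w - 2 * int k + int l \<and> b = snd w + int k - 2 * int l))"

definition invariant_subspace ::
  "(complex \<Rightarrow> 'v \<Rightarrow> 'v) \<Rightarrow> (complex^3^3 \<Rightarrow> 'v \<Rightarrow> 'v) \<Rightarrow> 'v::ab_group_add set \<Rightarrow> bool" where
  "invariant_subspace s \<pi> V \<longleftrightarrow> module.subspace s V \<and> (\<forall>g\<in>SU3. \<forall>v\<in>V. \<pi> g v \<in> V)"

definition irreducible_on ::
  "(complex \<Rightarrow> 'v \<Rightarrow> 'v) \<Rightarrow> (complex^3^3 \<Rightarrow> 'v \<Rightarrow> 'v) \<Rightarrow> 'v::ab_group_add set \<Rightarrow> bool" where
  "irreducible_on s \<pi> V \<longleftrightarrow> invariant_subspace s \<pi> V \<and> V \<noteq> {0} \<and>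
     (\<forall>U. invariant_subspace s \<pi> U \<and> U \<subseteq> V \<longrightarrow> U = {0} \<or> U = V)"

definition irrep_with_highest_weight ::
  "(complex \<Rightarrow> 'v \<Rightarrow> 'v) \<Rightarrow> (complex^3^3 \<Rightarrow> 'v \<Rightarrow> 'v) \<Rightarrow> 'v::ab_group_add set \<Rightarrow> int \<times> int \<Rightarrow> bool" where
  "irrep_with_highest_weight s \<pi> V w \<longleftrightarrow> irreducible_on s \<pi> V \<and> highest_weight s \<pi> V w"

text \<open>The Hilbert space is \<open>\<complex>\<^sup>N\<close> with its standard Hermitian product, \<open>N = CARD('n)\<close>.\<close>
definition unitary_rep :: "(complex^3^3 \<Rightarrow> complex^'n^'n) \<Rightarrow> bool" where
  "unitary_rep \<rho> \<longleftrightarrow> continuous_on SU3 \<rho> \<and> (\<forall>g\<in>SU3. unitary_mat (\<rho> g)) \<and>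
     (\<forall>g\<in>SU3. \<forall>h\<in>SU3. \<rho> (g ** h) = \<rho> g ** \<rho> h)"

definition unitary_irrep :: "(complex^3^3 \<Rightarrow> complex^'n^'n) \<Rightarrow> nat \<times> nat \<Rightarrow> bool" where
  "unitary_irrep \<rho> pq \<longleftrightarrow> unitary_rep \<rho> \<and>
     irrep_with_highest_weight (*s) (\<lambda>g v. \<rho> g *v v) UNIV (int (fst pq), int (snd pq))"

definition conj_act :: "(complex^3^3 \<Rightarrow> complex^'n^'n) \<Rightarrow> complex^3^3 \<Rightarrow> complex^'n^'n \<Rightarrow> complex^'n^'n" where
  "conj_act \<rho> g A = \<rho> g ** A ** matrix_inv (\<rho> g)"

definition isotropy_fixed :: "(complex^3^3 \<Rightarrow> complex^'n^'n) \<Rightarrow> complex^'n^'n \<Rightarrow> bool" where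
  "isotropy_fixed \<rho> K \<longleftrightarrow> (\<forall>h\<in>isotropy. conj_act \<rho> h K = K)"

section \<open>The complex projective plane\<close>

typedef cp2 = "{range (\<lambda>c::complex. c *s z) | z :: complex^3. z \<noteq> 0}"
proof -
  have "(axis 1 1 :: complex^3) \<noteq> 0" by (simp add: axis_eq_0_iff)
  then show ?thesis by blast
qed

definition cp2_pt :: "complex^3 \<Rightarrow> cp2" where
  "cp2_pt z = Abs_cp2 (range (\<lambda>c::complex. c *s z))"

definition cp2_base :: cp2 where
  "cp2_base = cp2_pt (vector [1, 0, 0])"

text \<open>Meaningful for invertible \<open>g\<close>.\<close>
definition cp2_act :: "complex^3^3 \<Rightarrow> cp2 \<Rightarrow> cp2" where
  "cp2_act g x = Abs_cp2 ((\<lambda>z. g *v z) ` Rep_cp2 x)"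

text \<open>The quotient topology from \<open>\<complex>\<^sup>3 - {0}\<close>.\<close>
instantiation cp2 :: topological_space
begin

definition open_cp2 :: "cp2 set \<Rightarrow> bool" where
  "open_cp2 U \<longleftrightarrow> open {z. z \<noteq> 0 \<and> cp2_pt z \<in> U}"

instance
proof
  have "{z :: complex^3. z \<noteq> 0 \<and> cp2_pt z \<in> UNIV} = - {0}" by auto
  then show "open (UNIV :: cp2 set)"
    unfolding open_cp2_def by (simp only: open_Compl closed_singleton)
next
  fix S T :: "cp2 set"
  assume "open S" "open T"
  moreover have "{z. z \<noteq> 0 \<and> cp2_pt z \<in> S \<inter> T} =
      {z. z \<noteq> 0 \<and> cp2_pt z \<in> S} \<inter> {z. z \<noteq> 0 \<and> cp2_pt z \<in> T}" by auto
  ultimately show "open (S \<inter> T)" unfolding open_cp2_def by (simp add: open_Int)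
next
  fix K :: "cp2 set set"
  assume "\<forall>S\<in>K. open S"
  moreover have "{z. z \<noteq> 0 \<and> cp2_pt z \<in> \<Union>K} = (\<Union>S\<in>K. {z. z \<noteq> 0 \<and> cp2_pt z \<in> S})" by auto
  ultimately show "open (\<Union>K)" unfolding open_cp2_def by (simp add: open_UN)
qed

end

text \<open>\<open>C\<^sup>k\<close> in the sense of real calculus: all iterated directional derivatives up to order \<open>k\<close>
  exist as total derivatives, and those of order \<open>k\<close> are continuous.\<close>
primrec Ck :: "nat \<Rightarrow> ('a::real_normed_vector \<Rightarrow> 'b::real_normed_vector) \<Rightarrow> bool" where
  "Ck 0 f \<longleftrightarrow> continuous_on UNIV f"
| "Ck (Suc k) f \<longleftrightarrow> (\<forall>x. f differentiable (at x)) \<and>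
     (\<forall>v. Ck k (\<lambda>x. frechet_derivative f (at x) v))"

definition Cinf :: "('a::real_normed_vector \<Rightarrow> 'b::real_normed_vector) \<Rightarrow> bool" where
  "Cinf f \<longleftrightarrow> (\<forall>k. Ck k f)"

text \<open>Smoothness in the three affine charts \<open>[1:u:v]\<close>, \<open>[u:1:v]\<close>, \<open>[u:v:1]\<close>.\<close>
definition cp2_smooth :: "(cp2 \<Rightarrow> complex) \<Rightarrow> bool" where
  "cp2_smooth f \<longleftrightarrow>
     Cinf (\<lambda>(u, v). f (cp2_pt (vector [1, u, v]))) \<and>
     Cinf (\<lambda>(u, v). f (cp2_pt (vector [u, 1, v]))) \<and>
     Cinf (\<lambda>(u, v). f (cp2_pt (vector [u, v, 1])))"

definition invariant_probability :: "cp2 measure \<Rightarrow> bool" where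
  "invariant_probability \<mu> \<longleftrightarrow> prob_space \<mu> \<and> sets \<mu> = sets borel \<and>
     (\<forall>g\<in>SU3. distr \<mu> \<mu> (cp2_act g) = \<mu>)"

section \<open>Symbol correspondences, operator kernels and characteristic numbers\<close>

definition symbol_correspondence ::
  "(complex^3^3 \<Rightarrow> complex^'n^'n) \<Rightarrow> cp2 measure \<Rightarrow> (complex^'n^'n \<Rightarrow> cp2 \<Rightarrow> complex) \<Rightarrow> bool" where
  "symbol_correspondence \<rho> \<mu> W \<longleftrightarrow>
     (\<forall>A. cp2_smooth (W A)) \<and>
     (\<forall>A B x. W (A + B) x = W A x + W B x) \<and>
     (\<forall>c A x. W (mscale c A) x = c * W A x) \<and>
     inj W \<and>
     (\<forall>g\<in>SU3. \<forall>A x. W (conj_act \<rho> g A) x = W A (cp2_act (matrix_inv g) x)) \<and>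
     (\<forall>A x. W (cadj A) x = cnj (W A x)) \<and>
     (\<forall>A. integral\<^sup>L \<mu> (W A) = trace A / of_nat CARD('n))"

definition operator_kernel ::
  "(complex^3^3 \<Rightarrow> complex^'n^'n) \<Rightarrow> (complex^'n^'n \<Rightarrow> cp2 \<Rightarrow> complex) \<Rightarrow> complex^'n^'n \<Rightarrow> bool" where
  "operator_kernel \<rho> W K \<longleftrightarrow> isotropy_fixed \<rho> K \<and>
     (\<forall>A. \<forall>g\<in>SU3. W A (cp2_act g cp2_base) = trace (A ** conj_act \<rho> g K))"

definition moduli_space ::
  "(complex^3^3 \<Rightarrow> complex^'n^'n) \<Rightarrow> cp2 measure \<Rightarrow> (complex^'n^'n) set" where
  "moduli_space \<rho> \<mu> = {K. \<exists>W. symbol_correspondence \<rho> \<mu> W \<and> operator_kernel \<rho> W K}"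

text \<open>\<open>E n\<close> for \<open>n \<le> p\<close> is a normalised Hermitian isotropy-fixed element of the summand \<open>(n, n)\<close>
  of the operator space; it is determined up to sign, and the sign is left arbitrary for \<open>n > 0\<close>.\<close>
definition fixed_basis ::
  "(complex^3^3 \<Rightarrow> complex^'n^'n) \<Rightarrow> nat \<Rightarrow> (nat \<Rightarrow> complex^'n^'n) \<Rightarrow> bool" where
  "fixed_basis \<rho> p E \<longleftrightarrow>
     (\<forall>n\<le>p. (\<exists>V. irrep_with_highest_weight mscale (conj_act \<rho>) V (int n, int n) \<and> E n \<in> V) \<and>
        isotropy_fixed \<rho> (E n) \<and> cadj (E n) = E n \<and> trace (E n ** E n) = 1) \<and>
     E 0 = (1 / sqrt (real CARD('n))) *\<^sub>R mat 1"

text \<open>\<open>c\<close> carries the indices \<open>0, \<dots>, p\<close>; it is pinned to \<^term>\<open>undefined\<close> elsewhere to make it unique.\<close>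
definition characteristic_numbers ::
  "nat \<Rightarrow> (nat \<Rightarrow> complex^'n^'n) \<Rightarrow> complex^'n^'n \<Rightarrow> (nat \<Rightarrow> real) \<Rightarrow> bool" where
  "characteristic_numbers p E K c \<longleftrightarrow> c \<in> extensional {0..p} \<and> c 0 = 1 \<and>
     K = (\<Sum>n=0..p. (c n * sqrt ((real n + 1) ^ 3 / real CARD('n))) *\<^sub>R E n)"

text \<open>The tuple \<open>(c\<^sub>1, \<dots>, c\<^sub>p)\<close>.\<close>
definition char_tuple ::
  "nat \<Rightarrow> (nat \<Rightarrow> complex^'n^'n) \<Rightarrow> complex^'n^'n \<Rightarrow> (nat \<Rightarrow> real)" where
  "char_tuple p E K = restrict (THE c. characteristic_numbers p E K c) {1..p}"

end

(*
  The representation is identified without Lie algebras.  All weights of rho are monomials of degree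
  p in the diagonal entries (for (0, p), after complex conjugation of the group).  A unit vector v of
  weight t_1^p is fixed by the SU(2) acting on the last two coordinates, so the coefficient
  <rho(g) v, v> is a function F of g_11, homogeneous of degree p.  On the conjugacy class of
  diag(u, 1, 1) with 11-entry 1 - s + s u it is a polynomial of degree at most p in u; comparing u with
  its conjugate shows that this polynomial is divisible by (1 - s + s u)^p, so F(z) = z^p.  Hence rho is
  the p-th symmetric power, with coherent vectors z^p: expectations in coherent vectors determine an
  operator, and the isotropy-fixed Hermitian operators have dimension at most p + 1, so the E_n are an
  orthonormal basis of them.  By Schur's lemma the symbol map of K = sum_n k_n E_n is injective exactly
  when all k_n are nonzero, while the trace condition fixes k_0.
*)
theory Submission
  imports Defs "HOL-Computational_Algebra.Fundamental_Theorem_Algebra"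
begin

section \<open>Complex matrices\<close>

text \<open>The obstacle is that only extremal data are given: the highest weight bounds the weights
  of \<open>\<rho>\<close>, but neither its dimension nor a decomposition of the operator space is
  available. All rests on one matrix coefficient. Group elements whose 11-entries have equal modulus
  have coefficients related by homogeneity; along a conjugated circle subgroup this links u with its
  conjugate, and an identity on the unit circle is an identity of polynomials. The linear forms 1 -
  s + s u and s + (1 - s) u that occur have reciprocal roots, distinct for s \<noteq> 1/2, whence
  the divisibility. One negative real entry of each modulus in (0, 1) suffices, since the torus
  adjusts the phase. The bound p + 1 comes from an even polynomial of degree at most 2 p with known
  zeros at 0, ..., p. The summands (n, n) are separated without classifying irreducibles: a nonzero
  pairing between two of them gives intertwiners both ways, and each compares highest weights.
  Schur's lemma also evaluates the integral, as an invariant functional on operators, so no Haar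
  measure on the group enters.\<close>

lemma cadj_component [simp]: "cadj A $ i $ j = cnj (A $ j $ i)"
  by (simp add: cadj_def)

lemma mscale_component [simp]: "mscale c A $ i $ j = c * A $ i $ j"
  by (simp add: mscale_def)

lemma cadj_cadj [simp]: "cadj (cadj A) = A"
  by (simp add: vec_eq_iff)

lemma cadj_add: "cadj (A + B) = cadj A + cadj B"
  by (simp add: vec_eq_iff)

lemma cadj_scaleR: "cadj (r *\<^sub>R A) = r *\<^sub>R cadj A"
  by (simp add: vec_eq_iff)

lemma cadj_mscale: "cadj (mscale c A) = mscale (cnj c) (cadj A)"
  by (simp add: vec_eq_iff)

lemma cadj_zero [simp]: "cadj 0 = 0"
  by (simp add: vec_eq_iff)

lemma cadj_mult: "cadj (A ** B) = cadj B ** cadj A"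
  by (simp add: vec_eq_iff matrix_matrix_mult_def mult.commute)

lemma cadj_mat1 [simp]: "cadj (mat 1) = mat 1"
  by (simp add: vec_eq_iff mat_def)

lemma mscale_of_real: "mscale (of_real r) A = r *\<^sub>R A"
  by (simp add: vec_eq_iff scaleR_conv_of_real[where 'a = complex])

lemma mscale_mult_left: "mscale c A ** B = mscale c (A ** B)"
  by (simp add: vec_eq_iff matrix_matrix_mult_def sum_distrib_left mult.assoc)

lemma mscale_mult_right: "A ** mscale c B = mscale c (A ** B)"
  by (simp add: vec_eq_iff matrix_matrix_mult_def sum_distrib_left mult_ac)

lemma mscale_vector_mult: "mscale c A *v x = c *s (A *v x)"
  by (simp add: vec_eq_iff matrix_vector_mult_def sum_distrib_left mult_ac)

lemma trace_mscale: "trace (mscale c A) = c * trace A"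
  by (simp add: trace_def sum_distrib_left)

lemma trace_cadj: "trace (cadj A) = cnj (trace A)"
  by (simp add: trace_def)

lemma trace_scaleR: "trace (r *\<^sub>R A) = r *\<^sub>R trace A" for A :: "complex^'n^'n"
  by (simp add: trace_def scaleR_sum_right)

lemma trace_zero [simp]: "trace (0 :: complex^'n^'n) = 0"
  by (simp add: trace_def)

lemma trace_sum: "trace (\<Sum>i\<in>I. f i) = (\<Sum>i\<in>I. trace (f i))" for f :: "'i \<Rightarrow> complex^'n^'n"
  by (induction I rule: infinite_finite_induct) (simp_all add: trace_add)

lemma matrix_mult_sum_right: "A ** (\<Sum>i\<in>I. f i) = (\<Sum>i\<in>I. A ** f i)"
  for A :: "complex^'n^'m" and f :: "'i \<Rightarrow> complex^'k^'n"
  by (induction I rule: infinite_finite_induct) (simp_all add: matrix_add_ldistrib)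

lemma matrix_add_rdistrib: "(A + B) ** C = A ** C + B ** C"
  for A :: "complex^'n^'m" and C :: "complex^'k^'n"
  by (simp add: vec_eq_iff matrix_matrix_mult_def distrib_right sum.distrib)

lemma matrix_mult_sum_left: "(\<Sum>i\<in>I. f i) ** A = (\<Sum>i\<in>I. f i ** A)"
  for A :: "complex^'k^'n" and f :: "'i \<Rightarrow> complex^'n^'m"
  by (induction I rule: infinite_finite_induct) (simp_all add: matrix_add_rdistrib)

lemma scaleR_matrix_mult_left: "(r *\<^sub>R A) ** B = r *\<^sub>R (A ** B)"
  for A :: "complex^'n^'m" and B :: "complex^'k^'n"
  by (metis mscale_mult_left mscale_of_real)

lemma scaleR_matrix_mult_right: "A ** (r *\<^sub>R B) = r *\<^sub>R (A ** B)"
  for A :: "complex^'n^'m" and B :: "complex^'k^'n"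
  by (metis mscale_mult_right mscale_of_real)

lemma module_mscale: "module (mscale :: complex \<Rightarrow> complex^'n^'m \<Rightarrow> _)"
  by unfold_locales (simp_all add: vec_eq_iff algebra_simps)

lemma mscale_subspace_iff:
  "module.subspace (mscale :: complex \<Rightarrow> complex^'n^'m \<Rightarrow> _) V \<longleftrightarrow>
    0 \<in> V \<and> (\<forall>x\<in>V. \<forall>y\<in>V. x + y \<in> V) \<and> (\<forall>c. \<forall>x\<in>V. mscale c x \<in> V)"
  by (rule module.subspace_def[OF module_mscale])

lemma mscale_subspace_imp_subspace:
  assumes "module.subspace mscale V"
  shows "subspace V"
  using assms unfolding mscale_subspace_iff subspace_def
  by (metis mscale_of_real)

lemma vec_subspace_imp_subspace:
  fixes S :: "(complex^'n) set"
  assumes "vec.subspace S"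
  shows "subspace S"
proof -
  have "r *\<^sub>R x = of_real r *s x" for r and x :: "complex^'n"
    by (simp add: vec_eq_iff scaleR_conv_of_real[where 'a = complex])
  with assms show ?thesis
    unfolding vec.subspace_def subspace_def by simp
qed

lemma vector_smult_matrix_mult: "A *v (c *s x) = c *s (A *v x)" for A :: "complex^'n^'m"
  by (simp add: vec_eq_iff matrix_vector_mult_def sum_distrib_left mult_ac)

lemma matrix_vector_mult_sum: "A *v (\<Sum>i\<in>I. f i) = (\<Sum>i\<in>I. A *v f i)"
  for A :: "complex^'n^'m"
  by (induction I rule: infinite_finite_induct) (simp_all add: matrix_vector_right_distrib)

lemma mult_span_subset:
  fixes A :: "complex^'n^'m"
  assumes "vec.subspace U" and "\<And>y. y \<in> S \<Longrightarrow> A *v y \<in> U" and x: "x \<in> vec.span S"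
  shows "A *v x \<in> U"
  using x by (induction rule: vec.span_induct_alt)
    (simp_all add: assms matrix_vector_right_distrib vector_smult_matrix_mult vec.subspace_0
      vec.subspace_add vec.subspace_scale)

lemma eigenvector_span:
  fixes A :: "complex^'n^'n"
  assumes "\<And>y. y \<in> S \<Longrightarrow> A *v y = c *s y" and x: "x \<in> vec.span S"
  shows "A *v x = c *s x"
  using x by (induction rule: vec.span_induct_alt)
    (simp_all add: assms matrix_vector_right_distrib vector_smult_matrix_mult vec.scale_right_distrib
      vector_smult_assoc mult.commute)

section \<open>The Hermitian product\<close>

definition cin :: "complex^'n \<Rightarrow> complex^'n \<Rightarrow> complex" where
  "cin x y = (\<Sum>i\<in>UNIV. x $ i * cnj (y $ i))"

lemma cin_add_left: "cin (x + y) z = cin x z + cin y z"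
  by (simp add: cin_def distrib_right sum.distrib)

lemma cin_add_right: "cin z (x + y) = cin z x + cin z y"
  by (simp add: cin_def distrib_left sum.distrib)

lemma cin_scale_left: "cin (c *s x) y = c * cin x y"
  by (simp add: cin_def sum_distrib_left mult.assoc)

lemma cin_scale_right: "cin x (c *s y) = cnj c * cin x y"
  by (simp add: cin_def sum_distrib_left mult_ac)

lemma cin_zero_left [simp]: "cin 0 x = 0" and cin_zero_right [simp]: "cin x 0 = 0"
  by (simp_all add: cin_def)

lemma cin_sum_left: "cin (\<Sum>i\<in>I. f i) y = (\<Sum>i\<in>I. cin (f i) y)"
  by (induction I rule: infinite_finite_induct) (simp_all add: cin_add_left)

lemma cin_sum_right: "cin y (\<Sum>i\<in>I. f i) = (\<Sum>i\<in>I. cin y (f i))"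
  by (induction I rule: infinite_finite_induct) (simp_all add: cin_add_right)

lemma cin_commute: "cin y x = cnj (cin x y)"
  by (simp add: cin_def mult.commute)

lemma cin_self: "cin x x = of_real ((norm x)\<^sup>2)"
proof -
  have "(norm x)\<^sup>2 = (\<Sum>i\<in>UNIV. (cmod (x $ i))\<^sup>2)"
    by (simp add: norm_vec_def L2_set_def sum_nonneg)
  then show ?thesis
    by (simp add: cin_def flip: complex_norm_square of_real_power)
qed

lemma cin_self_eq_0 [simp]: "cin x x = 0 \<longleftrightarrow> x = 0"
  by (simp add: cin_self)

lemma inner_eq_Re_cin: "inner x y = Re (cin x y)"
  by (simp add: inner_vec_def cin_def inner_complex_def)

lemma cin_mult_left: "cin (A *v x) y = cin x (cadj A *v y)"
proof -
  have "cin (A *v x) y = (\<Sum>i\<in>UNIV. \<Sum>j\<in>UNIV. A $ i $ j * x $ j * cnj (y $ i))"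
    by (simp add: cin_def matrix_vector_mult_def sum_distrib_right)
  also have "\<dots> = (\<Sum>j\<in>UNIV. \<Sum>i\<in>UNIV. A $ i $ j * x $ j * cnj (y $ i))"
    by (rule sum.swap)
  also have "\<dots> = cin x (cadj A *v y)"
    by (simp add: cin_def matrix_vector_mult_def sum_distrib_left mult_ac)
  finally show ?thesis .
qed

text \<open>The real inner product of z with \<open>\<i> *s s\<close> is the imaginary part of
  \<open>cin z s\<close>, and a complex subspace contains \<open>\<i> *s s\<close>. So the real
  orthogonal decomposition of Euclidean spaces serves for the Hermitian product.\<close>

lemma vec_subspace_orth_cin:
  fixes S :: "(complex^'n) set"
  assumes "vec.subspace S" and "\<And>s. s \<in> S \<Longrightarrow> inner z s = 0" and "s \<in> S"
  shows "cin z s = 0"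
proof -
  have "Re (cin z s) = 0" using assms by (simp flip: inner_eq_Re_cin)
  moreover have "\<i> *s s \<in> S" using assms by (simp add: vec.subspace_scale)
  then have "Re (cin z (\<i> *s s)) = 0" using assms by (simp flip: inner_eq_Re_cin)
  then have "Im (cin z s) = 0" by (simp add: cin_scale_right)
  ultimately show ?thesis by (simp add: complex_eq_iff)
qed

lemma vec_subspace_orth_decomp:
  fixes S :: "(complex^'n) set"
  assumes "vec.subspace S"
  obtains y z where "y \<in> S" "x = y + z" "\<And>s. s \<in> S \<Longrightarrow> cin z s = 0"
proof -
  have S: "span S = S"
    using vec_subspace_imp_subspace[OF assms] by (rule span_eq_iff[THEN iffD2])
  obtain y z where *: "y \<in> span S" "x = y + z" "\<And>w. w \<in> span S \<Longrightarrow> orthogonal z w"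
    using orthogonal_subspace_decomp_exists[of S x] by blast
  have "cin z s = 0" if "s \<in> S" for s
    using vec_subspace_orth_cin[OF assms _ that, of z] * S by (simp add: orthogonal_def)
  with * S that show thesis by auto
qed

lemma cin_span_zero:
  assumes "\<And>y. y \<in> S \<Longrightarrow> cin x y = 0" and y: "y \<in> vec.span S"
  shows "cin x y = 0"
  using y by (induction rule: vec.span_induct_alt) (simp_all add: assms cin_add_right cin_scale_right)

definition outer :: "complex^'n \<Rightarrow> complex^'n \<Rightarrow> complex^'n^'n" where
  "outer x y = (\<chi> i j. x $ i * cnj (y $ j))"

lemma outer_mult_vector: "outer x y *v z = cin z y *s x"
  by (simp add: outer_def cin_def vec_eq_iff matrix_vector_mult_def sum_distrib_right
      sum_distrib_left mult_ac)

lemma cadj_outer: "cadj (outer x y) = outer y x"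
  by (simp add: outer_def vec_eq_iff mult.commute)

lemma trace_mult_outer: "trace (A ** outer x y) = cin (A *v x) y"
  by (simp add: trace_def matrix_matrix_mult_def outer_def cin_def matrix_vector_mult_def
      sum_distrib_right mult.assoc)

lemma mult_outer: "A ** outer x y = outer (A *v x) y"
  by (simp add: vec_eq_iff matrix_matrix_mult_def outer_def matrix_vector_mult_def
      sum_distrib_right mult.assoc)

lemma outer_mult: "outer x y ** A = outer x (cadj A *v y)"
  by (simp add: vec_eq_iff matrix_matrix_mult_def outer_def matrix_vector_mult_def
      sum_distrib_left mult_ac)

text \<open>Links the Euclidean structure on matrices with the Hilbert-Schmidt product, so that real
  dimension theory and orthogonal projections apply to operators.\<close>

lemma inner_matrix: "inner A B = Re (trace (A ** cadj B))" for A B :: "complex^'n^'n"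
  by (simp add: inner_vec_def inner_complex_def trace_def matrix_matrix_mult_def)

section \<open>The group SU(3)\<close>

lemma unitary_mat_cadj: "unitary_mat A \<Longrightarrow> unitary_mat (cadj A)"
  by (simp add: unitary_mat_def)

lemma unitary_mat_mult: "unitary_mat A \<Longrightarrow> unitary_mat B \<Longrightarrow> unitary_mat (A ** B)"
  unfolding unitary_mat_def cadj_mult
  by (metis matrix_mul_assoc matrix_mul_lid)

lemma unitary_matI: "cadj A ** A = mat 1 \<Longrightarrow> unitary_mat A"
  by (simp add: unitary_mat_def matrix_left_right_inverse)

lemma matrix_inv_unitary: "unitary_mat A \<Longrightarrow> matrix_inv A = cadj A"
proof -
  assume A: "unitary_mat A"
  then have "\<exists>A'. A ** A' = mat 1 \<and> A' ** A = mat 1" by (auto simp: unitary_mat_def)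
  then have "A ** matrix_inv A = mat 1"
    unfolding matrix_inv_def by (rule someI2_ex) simp
  then have "cadj A ** (A ** matrix_inv A) = cadj A" by simp
  with A show ?thesis by (simp add: matrix_mul_assoc unitary_mat_def)
qed

lemma unitary_cin: "unitary_mat A \<Longrightarrow> cin (A *v x) (A *v y) = cin x y"
  by (simp add: cin_mult_left matrix_vector_mul_assoc unitary_mat_def)

lemma unitary_norm: "unitary_mat A \<Longrightarrow> norm (A *v x) = norm x"
proof -
  assume "unitary_mat A"
  then have "(norm (A *v x))\<^sup>2 = (norm x)\<^sup>2"
    using unitary_cin[of A x x] by (simp only: cin_self of_real_eq_iff)
  then show ?thesis by simp
qed

lemma det_cadj: "det (cadj A) = cnj (det A)" for A :: "complex^3^3"
  by (simp add: det_3 mult_ac)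

lemma SU3_D: "g \<in> SU3 \<Longrightarrow> unitary_mat g" "g \<in> SU3 \<Longrightarrow> det g = 1"
  by (simp_all add: SU3_def)

lemma SU3_mult: "g \<in> SU3 \<Longrightarrow> h \<in> SU3 \<Longrightarrow> g ** h \<in> SU3"
  by (simp add: SU3_def unitary_mat_mult det_mul)

lemma SU3_cadj: "g \<in> SU3 \<Longrightarrow> cadj g \<in> SU3"
  by (simp add: SU3_def unitary_mat_cadj det_cadj)

lemma SU3_one: "mat 1 \<in> SU3"
  by (simp add: SU3_def unitary_mat_def)

lemma SU3_cancel: "g \<in> SU3 \<Longrightarrow> cadj g ** g = mat 1" "g \<in> SU3 \<Longrightarrow> g ** cadj g = mat 1"
  by (simp_all add: SU3_def unitary_mat_def)

lemma SU3_matrix_inv: "g \<in> SU3 \<Longrightarrow> matrix_inv g = cadj g"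
  by (simp add: SU3_def matrix_inv_unitary)

text \<open>Conjugation is an automorphism of SU(3) that exchanges a representation with its dual,
  hence the highest weights (p, 0) and (0, p).\<close>

definition cnj_mat :: "complex^'n^'m \<Rightarrow> complex^'n^'m" where
  "cnj_mat A = (\<chi> i j. cnj (A $ i $ j))"

lemma cnj_mat_component [simp]: "cnj_mat A $ i $ j = cnj (A $ i $ j)"
  by (simp add: cnj_mat_def)

lemma cnj_mat_mult: "cnj_mat (A ** B) = cnj_mat A ** cnj_mat B"
  by (simp add: vec_eq_iff matrix_matrix_mult_def)

lemma cnj_mat_cnj_mat [simp]: "cnj_mat (cnj_mat A) = A"
  by (simp add: vec_eq_iff)

lemma unitary_cnj_mat: "unitary_mat A \<Longrightarrow> unitary_mat (cnj_mat A)"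
proof -
  assume "unitary_mat A"
  moreover have "cadj (cnj_mat A) = cnj_mat (cadj A)" "cnj_mat (mat 1) = (mat 1 :: complex^'a^'a)"
    by (simp_all add: vec_eq_iff mat_def)
  ultimately show ?thesis
    unfolding unitary_mat_def by (metis cnj_mat_mult)
qed

lemma SU3_cnj_mat: "g \<in> SU3 \<Longrightarrow> cnj_mat g \<in> SU3"
proof -
  assume g: "g \<in> SU3"
  have "det (cnj_mat g) = cnj (det g)" by (simp add: det_3)
  with g show ?thesis by (simp add: SU3_def unitary_cnj_mat)
qed

lemma norm_vec3: "(norm x)\<^sup>2 = (cmod (x $ 1))\<^sup>2 + (cmod (x $ 2))\<^sup>2 + (cmod (x $ 3))\<^sup>2" for x :: "complex^3"
  by (simp add: norm_vec_def L2_set_def sum_nonneg sum_3)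

lemma mat1_axis: "(A :: complex^3^3) *v axis 1 1 = (\<chi> i. A $ i $ 1)"
  by (simp add: vec_eq_iff forall_3 matrix_vector_mult_def sum_3 axis_def)

lemma diag3_component [simp]:
  "diag3 a b c $ 1 = vector [a, 0, 0]" "diag3 a b c $ 2 = vector [0, b, 0]" "diag3 a b c $ 3 = vector [0, 0, c]"
  by (simp_all add: diag3_def)

lemma diag3_mult: "diag3 a b c ** diag3 a' b' c' = diag3 (a * a') (b * b') (c * c')"
  by (simp add: vec_eq_iff forall_3 matrix_matrix_mult_def sum_3)

lemma cadj_diag3: "cadj (diag3 a b c) = diag3 (cnj a) (cnj b) (cnj c)"
  by (simp add: vec_eq_iff forall_3)

lemma diag3_one: "diag3 1 1 1 = mat 1"
  by (simp add: vec_eq_iff forall_3 mat_def)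

lemma diag3_SU3:
  assumes "cmod a = 1" "cmod b = 1" "cmod c = 1" "a * b * c = 1"
  shows "diag3 a b c \<in> SU3"
proof -
  have "cnj a * a = 1" "cnj b * b = 1" "cnj c * c = 1"
    using assms by (simp_all add: complex_norm_square[symmetric] mult.commute[of "cnj _"])
  then show ?thesis using assms(4)
    by (auto simp: SU3_def det_3 cadj_diag3 diag3_mult diag3_one intro!: unitary_matI)
qed

lemma torus_SU3: "t \<in> torus \<Longrightarrow> t \<in> SU3"
  by (auto simp: torus_def intro: diag3_SU3)

lemma torus_mult: "s \<in> torus \<Longrightarrow> t \<in> torus \<Longrightarrow> s ** t \<in> torus"
  unfolding torus_def
proof safe
  fix a b c a' b' c' :: complex
  assume "cmod a = 1" "cmod b = 1" "cmod c = 1" "a * b * c = 1"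
    "cmod a' = 1" "cmod b' = 1" "cmod c' = 1" "a' * b' * c' = 1"
  moreover from this have "(a * b * c) * (a' * b' * c') = 1" by simp
  then have "(a * a') * (b * b') * (c * c') = 1" by (simp only: mult_ac)
  ultimately show "\<exists>x y z. diag3 a b c ** diag3 a' b' c' = diag3 x y z \<and>
      cmod x = 1 \<and> cmod y = 1 \<and> cmod z = 1 \<and> x * y * z = 1"
    by (intro exI[of _ "a * a'"] exI[of _ "b * b'"] exI[of _ "c * c'"])
      (simp add: diag3_mult norm_mult)
qed

lemma torus_commute: "s \<in> torus \<Longrightarrow> t \<in> torus \<Longrightarrow> s ** t = t ** s"
  by (auto simp: torus_def diag3_mult mult.commute)

lemma torus_cadj: "t \<in> torus \<Longrightarrow> cadj t \<in> torus"
  unfolding torus_def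
  by (auto simp: cadj_diag3) (metis complex_cnj_mult complex_cnj_one complex_mod_cnj)

lemma torus_cnj_mat: "t \<in> torus \<Longrightarrow> cnj_mat t \<in> torus"
proof -
  assume t: "t \<in> torus"
  then have "cnj_mat t = cadj t"
    by (auto simp: torus_def vec_eq_iff forall_3)
  with t show ?thesis by (simp add: torus_cadj)
qed

definition su2_23 :: "complex \<Rightarrow> complex \<Rightarrow> complex^3^3" where
  "su2_23 a b = vector [vector [1, 0, 0], vector [0, a, - cnj b], vector [0, b, cnj a]]"

lemma su2_23_component [simp]:
  "su2_23 a b $ 1 = vector [1, 0, 0]" "su2_23 a b $ 2 = vector [0, a, - cnj b]"
  "su2_23 a b $ 3 = vector [0, b, cnj a]"
  by (simp_all add: su2_23_def)

lemma cadj_su2_23: "cadj (su2_23 a b) = su2_23 (cnj a) (- b)"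
  by (simp add: vec_eq_iff forall_3)

lemma su2_23_mult: "su2_23 a b ** su2_23 a' b' = su2_23 (a * a' - cnj b * b') (b * a' + cnj a * b')"
  by (simp add: vec_eq_iff forall_3 matrix_matrix_mult_def sum_3 algebra_simps)

lemma su2_23_SU3:
  assumes "(cmod a)\<^sup>2 + (cmod b)\<^sup>2 = 1"
  shows "su2_23 a b \<in> SU3"
proof -
  have *: "a * cnj a + b * cnj b = 1"
    using arg_cong[OF assms, of complex_of_real] by (simp only: complex_norm_square of_real_add of_real_1)
  then have "su2_23 1 0 = mat 1" "cnj a * a + cnj b * b = 1"
    by (simp_all add: vec_eq_iff forall_3 mat_def mult.commute)
  with * show ?thesis
    by (auto simp: SU3_def cadj_su2_23 su2_23_mult det_3 mult.commute intro!: unitary_matI)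
qed

text \<open>A permutation matrix of determinant one, representing an element of order three of the
  Weyl group.\<close>

definition cyc :: "complex^3^3" where
  "cyc = vector [vector [0, 0, 1], vector [1, 0, 0], vector [0, 1, 0]]"

lemma cyc_component [simp]:
  "cyc $ 1 = vector [0, 0, 1]" "cyc $ 2 = vector [1, 0, 0]" "cyc $ 3 = vector [0, 1, 0]"
  by (simp_all add: cyc_def)

lemma cyc_SU3: "cyc \<in> SU3"
  by (auto simp: SU3_def det_3 vec_eq_iff forall_3 matrix_matrix_mult_def sum_3 mat_def intro!: unitary_matI)

lemma diag3_cyc: "diag3 a b c ** cyc = cyc ** diag3 b c a"
  by (simp add: vec_eq_iff forall_3 matrix_matrix_mult_def sum_3)

section \<open>Weights of the torus\<close>

text \<open>The vector q(A) x, evaluated by Horner's scheme on the coefficients of q.\<close>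

definition poly_apply :: "complex^'n^'n \<Rightarrow> complex^'n \<Rightarrow> complex poly \<Rightarrow> complex^'n" where
  "poly_apply A x q = fold_coeffs (\<lambda>a y. a *s x + A *v y) q 0"

lemma poly_apply_0 [simp]: "poly_apply A x 0 = 0"
  by (simp add: poly_apply_def)

lemma poly_apply_pCons [simp]: "poly_apply A x (pCons a q) = a *s x + A *v poly_apply A x q"
proof (cases "a = 0 \<and> q = 0")
  case False
  then show ?thesis
    by (cases "q = 0") (simp_all add: poly_apply_def fold_coeffs_pCons_coeff_not_0_eq fold_coeffs_pCons_not_0_0_eq)
qed simp

lemma poly_apply_add: "poly_apply A x (q + r) = poly_apply A x q + poly_apply A x r"
  by (induction q r rule: poly_induct2) (simp_all add: vec.scale_left_distrib matrix_vector_right_distrib)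

lemma poly_apply_smult: "poly_apply A x (smult c q) = c *s poly_apply A x q"
  by (induction q) (simp_all add: vec.scale_right_distrib vector_smult_matrix_mult vector_smult_assoc)

lemma poly_apply_sum: "poly_apply A x (\<Sum>i\<in>I. f i) = (\<Sum>i\<in>I. poly_apply A x (f i))"
  by (induction I rule: infinite_finite_induct) (simp_all add: poly_apply_add)

lemma poly_apply_monom: "poly_apply A x (monom c i) = c *s (((*v) A ^^ i) x)"
  by (induction i) (simp_all add: monom_0 monom_Suc vector_smult_matrix_mult)

lemma poly_apply_in_subspace:
  assumes "vec.subspace S" "\<And>y. y \<in> S \<Longrightarrow> A *v y \<in> S" "x \<in> S"
  shows "poly_apply A x q \<in> S"
  using assms by (induction q) (simp_all add: vec.subspace_0 vec.subspace_add vec.subspace_scale)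

text \<open>The vectors x, A x, ..., A^N x are N + 1 in number in dimension N. A repetition among
  them is treated apart, because linear independence is a property of sets and would not see
  it.\<close>

lemma annihilating_poly: "\<exists>q. q \<noteq> 0 \<and> poly_apply A x q = 0" for A :: "complex^'n^'n"
proof -
  define b where "b i = ((*v) A ^^ i) x" for i
  let ?I = "{..CARD('n)}"
  show ?thesis
  proof (cases "inj_on b ?I")
    case False
    then obtain i j where ij: "b i = b j" "i \<noteq> j" unfolding inj_on_def by blast
    let ?q = "monom 1 i + smult (- 1) (monom 1 j) :: complex poly"
    have "poly_apply A x ?q = b i + (-1) *s b j"
      by (simp only: poly_apply_add poly_apply_smult poly_apply_monom b_def vec.scale_one)
    also have "\<dots> = 0" using ij by (simp add: vec_eq_iff)
    finally have "poly_apply A x ?q = 0" .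
    moreover have "coeff ?q i = 1" using ij by simp
    then have "?q \<noteq> 0" by (metis coeff_0 zero_neq_one)
    ultimately show ?thesis by blast
  next
    case True
    have "\<not> vec.independent (b ` ?I)"
    proof
      assume "vec.independent (b ` ?I)"
      then have "card (b ` ?I) \<le> vec.dim (UNIV :: (complex^'n) set)"
        by (metis subset_UNIV vec.independent_card_le_dim)
      then show False using True by (simp add: card_image vec_dim_card card_cart_basis)
    qed
    then obtain u w where u: "(\<Sum>v\<in>b ` ?I. u v *s v) = 0" "w \<in> b ` ?I" "u w \<noteq> 0"
      using vec.independent_if_scalars_zero[of "b ` ?I"] by blast
    let ?q = "\<Sum>i\<in>?I. monom (u (b i)) i"
    obtain j where j: "j \<in> ?I" "w = b j" using u by auto
    have "poly_apply A x ?q = (\<Sum>i\<in>?I. u (b i) *s b i)"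
      by (simp add: poly_apply_sum poly_apply_monom b_def)
    also have "\<dots> = 0" using u(1) True by (simp add: sum.reindex)
    finally have "poly_apply A x ?q = 0" .
    moreover have "coeff ?q j = u (b j)" using j
      by (simp add: coeff_sum if_distrib cong: if_cong)
    then have "?q \<noteq> 0" using u j by auto
    ultimately show ?thesis by blast
  qed
qed

text \<open>If (X - r) q' annihilates x, then q'(A) x is an eigenvector for r unless it vanishes,
  and in that case q' is an annihilator of smaller degree. All vectors of the form q'(A) x stay in
  the stable subspace.\<close>

lemma eigenvector_in_subspace:
  fixes A :: "complex^'n^'n"
  assumes S: "vec.subspace S" "\<And>y. y \<in> S \<Longrightarrow> A *v y \<in> S" and x: "x \<in> S" "x \<noteq> 0"
  obtains y \<mu> where "y \<in> S" "y \<noteq> 0" "A *v y = \<mu> *s y"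
proof -
  have "\<exists>y\<in>S. y \<noteq> 0 \<and> (\<exists>\<mu>. A *v y = \<mu> *s y)" if "q \<noteq> 0" "poly_apply A x q = 0" for q
    using that
  proof (induction "degree q" arbitrary: q rule: less_induct)
    case less
    show ?case
    proof (cases "degree q = 0")
      case True
      then obtain c where "q = [:c:]" by (auto elim: degree_eq_zeroE)
      with less.prems x show ?thesis by simp
    next
      case False
      then have "\<not> constant (poly q)" by (simp add: constant_degree)
      then obtain r where "poly q r = 0" using fundamental_theorem_of_algebra by blast
      then obtain q' where q': "q = [:-r, 1:] * q'" by (auto simp: poly_eq_0_iff_dvd elim: dvdE)
      let ?y = "poly_apply A x q'"
      have "q' \<noteq> 0" using less.prems q' by auto
      then have deg: "degree q' < degree q" unfolding q' by (subst degree_mult_eq) auto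
      have qq: "q = pCons 0 q' + smult (- r) q'" by (simp add: q')
      have "poly_apply A x q = (-r) *s ?y + A *v ?y"
        by (simp only: qq poly_apply_add poly_apply_smult poly_apply_pCons vec.scale_zero_left add_0_left add.commute)
      then have *: "A *v ?y = r *s ?y"
        using less.prems by (simp add: vec_eq_iff)
      show ?thesis
      proof (cases "?y = 0")
        case True
        then show ?thesis using less.hyps[OF deg] \<open>q' \<noteq> 0\<close> by blast
      next
        case False
        then show ?thesis using * poly_apply_in_subspace[OF S x(1), of q'] by blast
      qed
    qed
  qed
  then show thesis using that annihilating_poly[of A x] by blast
qed

text \<open>Continuity gives differentiability: integrating f (s + t) = f s * f t over s in [0, e]
  expresses f as a difference of values of its primitive, divided by a nonzero constant. Then f' = k
  f, so f is exponential, and the period forces k into \<i> times the integers.\<close>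

lemma circle_character:
  fixes f :: "real \<Rightarrow> complex"
  assumes cont: "continuous_on UNIV f" and add: "\<And>s t. f (s + t) = f s * f t"
    and "f 0 = 1" and per: "f (2 * pi) = 1"
  obtains n :: int where "\<And>t. f t = cis (of_int n * t)"
proof -
  have "isCont f 0" using cont by (simp add: continuous_on_eq_continuous_at)
  then obtain d where d: "d > 0" "\<And>x. dist x 0 < d \<Longrightarrow> dist (f x) (f 0) < 1/2"
    unfolding continuous_at_eps_delta by (metis half_gt_zero zero_less_one)
  \<comment> \<open>On [0, e] the function stays within 1/2 of f 0 = 1, so its integral
    \<open>c\<close> cannot vanish. The bound 1 keeps e inside the interval on which
    \<open>G\<close> is known to be differentiable.\<close>
  define e where "e = min (d / 2) 1"
  have e: "e > 0" "e \<le> 1" "e < d" using d by (auto simp: e_def)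
  have int: "f integrable_on {a..b}" for a b
    using cont continuous_on_subset integrable_continuous_real by blast
  define c where "c = integral {0..e} f"
  have "norm (c - complex_of_real e) \<le> 1/2 * (e - 0)"
  proof -
    have "c - complex_of_real e = integral {0..e} (\<lambda>x. f x - 1)"
      unfolding c_def using e by (subst integral_diff) (auto simp: int scaleR_conv_of_real)
    also have "norm \<dots> \<le> 1/2 * (e - 0)"
    proof (rule integral_bound)
      show "continuous_on {0..e} (\<lambda>x. f x - 1)"
        by (intro continuous_intros continuous_on_subset[OF cont]) auto
      show "norm (f t - 1) \<le> 1/2" if "t \<in> {0..e}" for t
        using d(2)[of t] that e \<open>f 0 = 1\<close> by (auto simp: dist_norm)
    qed (use e in auto)
    finally show ?thesis .
  qed
  then have "c \<noteq> 0" using e by auto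
  define G where "G t = integral {-1..t} f" for t
  have G: "(G has_vector_derivative f t) (at t)" if "-1 < t" "t < 3" for t
  proof -
    have "(G has_vector_derivative f t) (at t within {-1..3})"
      unfolding G_def by (rule integral_has_vector_derivative) (use that cont continuous_on_subset in auto)
    then show ?thesis using that by (simp add: at_within_Icc_at)
  qed
  have fG: "f t * c = G (t + e) - G t" if "-1 \<le> t" for t
  proof -
    have "f t * c = integral {0..e} (\<lambda>s. f (s + t))"
      by (simp add: c_def add mult.commute)
    also have "\<dots> = integral {0 + t..e + t} f"
      using integral_shift[of 0 t e f] continuous_on_subset[OF cont] by (simp add: o_def)
    also have "\<dots> = G (t + e) - G t"
      unfolding G_def using Henstock_Kurzweil_Integration.integral_combine[of "-1" t "t + e" f] that e int
      by (simp add: algebra_simps)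
    finally show ?thesis .
  qed
  define k where "k = (f e - f 0) / c"
  have "((\<lambda>t. (G (t + e) - G t) / c) has_vector_derivative k) (at 0)"
  proof -
    have "((\<lambda>t. G (t + e)) has_vector_derivative f e) (at 0)"
    proof -
      have "((\<lambda>t. t + e) has_vector_derivative 1) (at 0)"
        by (auto intro!: derivative_eq_intros)
      from vector_diff_chain_at[OF this, of G "f e"] G[of e] e show ?thesis
        by (simp add: o_def)
    qed
    from has_vector_derivative_diff[OF this G[of 0]]
    have "((\<lambda>t. G (t + e) - G t) has_vector_derivative (f e - f 0)) (at 0)" by simp
    from has_vector_derivative_mult_left[OF this, of "1 / c"] show ?thesis by (simp add: k_def)
  qed
  then have k0: "(f has_vector_derivative k) (at 0)"
    by (rule has_vector_derivative_transform_within[where d = 1])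
      (use fG \<open>c \<noteq> 0\<close> in \<open>auto simp: field_simps dist_norm\<close>)
  have kt: "(f has_vector_derivative (k * f t)) (at t)" for t
  proof -
    have "((\<lambda>s. f (s - t)) has_vector_derivative k) (at t)"
    proof -
      have "((\<lambda>s. s - t) has_vector_derivative 1) (at t)"
        by (auto intro!: derivative_eq_intros)
      from vector_diff_chain_at[OF this, of f k] k0 show ?thesis
        by (simp add: o_def)
    qed
    from has_vector_derivative_mult_left[OF this, of "f t"]
    have "((\<lambda>s. f (s - t) * f t) has_vector_derivative k * f t) (at t)" .
    moreover have "(\<lambda>s. f (s - t) * f t) = f" by (rule ext) (simp flip: add)
    ultimately show ?thesis by simp
  qed
  have "((\<lambda>s. f s * exp (- of_real s * k)) has_vector_derivative 0) (at t within UNIV)" for t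
  proof -
    have "((\<lambda>z. exp (- z * k)) has_field_derivative - k * exp (- of_real t * k)) (at (of_real t))"
      by (auto intro!: derivative_eq_intros)
    from has_vector_derivative_real_field[OF this]
    have "((\<lambda>s. exp (- of_real s * k)) has_vector_derivative - k * exp (- of_real t * k)) (at t)" .
    from has_vector_derivative_mult[OF kt[of t] this] show ?thesis by (simp add: algebra_simps)
  qed
  then obtain C where C: "\<And>t. f t * exp (- of_real t * k) = C"
    using has_vector_derivative_zero_constant[of UNIV "\<lambda>s. f s * exp (- of_real s * k)"] by auto
  have "C = 1" using C[of 0] \<open>f 0 = 1\<close> by simp
  then have fexp: "f t = exp (of_real t * k)" for t
    using C[of t] by (simp add: exp_minus field_simps)
  have "exp (of_real (2 * pi) * k) = 1" using per fexp[of "2 * pi"] by simp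
  then have "\<exists>n::int. Re (of_real (2 * pi) * k) = 0 \<and> Im (of_real (2 * pi) * k) = of_int (2 * n) * pi"
    by (simp only: exp_eq_1) blast
  then obtain n :: int where "Re k = 0" "Im k = of_int n" by auto
  then have "k = \<i> * of_int n" by (simp add: complex_eq_iff)
  then have "f t = cis (of_int n * t)" for t
    by (simp add: fexp cis_conv_exp mult_ac)
  with that show thesis by blast
qed

text \<open>In this form the continuity of a path in the torus can be checked entry by
  entry.\<close>

lemma diag3_eq: "diag3 a b c = (\<chi> i j. if i = j then (if i = 1 then a else if i = 2 then b else c) else 0)"
  by (simp add: vec_eq_iff forall_3)

lemma norm_1_cis: "cmod a = 1 \<Longrightarrow> \<exists>t. a = cis t"
  by (rule exI[of _ "Arg a"], cases "a = 0") (simp_all add: cis_Arg sgn_div_norm)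

section \<open>Unitary representations of SU(3) and their torus weights\<close>

lemma unitary_rep_D:
  assumes "unitary_rep \<rho>"
  shows "continuous_on SU3 \<rho>" "g \<in> SU3 \<Longrightarrow> unitary_mat (\<rho> g)"
    "g \<in> SU3 \<Longrightarrow> h \<in> SU3 \<Longrightarrow> \<rho> (g ** h) = \<rho> g ** \<rho> h"
  using assms by (auto simp: unitary_rep_def)

lemma unitary_rep_one: 
  assumes "unitary_rep \<rho>"
  shows "\<rho> (mat 1) = mat 1"
proof -
  have "\<rho> (mat 1) ** \<rho> (mat 1) = \<rho> (mat 1)"
    using unitary_rep_D(3)[OF assms SU3_one SU3_one] by simp
  then have "cadj (\<rho> (mat 1)) ** (\<rho> (mat 1) ** \<rho> (mat 1)) = cadj (\<rho> (mat 1)) ** \<rho> (mat 1)" by simp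
  then show ?thesis
    using unitary_rep_D(2)[OF assms SU3_one] by (simp add: matrix_mul_assoc unitary_mat_def)
qed

lemma unitary_rep_cadj:
  assumes "unitary_rep \<rho>" "g \<in> SU3"
  shows "\<rho> (cadj g) = cadj (\<rho> g)"
proof -
  have "\<rho> (cadj g) ** \<rho> g = mat 1"
    using assms unitary_rep_D(3)[OF assms(1) SU3_cadj[OF assms(2)] assms(2)]
    by (simp add: SU3_cancel unitary_rep_one)
  then have "\<rho> (cadj g) ** \<rho> g ** cadj (\<rho> g) = cadj (\<rho> g)" by simp
  then show ?thesis
    using unitary_rep_D(2)[OF assms] by (simp add: unitary_mat_def flip: matrix_mul_assoc)
qed

lemma unitary_rep_mult_vector:
  "unitary_rep \<rho> \<Longrightarrow> g \<in> SU3 \<Longrightarrow> h \<in> SU3 \<Longrightarrow> \<rho> (g ** h) *v x = \<rho> g *v (\<rho> h *v x)"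
  by (simp add: unitary_rep_D matrix_vector_mul_assoc)

lemma unitary_rep_cin_left:
  "unitary_rep \<rho> \<Longrightarrow> g \<in> SU3 \<Longrightarrow> cin (\<rho> g *v x) y = cin x (\<rho> (cadj g) *v y)"
  by (simp add: cin_mult_left unitary_rep_cadj)

text \<open>Take a nonzero torus-stable subspace of least dimension. Since the torus is commutative,
  an eigenspace of one of its elements is again stable, so each element acts by a scalar. The
  scalars form a continuous character, which is evaluated on two circles that generate the
  torus.\<close>

lemma torus_weight_exists:
  fixes \<rho> :: "complex^3^3 \<Rightarrow> complex^'n^'n"
  assumes rep: "unitary_rep \<rho>" and S: "vec.subspace S" "S \<noteq> {0}"
    and inv: "\<And>t x. t \<in> torus \<Longrightarrow> x \<in> S \<Longrightarrow> \<rho> t *v x \<in> S"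
  shows "\<exists>w. is_weight (*s) (\<lambda>g v. \<rho> g *v v) S w"
proof -
  define P where "P U \<longleftrightarrow> vec.subspace U \<and> U \<subseteq> S \<and> U \<noteq> {0} \<and>
    (\<forall>t\<in>torus. \<forall>x\<in>U. \<rho> t *v x \<in> U)" for U
  have "P S" using assms by (auto simp: P_def)
  then obtain U where "P U" and min: "\<And>U'. P U' \<Longrightarrow> vec.dim U \<le> vec.dim U'"
    using ex_has_least_nat[of P S vec.dim] by blast
  then have U: "vec.subspace U" "U \<subseteq> S" "U \<noteq> {0}" "\<And>t x. t \<in> torus \<Longrightarrow> x \<in> U \<Longrightarrow> \<rho> t *v x \<in> U"
    by (auto simp: P_def)
  then obtain x where x: "x \<in> U" "x \<noteq> 0" using vec.subspace_0[of U] by blast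
  have ev: "\<exists>\<mu>. \<rho> t *v x = \<mu> *s x" if t: "t \<in> torus" for t
  proof -
    obtain y \<mu> where y: "y \<in> U" "y \<noteq> 0" "\<rho> t *v y = \<mu> *s y"
      using eigenvector_in_subspace[OF U(1) U(4)[OF t] x] by metis
    define U' where "U' = {z \<in> U. \<rho> t *v z = \<mu> *s z}"
    have "vec.subspace U'"
      using U(1) by (auto simp: U'_def vec.subspace_def matrix_vector_right_distrib vec.scale_right_distrib
          vector_smult_matrix_mult vector_smult_assoc mult.commute)
    moreover have "\<rho> s *v z \<in> U'" if "s \<in> torus" "z \<in> U'" for s z
    proof -
      have "\<rho> t *v (\<rho> s *v z) = \<rho> s *v (\<rho> t *v z)"
        using rep t that torus_commute[OF t \<open>s \<in> torus\<close>]
        by (metis torus_SU3 unitary_rep_mult_vector)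
      then show ?thesis using that U by (auto simp: U'_def vector_smult_matrix_mult)
    qed
    ultimately have "P U'" using U y by (auto simp: P_def U'_def)
    then have "U' = U"
      using min[of U'] U vec.subspace_dim_equal[of U' U] by (auto simp: P_def U'_def)
    then show ?thesis using x by (auto simp: U'_def)
  qed
  define ch where "ch t = cin (\<rho> t *v x) x / cin x x" for t
  have ch: "\<rho> t *v x = ch t *s x" if "t \<in> torus" for t
    using ev[OF that] x by (auto simp: ch_def cin_scale_left)
  have ch_mult: "ch (s ** t) = ch s * ch t" if "s \<in> torus" "t \<in> torus" for s t
  proof -
    have "ch (s ** t) *s x = \<rho> s *v (\<rho> t *v x)"
      using that ch[OF torus_mult[OF that]] rep by (simp add: unitary_rep_mult_vector torus_SU3)
    also have "\<dots> = (ch s * ch t) *s x"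
      using that by (simp add: ch vector_smult_matrix_mult vector_smult_assoc mult.commute)
    finally have "ch (s ** t) *s x = (ch s * ch t) *s x" .
    then show ?thesis using x by (simp add: vec.scale_cancel_right)
  qed
  have one: "ch (mat 1) = 1" using x rep by (simp add: ch_def unitary_rep_one)
  have cont: "continuous_on torus ch"
  proof -
    have "continuous_on torus \<rho>"
      using unitary_rep_D(1)[OF rep] torus_SU3 by (auto intro: continuous_on_subset)
    then show ?thesis
      unfolding ch_def cin_def matrix_vector_mult_def using x
      by (auto intro!: continuous_intros simp: cin_def[symmetric])
  qed
  have tor: "diag3 (cis a) (cis b) (cis (- a - b)) \<in> torus" for a b
    unfolding torus_def by (force simp: cis_mult)
  have char: "\<exists>n::int. \<forall>t. ch (diag3 (cis (a t)) (cis (b t)) (cis (- a t - b t))) = cis (of_int n * t)"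
    if a: "a = (\<lambda>t. t) \<and> b = (\<lambda>t. 0) \<or> a = (\<lambda>t. 0) \<and> b = (\<lambda>t. t)" for a b :: "real \<Rightarrow> real"
  proof -
    let ?d = "\<lambda>t. diag3 (cis (a t)) (cis (b t)) (cis (- a t - b t))"
    have "continuous_on UNIV a \<and> continuous_on UNIV b" using a by (auto intro: continuous_intros)
    then have "continuous_on UNIV ?d"
      unfolding diag3_eq
    proof (intro continuous_on_vec_lambda)
      fix i j :: 3
      assume "continuous_on UNIV a \<and> continuous_on UNIV b"
      then show "continuous_on UNIV (\<lambda>x. if i = j then if i = 1 then cis (a x)
          else if i = 2 then cis (b x) else cis (- a x - b x) else 0)"
        by (cases "i = j"; cases "i = 1"; cases "i = 2") (auto intro!: continuous_intros)
    qed
    then have "continuous_on UNIV (\<lambda>t. ch (?d t))"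
      using cont tor by (intro continuous_on_compose2[OF cont]) auto
    moreover have "ch (?d (s + t)) = ch (?d s) * ch (?d t)" for s t
    proof -
      have "?d (s + t) = ?d s ** ?d t" using a by (auto simp: diag3_mult cis_mult)
      then show ?thesis using ch_mult tor by simp
    qed
    moreover have "ch (?d 0) = 1" using a one by (auto simp: diag3_one)
    moreover have "cis (- (2 * pi)) = 1"
      by (metis cis_2pi cis_cnj complex_cnj_one)
    then have "?d (2 * pi) = mat 1" using a by (auto simp: diag3_one)
    then have "ch (?d (2 * pi)) = 1" using one by simp
    ultimately obtain n where "\<And>t. ch (?d t) = cis (of_int n * t)"
      using circle_character[of "\<lambda>t. ch (?d t)"] by metis
    then show ?thesis by blast
  qed
  obtain m :: int where m: "\<And>t. ch (diag3 (cis t) 1 (cis (- t))) = cis (of_int m * t)"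
    using char[of "\<lambda>t. t" "\<lambda>t. 0"] by auto
  obtain n :: int where n: "\<And>t. ch (diag3 1 (cis t) (cis (- t))) = cis (of_int n * t)"
    using char[of "\<lambda>t. 0" "\<lambda>t. t"] by auto
  \<comment> \<open>The character is t_1^m t_2^n = t_1^(m - n) (t_1 t_2)^n, which gives its
    coordinates in the fundamental weights.\<close>
  have "\<rho> t *v x = weight_char (m - n, n) t *s x" if t: "t \<in> torus" for t
  proof -
    obtain a b c where abc: "t = diag3 a b c" "cmod a = 1" "cmod b = 1" "a * b * c = 1"
      using t by (auto simp: torus_def)
    obtain \<alpha> \<beta> where ab: "a = cis \<alpha>" "b = cis \<beta>"
      using abc by (metis norm_1_cis)
    have "a * b \<noteq> 0" using abc by auto
    then have "c = inverse (a * b)" using abc(4) by (simp add: field_simps)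
    then have "c = cis (- \<alpha> - \<beta>)" by (simp add: ab cis_mult)
    then have "t = diag3 (cis \<alpha>) 1 (cis (- \<alpha>)) ** diag3 1 (cis \<beta>) (cis (- \<beta>))"
      using abc ab by (simp add: diag3_mult cis_mult)
    then have "ch t = cis (of_int m * \<alpha>) * cis (of_int n * \<beta>)"
      using ch_mult[OF tor[of \<alpha> 0] tor[of 0 \<beta>]] m n by simp
    also have "\<dots> = a powi m * b powi n"
      by (simp add: ab cis_power_int)
    also have "\<dots> = weight_char (m - n, n) t"
    proof -
      have "a powi m = a powi (m - n) * a powi n"
        using abc(2) by (subst power_int_add[symmetric]) auto
      then show ?thesis using abc by (simp add: weight_char_def power_int_mult_distrib)
    qed
    finally show ?thesis using ch[OF t] by simp
  qed
  then show ?thesis using x U(2) unfolding is_weight_def by blast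
qed

definition weight_vec :: "(complex^3^3 \<Rightarrow> complex^'n^'n) \<Rightarrow> int \<times> int \<Rightarrow> complex^'n \<Rightarrow> bool" where
  "weight_vec \<rho> w x \<longleftrightarrow> (\<forall>t\<in>torus. \<rho> t *v x = weight_char w t *s x)"

text \<open>Otherwise the orthogonal complement, inside S, of the span of the weight vectors is
  nonzero. By unitarity it is torus-stable, so it contains a weight vector, which is orthogonal to
  itself.\<close>

lemma torus_subspace_span:
  fixes \<rho> :: "complex^3^3 \<Rightarrow> complex^'n^'n"
  assumes rep: "unitary_rep \<rho>" and S: "vec.subspace S"
    and inv: "\<And>t x. t \<in> torus \<Longrightarrow> x \<in> S \<Longrightarrow> \<rho> t *v x \<in> S"
  shows "S \<subseteq> vec.span {x \<in> S. \<exists>w. weight_vec \<rho> w x}"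
proof (rule ccontr)
  define U where "U = vec.span {x \<in> S. \<exists>w. weight_vec \<rho> w x}"
  assume "\<not> S \<subseteq> vec.span {x \<in> S. \<exists>w. weight_vec \<rho> w x}"
  then obtain x where x: "x \<in> S" "x \<notin> U" by (auto simp: U_def)
  have U: "vec.subspace U" by (simp add: U_def)
  have US: "U \<subseteq> S" unfolding U_def by (rule vec.span_minimal) (use S in auto)
  have Uinv: "\<rho> t *v x \<in> U" if t: "t \<in> torus" and x: "x \<in> U" for t x
  proof (rule mult_span_subset[OF U _ x[unfolded U_def]])
    fix y assume y: "y \<in> {x \<in> S. \<exists>w. weight_vec \<rho> w x}"
    then obtain w where "weight_vec \<rho> w y" by blast
    moreover have "y \<in> U" unfolding U_def using y by (intro vec.span_base)
    ultimately show "\<rho> t *v y \<in> U" using t U by (simp add: weight_vec_def vec.subspace_scale)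
  qed
  obtain y z where yz: "y \<in> U" "x = y + z" "\<And>u. u \<in> U \<Longrightarrow> cin z u = 0"
    using vec_subspace_orth_decomp[OF U, of x] by metis
  define V where "V = {z \<in> S. \<forall>u\<in>U. cin z u = 0}"
  have "z \<in> S" using yz x US S vec.subspace_diff[of S x y] by auto
  moreover have "z \<noteq> 0" using yz x by auto
  ultimately have "z \<in> V" "V \<noteq> {0}" using yz by (auto simp: V_def)
  moreover have "vec.subspace V"
    using S by (auto simp: V_def vec.subspace_def cin_add_left cin_scale_left)
  moreover have "\<rho> t *v z \<in> V" if "t \<in> torus" "z \<in> V" for t z
    using that inv Uinv[OF torus_cadj] by (auto simp: V_def unitary_rep_cin_left[OF rep] torus_SU3)
  ultimately obtain w v where v: "v \<in> V" "v \<noteq> 0" "weight_vec \<rho> w v"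
    using torus_weight_exists[OF rep, of V] by (auto simp: is_weight_def weight_vec_def)
  then have "v \<in> U" unfolding U_def V_def by (intro vec.span_base) blast
  then show False using v by (auto simp: V_def)
qed

section \<open>Matrices in SU(3) with given first column\<close>

lemma cmod_eq_1I: "(cmod a)\<^sup>2 = 1 \<Longrightarrow> cmod a = 1"
  using norm_ge_zero[of a] by (auto simp: power2_eq_1_iff simp del: norm_ge_zero)

text \<open>For determinant one the inverse is the adjugate matrix, and by unitarity it is also the
  adjoint; these are three entries of that equality.\<close>

lemma SU3_cofactors:
  assumes "g \<in> SU3"
  shows "cnj (g $ 1 $ 1) = g $ 2 $ 2 * g $ 3 $ 3 - g $ 2 $ 3 * g $ 3 $ 2"
    "cnj (g $ 2 $ 2) = g $ 1 $ 1 * g $ 3 $ 3 - g $ 1 $ 3 * g $ 3 $ 1"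
    "cnj (g $ 2 $ 3) = g $ 1 $ 2 * g $ 3 $ 1 - g $ 1 $ 1 * g $ 3 $ 2"
proof -
  define C :: "complex^3^3" where "C = vector
    [vector [g $ 2 $ 2 * g $ 3 $ 3 - g $ 2 $ 3 * g $ 3 $ 2, g $ 1 $ 3 * g $ 3 $ 2 - g $ 1 $ 2 * g $ 3 $ 3,
             g $ 1 $ 2 * g $ 2 $ 3 - g $ 1 $ 3 * g $ 2 $ 2],
     vector [g $ 2 $ 3 * g $ 3 $ 1 - g $ 2 $ 1 * g $ 3 $ 3, g $ 1 $ 1 * g $ 3 $ 3 - g $ 1 $ 3 * g $ 3 $ 1,
             g $ 1 $ 3 * g $ 2 $ 1 - g $ 1 $ 1 * g $ 2 $ 3],
     vector [g $ 2 $ 1 * g $ 3 $ 2 - g $ 2 $ 2 * g $ 3 $ 1, g $ 1 $ 2 * g $ 3 $ 1 - g $ 1 $ 1 * g $ 3 $ 2,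
             g $ 1 $ 1 * g $ 2 $ 2 - g $ 1 $ 2 * g $ 2 $ 1]]"
  have "g ** C = mscale (det g) (mat 1)"
    by (simp add: vec_eq_iff forall_3 matrix_matrix_mult_def sum_3 C_def det_3 mat_def) (simp add: algebra_simps)
  also have "\<dots> = mat 1" using SU3_D[OF assms] by (simp add: vec_eq_iff)
  finally have "cadj g ** (g ** C) = cadj g" by simp
  then have "C = cadj g" using assms by (simp add: matrix_mul_assoc SU3_cancel)
  then have "C $ i $ j = cadj g $ i $ j" for i j by simp
  from this[of 1 1] this[of 2 2] this[of 3 2]
  show "cnj (g $ 1 $ 1) = g $ 2 $ 2 * g $ 3 $ 3 - g $ 2 $ 3 * g $ 3 $ 2"
    "cnj (g $ 2 $ 2) = g $ 1 $ 1 * g $ 3 $ 3 - g $ 1 $ 3 * g $ 3 $ 1"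
    "cnj (g $ 2 $ 3) = g $ 1 $ 2 * g $ 3 $ 1 - g $ 1 $ 1 * g $ 3 $ 2"
    by (simp_all add: C_def)
qed

lemma SU3_column_norm:
  assumes "g \<in> SU3"
  shows "(cmod (g $ 1 $ 1))\<^sup>2 + (cmod (g $ 2 $ 1))\<^sup>2 + (cmod (g $ 3 $ 1))\<^sup>2 = 1"
proof -
  have "norm (g *v axis 1 1) = 1"
    using unitary_norm[OF SU3_D(1)[OF assms]] by simp
  then have "(norm (g *v axis 1 1))\<^sup>2 = 1" by simp
  then show ?thesis by (simp add: norm_vec3 mat1_axis)
qed

lemma SU3_row_norm:
  assumes "g \<in> SU3"
  shows "(cmod (g $ 1 $ 1))\<^sup>2 + (cmod (g $ 1 $ 2))\<^sup>2 + (cmod (g $ 1 $ 3))\<^sup>2 = 1"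
  using SU3_column_norm[OF SU3_cadj[OF assms]] by simp

text \<open>A corner of modulus one exhausts the norm of its row and of its column.\<close>

lemma SU3_fixes_line:
  assumes g: "g \<in> SU3" and 1: "cmod (g $ 1 $ 1) = 1"
  shows "g $ 2 $ 1 = 0" "g $ 3 $ 1 = 0" "g $ 1 $ 2 = 0" "g $ 1 $ 3 = 0"
  using SU3_column_norm[OF g] SU3_row_norm[OF g] 1
  by (simp_all add: add_nonneg_eq_0_iff)

lemma SU3_fixes_e1:
  assumes g: "g \<in> SU3" and 1: "g $ 1 $ 1 = 1"
  shows "\<exists>a b. (cmod a)\<^sup>2 + (cmod b)\<^sup>2 = 1 \<and> g = su2_23 a b"
proof -
  note z = SU3_fixes_line[OF g]
  have c: "g $ 3 $ 3 = cnj (g $ 2 $ 2)" "g $ 2 $ 3 = - cnj (g $ 3 $ 2)"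
    using SU3_cofactors(2,3)[OF g] z 1 by (simp_all, metis complex_cnj_cnj complex_cnj_minus)
  have "g = su2_23 (g $ 2 $ 2) (g $ 3 $ 2)"
    using c z 1 by (simp add: vec_eq_iff forall_3)
  moreover have "(cmod (g $ 2 $ 2))\<^sup>2 + (cmod (g $ 3 $ 2))\<^sup>2 = 1"
  proof -
    have "g $ 2 $ 2 * cnj (g $ 2 $ 2) + g $ 3 $ 2 * cnj (g $ 3 $ 2) = 1"
      using SU3_cofactors(1)[OF g] c 1 by (simp add: mult.commute)
    then have "complex_of_real ((cmod (g $ 2 $ 2))\<^sup>2 + (cmod (g $ 3 $ 2))\<^sup>2) = of_real 1"
      by (simp only: complex_norm_square of_real_add of_real_1)
    then show ?thesis by (simp only: of_real_eq_iff)
  qed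
  ultimately show ?thesis by blast
qed

text \<open>The entry r can be kept real because SU(2) on the last two coordinates turns (r, 0) into
  any vector of length r. Products of the two kinds thus realise every possible first
  column.\<close>

definition su2_12 :: "complex \<Rightarrow> real \<Rightarrow> complex^3^3" where
  "su2_12 c r = vector [vector [c, - of_real r, 0], vector [of_real r, cnj c, 0], vector [0, 0, 1]]"

lemma su2_12_component [simp]:
  "su2_12 c r $ 1 = vector [c, - of_real r, 0]" "su2_12 c r $ 2 = vector [of_real r, cnj c, 0]"
  "su2_12 c r $ 3 = vector [0, 0, 1]"
  by (simp_all add: su2_12_def)

lemma su2_12_SU3:
  assumes "(cmod c)\<^sup>2 + r\<^sup>2 = 1"
  shows "su2_12 c r \<in> SU3"
proof -
  have *: "c * cnj c + of_real r * of_real r = 1"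
    using arg_cong[OF assms, of complex_of_real]
    by (simp only: complex_norm_square of_real_add of_real_1) (simp add: power2_eq_square)
  then show ?thesis
    by (auto simp: SU3_def vec_eq_iff forall_3 matrix_matrix_mult_def sum_3 mat_def det_3 mult.commute
        add.commute intro!: unitary_matI)
qed

lemma su2_column:
  assumes "r > 0" "(cmod x)\<^sup>2 + (cmod y)\<^sup>2 = r\<^sup>2"
  shows "(cmod (x / of_real r))\<^sup>2 + (cmod (y / of_real r))\<^sup>2 = 1"
    "(su2_23 (x / of_real r) (y / of_real r) ** su2_12 c r) $ 1 $ 1 = c"
    "(su2_23 (x / of_real r) (y / of_real r) ** su2_12 c r) $ 2 $ 1 = x"
    "(su2_23 (x / of_real r) (y / of_real r) ** su2_12 c r) $ 3 $ 1 = y"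
  using assms by (simp_all add: norm_divide power_divide matrix_matrix_mult_def sum_3
      flip: add_divide_distrib)

lemma torus_first: "cmod c = 1 \<Longrightarrow> diag3 c (cnj c) 1 \<in> torus"
  unfolding torus_def
  by (rule CollectI, intro exI[of _ c] exI[of _ "cnj c"] exI[of _ 1])
    (simp flip: complex_norm_square)

lemma SU3_first_column:
  fixes z :: "complex^3"
  assumes "norm z = 1"
  obtains g where "g \<in> SU3" "g *v axis 1 1 = z"
proof -
  define r where "r = sqrt ((cmod (z $ 2))\<^sup>2 + (cmod (z $ 3))\<^sup>2)"
  have r2: "(cmod (z $ 2))\<^sup>2 + (cmod (z $ 3))\<^sup>2 = r\<^sup>2" by (simp add: r_def)
  have z1: "(cmod (z $ 1))\<^sup>2 + r\<^sup>2 = 1" using assms norm_vec3[of z] r2 by simp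
  show thesis
  proof (cases "r = 0")
    case True
    then have "z $ 2 = 0" "z $ 3 = 0" using r2 by (simp_all add: add_nonneg_eq_0_iff)
    moreover have "cmod (z $ 1) = 1" using z1 True by (intro cmod_eq_1I) simp
    ultimately show thesis
      using that[of "diag3 (z $ 1) (cnj (z $ 1)) 1"] torus_first torus_SU3
      by (simp add: mat1_axis vec_eq_iff forall_3)
  next
    case False
    then have "r > 0" by (simp add: r_def add_nonneg_nonneg order_less_le)
    from su2_column(1)[OF this r2] su2_column(2-4)[OF this r2, of "z $ 1"] show thesis
      using that[OF SU3_mult[OF su2_23_SU3 su2_12_SU3[OF z1]]]
      by (simp add: mat1_axis vec_eq_iff forall_3)
  qed
qed

section \<open>The matrix coefficient of an extreme weight vector\<close>

lemma infinite_unit_circle: "infinite {z. cmod z = 1}"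
proof
  assume "finite {z. cmod z = 1}"
  moreover have "(\<lambda>t. cis t) ` {0..1} \<subseteq> {z. cmod z = 1}" by auto
  ultimately have "finite ((\<lambda>t. cis t) ` {0..1})" by (rule rev_finite_subset)
  moreover have "inj_on (\<lambda>t. cis t) {0..1}"
  proof (rule inj_onI)
    fix s t :: real assume "s \<in> {0..1}" "t \<in> {0..1}" "cis s = cis t"
    then have "cos s = cos t" "0 \<le> s" "s \<le> pi" "0 \<le> t" "t \<le> pi"
      using pi_gt3 by (auto simp: complex_eq_iff)
    then show "s = t" using cos_inj_pi by blast
  qed
  ultimately show False using finite_imageD[of cis "{0..1}"] infinite_Icc[of "0::real" 1] by simp
qed

lemma poly_eq_on_circle:
  fixes q r :: "complex poly"
  assumes "\<And>z. cmod z = 1 \<Longrightarrow> poly q z = poly r z"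
  shows "q = r"
proof (rule ccontr)
  assume "q \<noteq> r"
  then have "finite {z. poly (q - r) z = 0}" by (intro poly_roots_finite) simp
  moreover have "{z. cmod z = 1} \<subseteq> {z. poly (q - r) z = 0}" using assms by auto
  ultimately show False using infinite_unit_circle finite_subset by blast
qed

lemma poly_eq_sum_le: "degree q \<le> n \<Longrightarrow> poly (q :: complex poly) x = (\<Sum>j\<le>n. coeff q j * x ^ j)"
  unfolding poly_altdef by (rule sum.mono_neutral_left) (auto simp: coeff_eq_0)

text \<open>Multiplied by u^p, the hypothesis becomes l1^p q' = l2^p q on the circle, hence as
  polynomials, where q' has the coefficients of q in reverse order. The root of \<open>l2\<close> is
  the inverse of the root of \<open>l1\<close>, and s < 1/2 keeps the two apart. So l1^p divides q;
  the degree bound leaves a constant factor, which q(1) = 1 determines.\<close>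

lemma poly_reflected_symmetry:
  fixes q :: "complex poly" and s :: real and u :: complex
  assumes deg: "degree q \<le> p" and s: "0 < s" "s < 1/2" and q1: "poly q 1 = 1"
    and sym: "\<And>u :: complex. cmod u = 1 \<Longrightarrow>
      (1 - s + s * u) ^ p * poly q (cnj u) = (1 - s + s * cnj u) ^ p * poly q u"
  shows "poly q u = (1 - s + s * u) ^ p"
proof -
  define q' where "q' = (\<Sum>j\<le>p. monom (coeff q j) (p - j))"
  have q': "poly q' u = u ^ p * poly q (cnj u)" if "cmod u = 1" for u
  proof -
    have u: "u * cnj u = 1" using that by (simp flip: complex_norm_square)
    have "poly q' u = (\<Sum>j\<le>p. coeff q j * u ^ (p - j))"
      by (simp add: q'_def poly_sum poly_monom)
    also have "\<dots> = (\<Sum>j\<le>p. u ^ p * (coeff q j * cnj u ^ j))"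
    proof (rule sum.cong[OF refl])
      fix j assume "j \<in> {..p}"
      then have "u ^ p * cnj u ^ j = u ^ (p - j) * (u * cnj u) ^ j"
        by (simp add: power_mult_distrib flip: power_add)
      then show "coeff q j * u ^ (p - j) = u ^ p * (coeff q j * cnj u ^ j)"
        using u by (simp add: mult_ac)
    qed
    also have "\<dots> = u ^ p * poly q (cnj u)"
      using deg by (simp add: poly_eq_sum_le sum_distrib_left)
    finally show ?thesis .
  qed
  define l1 where "l1 = [:1 - of_real s, of_real s :: complex:]"
  define l2 where "l2 = [:of_real s, 1 - of_real s :: complex:]"
  have eq: "l1 ^ p * q' = l2 ^ p * q"
  proof (rule poly_eq_on_circle)
    fix u :: complex assume u: "cmod u = 1"
    then have "u * cnj u = 1" by (simp flip: complex_norm_square)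
    then have l2: "poly l2 u = u * (1 - s + s * cnj u)"
      by (simp add: l2_def algebra_simps)
    have "poly (l1 ^ p * q') u = u ^ p * ((1 - s + s * u) ^ p * poly q (cnj u))"
      using q'[OF u] by (simp add: l1_def mult_ac)
    also have "\<dots> = poly (l2 ^ p * q) u"
      using sym[OF u] by (simp add: l2 power_mult_distrib)
    finally show "poly (l1 ^ p * q') u = poly (l2 ^ p * q) u" .
  qed
  define r :: complex where "r = - (1 - of_real s) / of_real s"
  have sr: "of_real s * r = of_real s - 1" using s by (simp add: r_def)
  have l1: "l1 = smult (of_real s) [:-r, 1:]" by (simp add: l1_def sr)
  have "q \<noteq> 0" using q1 by auto
  have "poly l2 r \<noteq> 0"
  proof
    assume "poly l2 r = 0"
    then have "of_real s * (of_real s + r * (1 - of_real s)) = (0::complex)" by (simp add: l2_def)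
    then have "of_real s * of_real s + (of_real s - 1) * (1 - of_real s) = (0::complex)"
      by (simp add: sr[symmetric] algebra_simps)
    then have "complex_of_real (s * s + (s - 1) * (1 - s)) = of_real 0" by simp
    then have "s * s + (s - 1) * (1 - s) = 0" by (simp only: of_real_eq_iff)
    then show False using s by (simp add: algebra_simps)
  qed
  then have ord2: "order r (l2 ^ p) = 0" "l2 \<noteq> 0"
    by (auto intro!: order_0I)
  have "[:-r, 1:] ^ p dvd l2 ^ p * q"
    unfolding eq[symmetric] l1 smult_power using s by (simp add: smult_dvd_iff dvd_mult2 dvd_smult)
  then have "p \<le> order r (l2 ^ p * q)" using \<open>q \<noteq> 0\<close> ord2 by (simp add: order_divides)
  then have "p \<le> order r q" using \<open>q \<noteq> 0\<close> ord2 by (simp add: order_mult)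
  then have "[:-r, 1:] ^ p dvd q" by (simp add: order_divides)
  then obtain c where c: "q = [:-r, 1:] ^ p * c" by (elim dvdE)
  then have "c \<noteq> 0" using \<open>q \<noteq> 0\<close> by auto
  then have "degree q = p + degree c"
    unfolding c by (subst degree_mult_eq) (auto simp: degree_linear_power)
  then obtain c0 where c0: "c = [:c0:]" using deg degree_eq_zeroE[of c] by auto
  have "of_real s * (1 - r) = 1" using sr by (simp add: algebra_simps)
  then have sr1: "of_real s ^ p * (1 - r) ^ p = 1" by (simp flip: power_mult_distrib)
  have "(1 - r) ^ p * c0 = 1" using q1 by (simp add: c c0 mult.commute)
  then have "of_real s ^ p = of_real s ^ p * ((1 - r) ^ p * c0)" by simp
  also have "\<dots> = c0" using sr1 by (simp flip: mult.assoc)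
  finally have "c0 = of_real s ^ p" ..
  then have "poly q u = (of_real s * (u - r)) ^ p"
    by (simp add: c c0 power_mult_distrib mult.commute)
  also have "of_real s * (u - r) = 1 - s + s * u" using sr by (simp add: algebra_simps)
  finally show ?thesis .
qed

text \<open>Common normal form of both families, reached by (0, p) after conjugating the group. What
  the highest weight of \<open>\<rho>\<close> contributes is condensed into the assumption that all
  weights are monomials of degree p.\<close>

locale sym_power_rep =
  fixes \<rho> :: "complex^3^3 \<Rightarrow> complex^'n^'n" and p :: nat and v :: "complex^'n"
  assumes rep: "unitary_rep \<rho>" and p: "p \<ge> 1"
    and weights: "\<And>x w. x \<noteq> 0 \<Longrightarrow> weight_vec \<rho> w x \<Longrightarrow> \<exists>k l m. k + l + m = p \<and>
      (\<forall>t\<in>torus. weight_char w t = t $ 1 $ 1 ^ k * t $ 2 $ 2 ^ l * t $ 3 $ 3 ^ m)"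
    and norm_v: "norm v = 1" and v: "\<And>t. t \<in> torus \<Longrightarrow> \<rho> t *v v = (t $ 1 $ 1) ^ p *s v"
    and irreducible: "\<And>U. vec.subspace U \<Longrightarrow> (\<And>g x. g \<in> SU3 \<Longrightarrow> x \<in> U \<Longrightarrow> \<rho> g *v x \<in> U) \<Longrightarrow>
      U = {0} \<or> U = UNIV"
begin

lemma cin_v [simp]: "cin v v = 1"
  by (simp add: cin_self norm_v)

lemmas rep_mult = unitary_rep_mult_vector[OF rep]
lemmas rep_cin = unitary_rep_cin_left[OF rep]

text \<open>For u of modulus one this is \<open>cnj u\<close> times diag(u^3, 1, 1), the scalar
  making the determinant one. It is the source of the factors \<open>u ^ p\<close> and of the
  variable \<open>u ^ 3\<close> below.\<close>

definition circ :: "complex \<Rightarrow> complex^3^3" where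
  "circ u = diag3 (u\<^sup>2) (cnj u) (cnj u)"

lemma circ_torus: "cmod u = 1 \<Longrightarrow> circ u \<in> torus"
proof -
  assume "cmod u = 1"
  then have "u * cnj u = 1" by (simp flip: complex_norm_square)
  then have "u\<^sup>2 * cnj u * cnj u = 1" by (simp add: power2_eq_square mult_ac)
  then show ?thesis unfolding torus_def circ_def using \<open>cmod u = 1\<close>
    by (intro CollectI exI[of _ "u\<^sup>2"] exI[of _ "cnj u"]) (simp add: norm_power)
qed

lemma circ_monomial:
  assumes "cmod u = 1" "k + l + m = p"
  shows "u ^ p * (circ u $ 1 $ 1 ^ k * circ u $ 2 $ 2 ^ l * circ u $ 3 $ 3 ^ m) = (u ^ 3) ^ k"
proof -
  have u: "u * cnj u = 1" using assms by (simp flip: complex_norm_square)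
  have "u ^ p * (circ u $ 1 $ 1 ^ k * circ u $ 2 $ 2 ^ l * circ u $ 3 $ 3 ^ m)
      = u ^ k * (u\<^sup>2) ^ k * ((u * cnj u) ^ l * (u * cnj u) ^ m)"
    unfolding assms(2)[symmetric] by (simp add: circ_def power_add power_mult_distrib mult_ac)
  also have "\<dots> = (u * u\<^sup>2) ^ k" by (simp add: u power_mult_distrib)
  also have "u * u\<^sup>2 = u ^ 3" by (simp add: power3_eq_cube power2_eq_square)
  finally show ?thesis .
qed

text \<open>Expand x in weight vectors. By \<open>circ_monomial\<close> a weight t_1^k t_2^l t_3^m
  contributes a multiple of the k-th power of \<open>u ^ 3\<close>, and k is at most p.\<close>

lemma circ_polynomial:
  "\<exists>q. degree q \<le> p \<and> (\<forall>u. cmod u = 1 \<longrightarrow> u ^ p * cin (\<rho> (circ u) *v x) y = poly q (u ^ 3))"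
proof -
  have "UNIV \<subseteq> vec.span {x \<in> UNIV. \<exists>w. weight_vec \<rho> w x}"
    by (rule torus_subspace_span[OF rep]) (auto simp: vec.subspace_UNIV)
  then have "x \<in> vec.span {x. \<exists>w. weight_vec \<rho> w x}" by auto
  then show ?thesis
  proof (induction rule: vec.span_induct_alt)
    case base
    show ?case by (intro exI[of _ 0]) simp
  next
    case (step c x z)
    then obtain q where q: "degree q \<le> p"
      "\<And>u. cmod u = 1 \<Longrightarrow> u ^ p * cin (\<rho> (circ u) *v z) y = poly q (u ^ 3)" by blast
    show ?case
    proof (cases "x = 0")
      case True
      with q show ?thesis by auto
    next
      case False
      obtain w where w: "weight_vec \<rho> w x" using step by auto
      obtain k l m where klm: "k + l + m = p"
        "\<And>t. t \<in> torus \<Longrightarrow> weight_char w t = t $ 1 $ 1 ^ k * t $ 2 $ 2 ^ l * t $ 3 $ 3 ^ m"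
        using weights[OF False w] by blast
      let ?q = "monom (c * cin x y) k + q"
      have "u ^ p * cin (\<rho> (circ u) *v (c *s x + z)) y = poly ?q (u ^ 3)" if u: "cmod u = 1" for u
      proof -
        have "u ^ p * cin (\<rho> (circ u) *v (c *s x)) y = c * cin x y * (u ^ p * weight_char w (circ u))"
          using w circ_torus[OF u]
          by (simp add: weight_vec_def vector_smult_matrix_mult vector_smult_assoc cin_scale_left mult_ac)
        also have "u ^ p * weight_char w (circ u) = (u ^ 3) ^ k"
          using klm(2)[OF circ_torus[OF u]] circ_monomial[OF u klm(1)] by simp
        finally show ?thesis
          using q(2)[OF u] by (simp add: matrix_vector_right_distrib cin_add_left distrib_left poly_monom)
      qed
      moreover have "degree ?q \<le> p"
        using klm(1) q(1) degree_monom_le[of "c * cin x y" k] by (intro degree_add_le) auto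
      ultimately show ?thesis by blast
    qed
  qed
qed

section \<open>The stabiliser of the extreme weight vector\<close>

definition SU2 :: "(complex^3^3) set" where
  "SU2 = {su2_23 a b | a b. (cmod a)\<^sup>2 + (cmod b)\<^sup>2 = 1}"

lemma SU2_SU3: "k \<in> SU2 \<Longrightarrow> k \<in> SU3"
  by (auto simp: SU2_def su2_23_SU3)

lemma SU2_iff: "k \<in> SU2 \<longleftrightarrow> k \<in> SU3 \<and> k $ 1 $ 1 = 1"
  by (auto simp: SU2_def su2_23_SU3 dest!: SU3_fixes_e1)

lemma SU2_cadj: "k \<in> SU2 \<Longrightarrow> cadj k \<in> SU2"
  unfolding SU2_iff by (auto simp: SU3_cadj)

text \<open>The diagonal subgroup acts on the span of the \<open>SU2\<close>-orbit of \<open>v\<close> by the weight of \<open>v\<close> alone,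
  because \<^const>\<open>circ\<close> commutes with \<open>SU2\<close> and \<open>t\<^sub>1\<^sup>p\<close> is the only monomial of degree \<open>p\<close>
  with its value there.\<close>
lemma torus_on_SU2_orbit:
  assumes t: "t \<in> torus" and k: "k \<in> SU2"
  shows "\<rho> t *v (\<rho> k *v v) = (t $ 1 $ 1) ^ p *s (\<rho> k *v v)"
proof -
  define U where "U = vec.span ((\<lambda>k. \<rho> k *v v) ` SU2)"
  have U: "vec.subspace U" by (simp add: U_def)
  have kU: "\<rho> k *v v \<in> U" if "k \<in> SU2" for k
    unfolding U_def using that by (intro vec.span_base) blast
  have base: "\<rho> t *v (\<rho> k *v v) \<in> U" if t: "t \<in> torus" and k: "k \<in> SU2" for t k
  proof -
    have "t ** k ** cadj t \<in> SU2"
      using t k torus_SU3[OF t] torus_SU3[OF torus_cadj[OF t]] SU2_SU3[OF k]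
      unfolding SU2_iff
    proof (intro conjI SU3_mult)
      show "(t ** k ** cadj t) $ 1 $ 1 = 1" if "k \<in> SU3 \<and> k $ 1 $ 1 = 1"
        using t that by (auto simp: torus_def matrix_matrix_mult_def sum_3 simp flip: complex_norm_square)
    qed auto
    moreover have "t ** k = (t ** k ** cadj t) ** t"
      using torus_SU3[OF t] by (simp add: SU3_cancel flip: matrix_mul_assoc)
    then have "\<rho> t *v (\<rho> k *v v) = (t $ 1 $ 1) ^ p *s (\<rho> (t ** k ** cadj t) *v v)"
      using t torus_SU3[OF t] SU2_SU3[OF k] SU2_SU3[OF calculation] v[OF t]
      by (metis rep_mult vector_smult_matrix_mult)
    ultimately show ?thesis using kU U by (simp add: vec.subspace_scale)
  qed
  have inv: "\<rho> t *v x \<in> U" if t: "t \<in> torus" and x: "x \<in> U" for t x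
    by (rule mult_span_subset[OF U _ x[unfolded U_def]]) (use base t in blast)
  have circ: "\<rho> (circ u) *v x = (u\<^sup>2) ^ p *s x" if u: "cmod u = 1" and x: "x \<in> U" for u x
  proof (rule eigenvector_span[OF _ x[unfolded U_def]])
    fix y assume "y \<in> (\<lambda>k. \<rho> k *v v) ` SU2"
    then obtain k where k: "y = \<rho> k *v v" "k \<in> SU2" by auto
    then have "circ u ** k = k ** circ u"
      by (auto simp: SU2_def circ_def vec_eq_iff forall_3 matrix_matrix_mult_def sum_3)
    then have "\<rho> (circ u) *v y = \<rho> k *v (\<rho> (circ u) *v v)"
      using k torus_SU3[OF circ_torus[OF u]] SU2_SU3 by (metis rep_mult)
    then show "\<rho> (circ u) *v y = (u\<^sup>2) ^ p *s y"
      using v[OF circ_torus[OF u]] k by (simp add: circ_def vector_smult_matrix_mult)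
  qed
  have weight: "\<rho> t *v x = (t $ 1 $ 1) ^ p *s x" if x: "x \<in> U" "weight_vec \<rho> w x" and t: "t \<in> torus" for x w t
  proof (cases "x = 0")
    case False
    then obtain k l m where klm: "k + l + m = p"
      "\<And>t. t \<in> torus \<Longrightarrow> weight_char w t = t $ 1 $ 1 ^ k * t $ 2 $ 2 ^ l * t $ 3 $ 3 ^ m"
      using weights[OF False x(2)] by blast
    \<comment> \<open>A single group element separates the weights: \<open>u ^ 3\<close> has angle
      pi/p, so its power with exponent l + m \<le> p has angle at most pi and equals 1 only if l + m
      = 0.\<close>
    define u where "u = cis (pi / (3 * p))"
    have u: "cmod u = 1" by (simp add: u_def)
    have "weight_char w (circ u) *s x = (u\<^sup>2) ^ p *s x"
      using circ[OF u x(1)] x(2) circ_torus[OF u] by (simp add: weight_vec_def)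
    then have "u ^ p * weight_char w (circ u) = u ^ p * (u\<^sup>2) ^ p" using False by simp
    then have "(u ^ 3) ^ k = u ^ p * (u\<^sup>2) ^ p"
      using klm(2)[OF circ_torus[OF u]] circ_monomial[OF u klm(1)] by simp
    also have "\<dots> = (u ^ 3) ^ p"
      by (simp add: power3_eq_cube power2_eq_square power_mult_distrib)
    finally have "(u ^ 3) ^ k = (u ^ 3) ^ k * (u ^ 3) ^ (l + m)"
      using klm(1) by (metis add.assoc power_add)
    moreover have "u \<noteq> 0" using u by auto
    ultimately have "(u ^ 3) ^ (l + m) = 1" by simp
    moreover have "u ^ 3 = cis (pi / p)" using p by (simp add: u_def Complex.DeMoivre)
    ultimately have "cis (real (l + m) * (pi / p)) = 1" by (simp only: Complex.DeMoivre)
    moreover define th where "th = real (l + m) * (pi / p)"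
    ultimately have "cos th = cos 0" by (simp add: complex_eq_iff)
    moreover have "th \<le> pi"
    proof -
      have "real (l + m) / p \<le> 1" using klm(1) p by simp
      then show ?thesis using mult_right_mono[of "real (l + m) / p" 1 pi] by (simp add: th_def)
    qed
    moreover have "0 \<le> th" by (simp add: th_def)
    ultimately have "th = 0" using cos_inj_pi[of th 0] by simp
    then have "l + m = 0" using p by (simp add: th_def)
    then have "l = 0" "m = 0" by simp_all
    then show ?thesis using klm t x(2) by (simp add: weight_vec_def)
  qed simp
  have "U \<subseteq> vec.span {x \<in> U. \<exists>w. weight_vec \<rho> w x}"
    by (rule torus_subspace_span[OF rep U]) (use inv in auto)
  then have "\<rho> k *v v \<in> vec.span {x \<in> U. \<exists>w. weight_vec \<rho> w x}" using kU[OF k] by blast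
  then show ?thesis by (rule eigenvector_span[rotated]) (use weight t in blast)
qed

text \<open>A diagonal element of \<open>SU2\<close> has first entry 1, so by
  \<open>torus_on_SU2_orbit\<close> it fixes the whole \<open>SU2\<close>-orbit of v. Every element
  of \<open>SU2\<close> is conjugate to a diagonal one inside \<open>SU2\<close>; the proof
  diagonalises it explicitly.\<close>

lemma SU2_fixes_v:
  assumes k: "k \<in> SU2"
  shows "\<rho> k *v v = v"
proof -
  obtain a b where ab: "k = su2_23 a b" "(cmod a)\<^sup>2 + (cmod b)\<^sup>2 = 1"
    using k by (auto simp: SU2_def)
  have tor: "su2_23 u 0 \<in> torus" if "cmod u = 1" for u
  proof -
    have "su2_23 u 0 = diag3 1 u (cnj u)" by (simp add: vec_eq_iff forall_3)
    moreover have "u * cnj u = 1" using that by (simp flip: complex_norm_square)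
    ultimately show ?thesis using that unfolding torus_def by force
  qed
  show ?thesis
  proof (cases "b = 0")
    case True
    then have "cmod a = 1" using ab(2) by (intro cmod_eq_1I) simp
    then show ?thesis using v[OF tor] ab True by simp
  next
    case False
    \<comment> \<open>An eigenvalue of the 2 x 2 block: it has modulus one and u + cnj u is the
      trace of the block.\<close>
    define u where "u = Complex (Re a) (sqrt (1 - (Re a)\<^sup>2))"
    have "(Re a)\<^sup>2 \<le> (cmod a)\<^sup>2" by (simp add: cmod_power2)
    then have Re_a: "(Re a)\<^sup>2 \<le> 1" using ab(2) by (smt (verit) zero_le_power2)
    then have u1: "cmod u = 1" by (simp add: u_def complex_norm)
    then have uu: "u * cnj u = 1" by (simp flip: complex_norm_square)
    have ua: "u + cnj u = a + cnj a" by (simp add: u_def complex_eq_iff)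
    have aabb: "a * cnj a + b * cnj b = 1"
      using arg_cong[OF ab(2), of complex_of_real] by (simp only: complex_norm_square of_real_add of_real_1)
    define n where "n = sqrt ((cmod b)\<^sup>2 + (cmod (a - u))\<^sup>2)"
    have "n > 0" using False by (simp add: n_def add_pos_nonneg)
    \<comment> \<open>The vector (cnj b, a - u) is an eigenvector of the block for u; q has it,
      normalised, as the first column of its own block.\<close>
    define q where "q = su2_23 (cnj b / of_real n) ((a - u) / of_real n)"
    have "(cmod (cnj b / of_real n))\<^sup>2 + (cmod ((a - u) / of_real n))\<^sup>2 = 1"
      by (rule su2_column(1)[OF \<open>n > 0\<close>]) (simp add: n_def)
    then have q: "q \<in> SU2" by (auto simp: q_def SU2_def)
    let ?d = "su2_23 u 0"
    have "k ** q = q ** ?d"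
    proof -
      have "a * cnj b - cnj b * (a - u) = cnj b * u" by (simp add: algebra_simps)
      moreover have "b * cnj b + cnj a * (a - u) = (a - u) * u"
      proof -
        have "b * cnj b + cnj a * (a - u) - (a - u) * u = 1 - u * (a + cnj a - u)"
          using aabb by (simp add: algebra_simps)
        also have "\<dots> = 0" using ua uu by (metis add_diff_cancel_left' cancel_comm_monoid_add_class.diff_cancel)
        finally show ?thesis by simp
      qed
      moreover have "a * (cnj b / of_real n) - cnj b * ((a - u) / of_real n)
          = (a * cnj b - cnj b * (a - u)) / of_real n"
        "b * (cnj b / of_real n) + cnj a * ((a - u) / of_real n)
          = (b * cnj b + cnj a * (a - u)) / of_real n"
        by (simp_all add: diff_divide_distrib add_divide_distrib right_diff_distrib)
      ultimately show ?thesis by (simp add: ab q_def su2_23_mult)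
    qed
    then have "k = q ** ?d ** cadj q"
      using SU3_cancel(2)[OF SU2_SU3[OF q]] by (metis matrix_mul_assoc matrix_mul_rid)
    then have "\<rho> k *v v = \<rho> q *v (\<rho> ?d *v (\<rho> (cadj q) *v v))"
      using q tor[OF u1] torus_SU3 SU2_SU3 SU2_cadj by (simp add: rep_mult SU3_mult)
    also have "\<rho> ?d *v (\<rho> (cadj q) *v v) = \<rho> (cadj q) *v v"
      using torus_on_SU2_orbit[OF tor[OF u1] SU2_cadj[OF q]] by simp
    also have "\<rho> q *v (\<rho> (cadj q) *v v) = \<rho> (q ** cadj q) *v v"
      using q SU2_SU3 SU2_cadj by (simp add: rep_mult)
    also have "\<dots> = v" using SU3_cancel(2)[OF SU2_SU3[OF q]] by (simp add: unitary_rep_one[OF rep])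
    finally show ?thesis .
  qed
qed

text \<open>Equal first columns give \<open>cadj h ** g\<close> the corner entry 1, so it lies in
  \<open>SU2\<close> and fixes v.\<close>

lemma orbit_first_column:
  assumes g: "g \<in> SU3" and h: "h \<in> SU3" and eq: "g *v axis 1 1 = h *v axis 1 1"
  shows "\<rho> g *v v = \<rho> h *v v"
proof -
  have "g $ 1 $ 1 = h $ 1 $ 1" "g $ 2 $ 1 = h $ 2 $ 1" "g $ 3 $ 1 = h $ 3 $ 1"
    using eq by (simp_all add: mat1_axis vec_eq_iff forall_3)
  then have "(cadj h ** g) $ 1 $ 1 = (cadj h ** h) $ 1 $ 1"
    by (simp add: matrix_matrix_mult_def sum_3)
  then have "cadj h ** g \<in> SU2"
    using g h by (simp add: SU2_iff SU3_mult SU3_cadj SU3_cancel mat_def)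
  then have "\<rho> h *v (\<rho> (cadj h ** g) *v v) = \<rho> h *v v" by (simp add: SU2_fixes_v)
  moreover have "h ** (cadj h ** g) = g" using h by (simp add: matrix_mul_assoc SU3_cancel)
  ultimately show ?thesis using g h by (metis SU3_cadj SU3_mult rep_mult)
qed

section \<open>The coefficient as a function of the corner entry\<close>

lemma coefficient_torus:
  assumes t: "t \<in> torus" and g: "g \<in> SU3"
  shows "cin (\<rho> (t ** g) *v v) v = (t $ 1 $ 1) ^ p * cin (\<rho> g *v v) v"
  using t g v[OF torus_cadj[OF t]]
  by (simp add: rep_mult torus_SU3 rep_cin[OF torus_SU3[OF t]] cin_scale_right)

lemma coefficient_unit:
  assumes g: "g \<in> SU3" and 1: "cmod (g $ 1 $ 1) = 1"
  shows "cin (\<rho> g *v v) v = (g $ 1 $ 1) ^ p"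
proof -
  let ?t = "diag3 (g $ 1 $ 1) (cnj (g $ 1 $ 1)) 1"
  have t: "?t \<in> torus" using torus_first[OF 1] .
  have "\<rho> g *v v = \<rho> ?t *v v"
    using SU3_fixes_line[OF assms] t
    by (intro orbit_first_column g) (simp_all add: torus_SU3 mat1_axis vec_eq_iff forall_3)
  then show ?thesis using v[OF t] by (simp add: cin_scale_left)
qed

text \<open>Write g, up to elements fixing v on the right, as k R with k in \<open>SU2\<close> and R
  determined by the corner entry. By unitarity k moves to the other argument of the product, where
  it fixes v. A corner of modulus one is treated apart, since then r = 0 and k cannot be
  normalised.\<close>

lemma coefficient_eq:
  assumes g: "g \<in> SU3" and h: "h \<in> SU3" and eq: "g $ 1 $ 1 = h $ 1 $ 1"
  shows "cin (\<rho> g *v v) v = cin (\<rho> h *v v) v"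
proof (cases "cmod (g $ 1 $ 1) = 1")
  case True
  then show ?thesis using assms by (simp add: coefficient_unit)
next
  case False
  define c where "c = g $ 1 $ 1"
  define r where "r = sqrt (1 - (cmod c)\<^sup>2)"
  have "cin (\<rho> g *v v) v = cin (\<rho> (su2_12 c r) *v v) v" if g: "g \<in> SU3" and "g $ 1 $ 1 = c" for g
  proof -
    have *: "(cmod c)\<^sup>2 + (cmod (g $ 2 $ 1))\<^sup>2 + (cmod (g $ 3 $ 1))\<^sup>2 = 1"
      using SU3_column_norm[OF g] that by simp
    then have "(cmod c)\<^sup>2 \<le> 1" by (smt (verit) zero_le_power2)
    moreover have "(cmod c)\<^sup>2 \<noteq> 1" using False cmod_eq_1I by (auto simp: c_def)
    ultimately have r: "r > 0" "r\<^sup>2 = 1 - (cmod c)\<^sup>2" by (simp_all add: r_def)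
    have col: "(cmod (g $ 2 $ 1))\<^sup>2 + (cmod (g $ 3 $ 1))\<^sup>2 = r\<^sup>2" using * r(2) by simp
    let ?k = "su2_23 (g $ 2 $ 1 / of_real r) (g $ 3 $ 1 / of_real r)"
    have k: "?k \<in> SU2" using su2_column(1)[OF r(1) col] by (auto simp: SU2_def)
    have R: "su2_12 c r \<in> SU3" using r(2) by (intro su2_12_SU3) simp
    have "\<rho> g *v v = \<rho> (?k ** su2_12 c r) *v v"
      using su2_column(2-4)[OF r(1) col, of c] that(2) SU3_mult[OF SU2_SU3[OF k] R]
      by (intro orbit_first_column g) (simp_all add: mat1_axis vec_eq_iff forall_3)
    also have "cin \<dots> v = cin (\<rho> (su2_12 c r) *v v) (\<rho> (cadj ?k) *v v)"
      using k R by (simp add: rep_mult SU2_SU3 rep_cin[OF SU2_SU3[OF k]])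
    also have "\<rho> (cadj ?k) *v v = v" by (rule SU2_fixes_v[OF SU2_cadj[OF k]])
    finally show ?thesis .
  qed
  with assms show ?thesis by (simp add: c_def)
qed

text \<open>Along the conjugated circle group \<open>g\<close> the coefficient is, up to u^(-p), a
  polynomial \<open>q\<close> in u^3. The corners of \<open>g u\<close> and \<open>g (cnj u)\<close>
  have the same modulus, so a torus element relates their coefficients; this is the symmetry that
  determines \<open>q\<close>. The value is then read off at u = -1.\<close>

lemma coefficient_negative:
  assumes s: "0 < s" "s < (1/2 :: real)"
  shows "\<exists>g\<in>SU3. g $ 1 $ 1 = of_real (2 * s - 1) \<and> cin (\<rho> g *v v) v = (g $ 1 $ 1) ^ p"
proof -
  \<comment> \<open>With first row (a, -b, 0) in \<open>k\<close>, the corner of \<open>g u\<close>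
    becomes s u^2 + (1 - s) cnj u, which is 2 s - 1 at u = -1.\<close>
  define a b where "a = sqrt s" and "b = sqrt (1 - s)"
  have ab: "a * a = s" "b * b = 1 - s" using s by (simp_all add: a_def b_def)
  define k where "k = su2_12 (of_real a) b"
  have k: "k \<in> SU3" unfolding k_def using ab by (intro su2_12_SU3) (simp add: power2_eq_square)
  define x where "x = \<rho> (cadj k) *v v"
  define g where "g u = k ** circ u ** cadj k" for u
  have g: "g u \<in> SU3" if "cmod u = 1" for u
    using k torus_SU3[OF circ_torus[OF that]] by (simp add: g_def SU3_mult SU3_cadj)
  define z where "z u = 1 - s + s * u" for u :: complex
  have g11: "g u $ 1 $ 1 = cnj u * z (u ^ 3)" if u: "cmod u = 1" for u
  proof -
    have uu: "u * cnj u = 1" using u by (simp flip: complex_norm_square)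
    have "g u $ 1 $ 1 = of_real a * of_real a * u\<^sup>2 + of_real b * of_real b * cnj u"
      by (simp add: g_def k_def circ_def matrix_matrix_mult_def sum_3 mult_ac)
    also have "\<dots> = of_real s * u\<^sup>2 + (1 - of_real s) * cnj u"
      by (simp add: ab flip: of_real_mult)
    also have "\<dots> = of_real s * ((u * cnj u) * u\<^sup>2) + (1 - of_real s) * cnj u" by (simp add: uu)
    also have "\<dots> = cnj u * z (u ^ 3)"
      by (simp add: z_def algebra_simps power3_eq_cube power2_eq_square)
    finally show ?thesis .
  qed
  have coeff: "cin (\<rho> (g u) *v v) v = cin (\<rho> (circ u) *v x) x" if "cmod u = 1" for u
    using k torus_SU3[OF circ_torus[OF that]]
    by (simp add: g_def x_def rep_mult SU3_mult SU3_cadj rep_cin[OF k])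
  obtain q where q: "degree q \<le> p"
    "\<And>u. cmod u = 1 \<Longrightarrow> u ^ p * cin (\<rho> (circ u) *v x) x = poly q (u ^ 3)"
    using circ_polynomial by blast
  have q1: "poly q 1 = 1"
  proof -
    have "circ 1 = mat 1" by (simp add: circ_def diag3_one)
    then have "poly q 1 = cin x x" using q(2)[of 1] by (simp add: unitary_rep_one[OF rep])
    also have "\<dots> = 1" unfolding x_def
      using unitary_cin[OF unitary_rep_D(2)[OF rep SU3_cadj[OF k]]] by simp
    finally show ?thesis .
  qed
  have znz: "z w \<noteq> 0" if "cmod w = 1" for w
  proof
    assume "z w = 0"
    then have "of_real (1 - s) = - (of_real s * w)" by (simp add: z_def add_eq_0_iff2)
    then have "cmod (of_real (1 - s)) = cmod (of_real s * w)" by (metis norm_minus_cancel)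
    moreover have "cmod (of_real (1 - s)) = 1 - s" using s by (simp only: norm_of_real)
    ultimately show False using s that by (simp add: norm_mult)
  qed
  have sym: "(1 - s + s * w) ^ p * poly q (cnj w) = (1 - s + s * cnj w) ^ p * poly q w"
    if w: "cmod w = 1" for w :: complex
  proof -
    obtain th where th: "w = cis th" using norm_1_cis[OF w] by blast
    \<comment> \<open>The variable of \<open>q\<close> is \<open>u ^ 3\<close>, hence the cube root
      of w.\<close>
    define u where "u = cis (th / 3)"
    have u: "u ^ 3 = w" "cmod u = 1" by (simp_all add: u_def th Complex.DeMoivre)
    have u': "cnj u ^ 3 = cnj w" "cmod (cnj u) = 1" using u by (simp_all flip: complex_cnj_power)
    have uu: "u * cnj u = 1" using u by (simp flip: complex_norm_square)
    \<comment> \<open>The quotient of the corner u * cnj (z w) of \<open>g (cnj u)\<close> by the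
      corner cnj u * z w of \<open>g u\<close>.\<close>
    define m where "m = u\<^sup>2 * cnj (z w) / z w"
    have m: "cmod m = 1" using znz[OF w] u by (simp add: m_def norm_mult norm_divide norm_power)
    have zc: "z (cnj w) = cnj (z w)" by (simp add: z_def)
    let ?t = "diag3 m (cnj m) 1"
    have t: "?t \<in> torus" using torus_first[OF m] .
    have "(?t ** g u) $ 1 $ 1 = m * (cnj u * z w)"
      using g11[OF u(2)] u(1) by (simp add: matrix_matrix_mult_def sum_3)
    also have "\<dots> = u * (u * cnj u) * cnj (z w)"
      using znz[OF w] by (simp add: m_def power2_eq_square)
    also have "\<dots> = g (cnj u) $ 1 $ 1"
      using g11[OF u'(2)] u' by (simp add: uu zc)
    finally have "cin (\<rho> (?t ** g u) *v v) v = cin (\<rho> (g (cnj u)) *v v) v"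
      using coefficient_eq SU3_mult torus_SU3[OF t] g u u' by blast
    then have eq: "cin (\<rho> (g (cnj u)) *v v) v = m ^ p * cin (\<rho> (g u) *v v) v"
      using coefficient_torus[OF t g[OF u(2)]] by simp
    have "poly q (cnj w) = cnj u ^ p * (m ^ p * cin (\<rho> (g u) *v v) v)"
      using q(2)[OF u'(2)] u' coeff[OF u'(2)] eq by simp
    also have "\<dots> = cnj u ^ p * m ^ p * (cnj u * u) ^ p * cin (\<rho> (g u) *v v) v"
      using uu by (simp add: mult.commute)
    also have "\<dots> = (cnj u * m * cnj u) ^ p * poly q w"
      using q(2)[OF u(2)] u coeff[OF u(2)] by (simp add: power_mult_distrib mult_ac)
    also have "cnj u * m * cnj u = cnj (z w) / z w"
    proof -
      have "cnj u * m * cnj u = (u * cnj u) * (u * cnj u) * cnj (z w) / z w"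
        by (simp add: m_def power2_eq_square mult_ac)
      then show ?thesis by (simp add: uu)
    qed
    finally have "z w ^ p * poly q (cnj w) = z w ^ p * (cnj (z w) / z w) ^ p * poly q w" by simp
    also have "z w ^ p * (cnj (z w) / z w) ^ p = cnj (z w) ^ p"
      using znz[OF w] by (simp add: power_divide)
    finally show ?thesis by (simp add: z_def)
  qed
  have "poly q (-1) = (1 - s + s * (-1 :: complex)) ^ p"
    by (rule poly_reflected_symmetry[OF q(1) s q1 sym])
  moreover have "cin (\<rho> (g (-1)) *v v) v = (-1) ^ p * poly q (-1)"
  proof -
    have "poly q (-1) = (-1) ^ p * cin (\<rho> (g (-1)) *v v) v"
      using q(2)[of "-1"] coeff[of "-1"] by simp
    then have "(-1) ^ p * poly q (-1) = ((-1) ^ p * (-1) ^ p) * cin (\<rho> (g (-1)) *v v) v"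
      by (simp only: mult.assoc)
    also have "(-1) ^ p * (-1) ^ p = (1 :: complex)" by (simp flip: power_mult_distrib)
    finally show ?thesis by simp
  qed
  moreover have "g (-1) $ 1 $ 1 = of_real (2 * s - 1)" using g11[of "-1"] by (simp add: z_def)
  ultimately show ?thesis
    using g[of "-1"] by (intro bexI[of _ "g (-1)"]) (simp_all flip: power_mult_distrib)
qed

lemma coefficient:
  assumes g: "g \<in> SU3"
  shows "cin (\<rho> g *v v) v = (g $ 1 $ 1) ^ p"
proof -
  define r where "r = cmod (g $ 1 $ 1)"
  have "r\<^sup>2 \<le> 1" using SU3_column_norm[OF g] unfolding r_def by (smt (verit) zero_le_power2)
  then have "r \<le> 1" using r_def abs_le_square_iff[of r 1] by simp
  have r0: "r \<ge> 0" by (simp add: r_def)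
  consider "r = 0" | "r = 1" | "0 < r" "r < 1" using \<open>r \<le> 1\<close> r0 by linarith
  then show ?thesis
  proof cases
    case 1
    then have g11: "g $ 1 $ 1 = 0" by (simp add: r_def)
    \<comment> \<open>Multiplication by this phase keeps the corner 0 but, as m^p = -1, negates the
      coefficient, which must therefore vanish.\<close>
    define m where "m = cis (pi / p)"
    have t: "diag3 m (cnj m) 1 \<in> torus" by (rule torus_first) (simp add: m_def)
    have "cin (\<rho> (diag3 m (cnj m) 1 ** g) *v v) v = cin (\<rho> g *v v) v"
    proof (rule coefficient_eq[OF SU3_mult[OF torus_SU3[OF t] g] g])
      show "(diag3 m (cnj m) 1 ** g) $ 1 $ 1 = g $ 1 $ 1"
        by (simp add: g11 matrix_matrix_mult_def sum_3)
    qed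
    then have "m ^ p * cin (\<rho> g *v v) v = cin (\<rho> g *v v) v"
      using coefficient_torus[OF t g] by simp
    moreover have "m ^ p = -1" using p by (simp add: m_def Complex.DeMoivre)
    ultimately have "cin (\<rho> g *v v) v = 0" by simp
    then show ?thesis using g11 p by simp
  next
    case 2
    then show ?thesis using coefficient_unit[OF g] by (simp add: r_def)
  next
    case 3
    \<comment> \<open>The choice s = (1 - r) / 2 gives the corner -r; the torus then supplies the
      phase of the corner of g.\<close>
    obtain h where h: "h \<in> SU3" "h $ 1 $ 1 = of_real (2 * ((1 - r) / 2) - 1)"
      "cin (\<rho> h *v v) v = (h $ 1 $ 1) ^ p"
      using coefficient_negative[of "(1 - r) / 2"] 3 by auto
    then have h11: "h $ 1 $ 1 = - of_real r" by (simp add: field_simps)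
    define m where "m = - (g $ 1 $ 1) / of_real r"
    have m: "cmod m = 1" using 3 by (simp add: m_def norm_divide r_def)
    have t: "diag3 m (cnj m) 1 \<in> torus" using torus_first[OF m] .
    have *: "m * h $ 1 $ 1 = g $ 1 $ 1" using 3 by (simp add: m_def h11)
    have "cin (\<rho> g *v v) v = cin (\<rho> (diag3 m (cnj m) 1 ** h) *v v) v"
    proof (rule coefficient_eq[OF g SU3_mult[OF torus_SU3[OF t] h(1)]])
      show "g $ 1 $ 1 = (diag3 m (cnj m) 1 ** h) $ 1 $ 1"
        by (simp add: * matrix_matrix_mult_def sum_3)
    qed
    also have "\<dots> = (m * h $ 1 $ 1) ^ p"
      using coefficient_torus[OF t h(1)] h(3) by (simp add: power_mult_distrib)
    finally show ?thesis by (simp add: *)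
  qed
qed

end

section \<open>The isotropy group\<close>

text \<open>Replaces the parametrisation by U(2) with a condition on one entry. A corner of modulus
  one forces the block shape, and the determinant of the lower block is then its conjugate.\<close>

lemma isotropy_iff: "h \<in> isotropy \<longleftrightarrow> h \<in> SU3 \<and> cmod (h $ 1 $ 1) = 1"
proof
  assume "h \<in> isotropy"
  then obtain U :: "complex^2^2" where U: "unitary_mat U" and h: "h = vector [vector [inverse (det U), 0, 0],
      vector [0, U $ 1 $ 1, U $ 1 $ 2], vector [0, U $ 2 $ 1, U $ 2 $ 2]]"
    by (auto simp: isotropy_def)
  have "det (cadj U) = cnj (det U)" by (simp add: det_2 mult.commute)
  moreover have "det (cadj U ** U) = 1" using U by (simp add: unitary_mat_def)
  ultimately have d: "cnj (det U) * det U = 1" by (simp add: det_mul)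
  then have d0: "det U \<noteq> 0" by auto
  have d': "inverse (cnj (det U)) * inverse (det U) = 1"
    using d by (simp flip: inverse_mult_distrib)
  have "complex_of_real ((cmod (det U))\<^sup>2) = of_real 1"
    using d by (simp only: complex_norm_square mult.commute of_real_1)
  then have "cmod (det U) = 1" by (intro cmod_eq_1I) (simp only: of_real_eq_iff)
  then have 1: "cmod (h $ 1 $ 1) = 1" by (simp add: h norm_inverse)
  have "(cadj U ** U) $ i $ j = mat 1 $ i $ j" for i j using U by (simp add: unitary_mat_def)
  from this[of 1 1] this[of 1 2] this[of 2 1] this[of 2 2]
  have "cadj h ** h = mat 1" using d'
    by (simp add: vec_eq_iff forall_3 h matrix_matrix_mult_def sum_3 sum_2 mat_def)
  moreover have "det h = inverse (det U) * (U $ 1 $ 1 * U $ 2 $ 2 - U $ 1 $ 2 * U $ 2 $ 1)"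
    by (simp add: h det_3 algebra_simps)
  then have "det h = 1" using d0 by (simp flip: det_2)
  ultimately show "h \<in> SU3 \<and> cmod (h $ 1 $ 1) = 1"
    using 1 by (simp add: SU3_def unitary_matI)
next
  assume h: "h \<in> SU3 \<and> cmod (h $ 1 $ 1) = 1"
  note z = SU3_fixes_line[of h]
  define U :: "complex^2^2" where "U = vector [vector [h $ 2 $ 2, h $ 2 $ 3], vector [h $ 3 $ 2, h $ 3 $ 3]]"
  have "(cadj h ** h) $ i $ j = mat 1 $ i $ j" for i j using h by (simp add: SU3_cancel)
  from this[of 2 2] this[of 2 3] this[of 3 2] this[of 3 3]
  have U: "unitary_mat U" using h z
    by (intro unitary_matI) (simp add: vec_eq_iff forall_2 U_def matrix_matrix_mult_def sum_3 sum_2 mat_def)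
  have "det U = cnj (h $ 1 $ 1)" using SU3_cofactors(1)[of h] h by (simp add: U_def det_2)
  moreover have "h $ 1 $ 1 * cnj (h $ 1 $ 1) = 1" using h by (simp flip: complex_norm_square)
  then have "inverse (cnj (h $ 1 $ 1)) = h $ 1 $ 1" by (simp add: inverse_unique mult.commute)
  ultimately have "h = vector [vector [inverse (det U), 0, 0],
      vector [0, U $ 1 $ 1, U $ 1 $ 2], vector [0, U $ 2 $ 1, U $ 2 $ 2]]"
    using h z by (simp add: vec_eq_iff forall_3 U_def)
  with U show "h \<in> isotropy" unfolding isotropy_def by blast
qed

lemma isotropy_SU3: "h \<in> isotropy \<Longrightarrow> h \<in> SU3"
  by (simp add: isotropy_iff)

lemma isotropy_cnj_mat: "h \<in> isotropy \<Longrightarrow> cnj_mat h \<in> isotropy"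
  by (simp add: isotropy_iff SU3_cnj_mat)

section \<open>Coherent vectors\<close>

text \<open>The frame operator \<open>G\<close> of a spanning set is injective, because
  \<open>cin (G *v x) x\<close> is the sum of the squared moduli of the coefficients of x. The
  vectors w b form the dual frame.\<close>

lemma outer_sum_inverse:
  fixes B :: "(complex^'n) set"
  assumes B: "finite B" "vec.span B = UNIV"
  obtains w where "\<And>x. x = (\<Sum>b\<in>B. cin x b *s w b)"
proof -
  define G where "G = (\<Sum>b\<in>B. outer b b)"
  have G: "G *v x = (\<Sum>b\<in>B. cin x b *s b)" for x
  proof -
    have "(\<Sum>b\<in>C. outer b b) *v x = (\<Sum>b\<in>C. cin x b *s b)" for C
      by (induction C rule: infinite_finite_induct)
        (simp_all add: matrix_vector_mult_add_rdistrib outer_mult_vector)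
    then show ?thesis by (simp add: G_def)
  qed
  have "x = 0" if "G *v x = 0" for x
  proof -
    have "complex_of_real (\<Sum>b\<in>B. (cmod (cin x b))\<^sup>2) = cin (G *v x) x"
      by (simp add: G cin_sum_left cin_scale_left complex_norm_square cin_commute[of x] mult.commute del: of_real_power)
    then have "(\<Sum>b\<in>B. (cmod (cin x b))\<^sup>2) = 0"
      by (simp only: that cin_zero_left of_real_eq_0_iff)
    then have 0: "cin x b = 0" if "b \<in> B" for b
      using that B(1) by (simp add: sum_nonneg_eq_0_iff)
    then have "cin x x = 0" using cin_span_zero[of B x x] B(2) by simp
    then show ?thesis by simp
  qed
  then obtain G' where G': "G' ** G = mat 1"
    using matrix_left_invertible_ker[of G] by auto
  have "x = (\<Sum>b\<in>B. cin x b *s (G' *v b))" for x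
  proof -
    have "x = G' *v (G *v x)" by (simp add: matrix_vector_mul_assoc G')
    also have "\<dots> = (\<Sum>b\<in>B. cin x b *s (G' *v b))"
      by (simp add: G matrix_vector_mult_sum vector_smult_matrix_mult)
    finally show ?thesis .
  qed
  with that show thesis by blast
qed

lemma vec3_polar:
  fixes z :: "complex^3"
  obtains g c where "g \<in> SU3" "z = c *s (g *v axis 1 1)"
proof (cases "z = 0")
  case True
  with that[of "mat 1" 0] SU3_one show thesis by simp
next
  case False
  define u where "u = of_real (1 / norm z) *s z"
  have n: "norm (of_real r *s x) = \<bar>r\<bar> * norm x" for r and x :: "complex^3"
  proof -
    have "of_real r *s x = r *\<^sub>R x" by (simp add: vec_eq_iff scaleR_conv_of_real[where 'a = complex])
    then show ?thesis by simp
  qed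
  have "norm u = 1" using False unfolding u_def n by simp
  then obtain g where "g \<in> SU3" "g *v axis 1 1 = u" by (rule SU3_first_column)
  moreover have "z = of_real (norm z) *s u" using False by (simp add: u_def vector_smult_assoc)
  ultimately show thesis using that by metis
qed

context sym_power_rep
begin

lemma orbit_span: "vec.span ((\<lambda>g. \<rho> g *v v) ` SU3) = UNIV"
proof -
  define U where "U = vec.span ((\<lambda>g. \<rho> g *v v) ` SU3)"
  have U: "vec.subspace U" by (simp add: U_def)
  have base: "\<rho> g *v v \<in> U" if "g \<in> SU3" for g
    unfolding U_def by (intro vec.span_base imageI that)
  have inv: "\<rho> g *v x \<in> U" if g: "g \<in> SU3" and x: "x \<in> U" for g x
  proof (rule mult_span_subset[OF U _ x[unfolded U_def]])
    fix y assume "y \<in> (\<lambda>g. \<rho> g *v v) ` SU3"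
    then obtain h where h: "y = \<rho> h *v v" "h \<in> SU3" by blast
    then show "\<rho> g *v y \<in> U" using base[OF SU3_mult[OF g h(2)]] g by (simp add: rep_mult)
  qed
  have "v \<in> U" using base[OF SU3_one] by (simp add: unitary_rep_one[OF rep])
  moreover have "v \<noteq> 0" using norm_v by auto
  ultimately have "U \<noteq> {0}" by blast
  then have "U = UNIV" using irreducible[OF U inv] by blast
  then show ?thesis by (simp add: U_def)
qed

text \<open>Orbit vectors form a frame, so \<open>\<rho> g *v v\<close> is recovered from its
  products with finitely many vectors \<open>\<rho> (h b) *v v\<close>. By
  \<open>coefficient\<close> these products are p-th powers of products of first columns, an
  expression that makes sense for every z.\<close>

lemma coherent_exists:
  "\<exists>f. (\<exists>(I :: (complex^'n) set) y w. finite I \<and> f = (\<lambda>z. \<Sum>b\<in>I. (cin z (y b)) ^ p *s w b)) \<and>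
    (\<forall>g\<in>SU3. f (g *v axis 1 1) = \<rho> g *v v)"
proof -
  obtain B where B: "B \<subseteq> (\<lambda>g. \<rho> g *v v) ` SU3" "vec.independent B"
    "(\<lambda>g. \<rho> g *v v) ` SU3 \<subseteq> vec.span B"
    using vec.maximal_independent_subset by blast
  have finB: "finite B" using B(2) by (rule vec.finiteI_independent)
  have spanB: "vec.span B = UNIV"
    using vec.span_mono[OF B(3)] orbit_span by (auto simp: vec.span_span)
  obtain w where w: "\<And>x. x = (\<Sum>b\<in>B. cin x b *s w b)"
    using outer_sum_inverse[OF finB spanB] by blast
  have "\<forall>b\<in>B. \<exists>h. h \<in> SU3 \<and> \<rho> h *v v = b" using B(1) by auto
  then obtain h where h: "\<And>b. b \<in> B \<Longrightarrow> h b \<in> SU3" "\<And>b. b \<in> B \<Longrightarrow> \<rho> (h b) *v v = b"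
    by metis
  have "(\<Sum>b\<in>B. (cin (g *v axis 1 1) (h b *v axis 1 1)) ^ p *s w b) = \<rho> g *v v" if g: "g \<in> SU3" for g
  proof -
    have "cin (\<rho> g *v v) b = (cin (g *v axis 1 1) (h b *v axis 1 1)) ^ p" if b: "b \<in> B" for b
    proof -
      have "cin (\<rho> g *v v) b = cin (\<rho> g *v v) (\<rho> (cadj (cadj (h b))) *v v)"
        using h[OF b] by simp
      also have "\<dots> = cin (\<rho> (cadj (h b) ** g) *v v) v"
        using h[OF b] g by (simp only: rep_mult SU3_cadj rep_cin[OF SU3_cadj[OF h(1)[OF b]]])
      also have "\<dots> = (cadj (h b) ** g) $ 1 $ 1 ^ p"
        using h[OF b] g by (intro coefficient SU3_mult SU3_cadj)
      also have "(cadj (h b) ** g) $ 1 $ 1 = cin (g *v axis 1 1) (h b *v axis 1 1)"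
        by (simp add: mat1_axis cin_def matrix_matrix_mult_def mult.commute)
      finally show ?thesis .
    qed
    then show ?thesis using w[of "\<rho> g *v v"] by simp
  qed
  moreover define f where "f z = (\<Sum>b\<in>B. (cin z (h b *v axis 1 1)) ^ p *s w b)" for z
  moreover have "\<exists>(I :: (complex^'n) set) y w. finite I \<and> f = (\<lambda>z. \<Sum>b\<in>I. (cin z (y b)) ^ p *s w b)"
    using finB by (rule_tac x = B in exI, rule_tac x = "\<lambda>b. h b *v axis 1 1" in exI, rule_tac x = w in exI)
      (simp add: f_def fun_eq_iff)
  ultimately show ?thesis by (rule_tac x = f in exI) simp
qed

text \<open>In the model \<open>Sym\<^sup>p(\<complex>\<^sup>3)\<close> of the representation this is \<open>z \<mapsto> z\<^sup>p\<close>.\<close>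
definition coh :: "complex^3 \<Rightarrow> complex^'n" where
  "coh = (SOME f. (\<exists>(I :: (complex^'n) set) y w. finite I \<and>
      f = (\<lambda>z. \<Sum>b\<in>I. (cin z (y b)) ^ p *s w b)) \<and> (\<forall>g\<in>SU3. f (g *v axis 1 1) = \<rho> g *v v))"

lemma coh_spec:
  "(\<exists>(I :: (complex^'n) set) y w. finite I \<and> coh = (\<lambda>z. \<Sum>b\<in>I. (cin z (y b)) ^ p *s w b)) \<and>
    (\<forall>g\<in>SU3. coh (g *v axis 1 1) = \<rho> g *v v)"
  unfolding coh_def by (rule someI_ex[OF coherent_exists])

lemma coh_polynomial:
  obtains I :: "(complex^'n) set" and y w
  where "finite I" "\<And>z. coh z = (\<Sum>b\<in>I. (cin z (y b)) ^ p *s w b)"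
proof -
  obtain I :: "(complex^'n) set" and y w
    where I: "finite I" "coh = (\<lambda>z. \<Sum>b\<in>I. (cin z (y b)) ^ p *s w b)"
    using conjunct1[OF coh_spec] by (elim exE conjE)
  show thesis by (rule that[of I y w]) (simp_all only: I)
qed

lemma coh_orbit: "g \<in> SU3 \<Longrightarrow> coh (g *v axis 1 1) = \<rho> g *v v"
  by (rule bspec[OF conjunct2[OF coh_spec]])

lemma coh_scale: "coh (c *s z) = c ^ p *s coh z"
proof (rule coh_polynomial)
  fix I :: "(complex^'n) set" and y w
  assume I: "finite I" "\<And>z. coh z = (\<Sum>i\<in>I. (cin z (y i)) ^ p *s w i)"
  show ?thesis
    by (simp add: I(2) cin_scale_left power_mult_distrib vec.scale_sum_right vector_smult_assoc)
qed

lemma coh_equivariant: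
  assumes g: "g \<in> SU3"
  shows "coh (g *v z) = \<rho> g *v coh z"
proof -
  obtain h c where h: "h \<in> SU3" "z = c *s (h *v axis 1 1)" by (rule vec3_polar)
  then have "g *v z = c *s ((g ** h) *v axis 1 1)"
    by (simp add: vector_smult_matrix_mult matrix_vector_mul_assoc)
  then have "coh (g *v z) = c ^ p *s (\<rho> g *v (\<rho> h *v v))"
    using h g by (simp only: coh_scale coh_orbit SU3_mult rep_mult)
  then show ?thesis
    using h by (simp add: coh_scale coh_orbit vector_smult_matrix_mult)
qed

lemma coh_span: "vec.span (range coh) = UNIV"
proof -
  have "(\<lambda>g. \<rho> g *v v) ` SU3 \<subseteq> range coh" by (auto simp flip: coh_orbit)
  then show ?thesis using vec.span_mono[of "(\<lambda>g. \<rho> g *v v) ` SU3" "range coh"] orbit_span by auto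
qed

lemma coh_total: "(\<And>z. cin x (coh z) = 0) \<Longrightarrow> x = 0"
proof -
  assume 0: "\<And>z. cin x (coh z) = 0"
  then have "cin x x = 0" using cin_span_zero[of "range coh" x x] coh_span by auto
  then show "x = 0" by simp
qed

lemma coh_affine:
  obtains c where "\<And>u. coh (a + u *s b) = (\<Sum>j\<le>p. u ^ j *s c j)" "c 0 = coh a" "c p = coh b"
proof (rule coh_polynomial)
  fix I :: "(complex^'n) set" and y w
  assume I: "finite I" "\<And>z. coh z = (\<Sum>i\<in>I. (cin z (y i)) ^ p *s w i)"
  define c where "c j = (\<Sum>i\<in>I. (of_nat (p choose j) * cin a (y i) ^ (p - j) * cin b (y i) ^ j) *s w i)" for j
  have "coh (a + u *s b) = (\<Sum>j\<le>p. u ^ j *s c j)" for u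
  proof -
    have "coh (a + u *s b) = (\<Sum>i\<in>I. \<Sum>j\<le>p. (u ^ j * (of_nat (p choose j) * cin a (y i) ^ (p - j) * cin b (y i) ^ j)) *s w i)"
      unfolding I(2)
    proof (rule sum.cong[OF refl])
      fix i
      have "(cin (a + u *s b) (y i)) ^ p = (u * cin b (y i) + cin a (y i)) ^ p"
        by (simp add: cin_add_left cin_scale_left add.commute)
      also have "\<dots> = (\<Sum>j\<le>p. u ^ j * (of_nat (p choose j) * cin a (y i) ^ (p - j) * cin b (y i) ^ j))"
        by (simp add: binomial_ring power_mult_distrib mult_ac)
      finally show "(cin (a + u *s b) (y i)) ^ p *s w i =
          (\<Sum>j\<le>p. (u ^ j * (of_nat (p choose j) * cin a (y i) ^ (p - j) * cin b (y i) ^ j)) *s w i)"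
        by (simp only: vec.scale_sum_left)
    qed
    also have "\<dots> = (\<Sum>j\<le>p. u ^ j *s c j)"
      by (subst sum.swap) (simp add: c_def vec.scale_sum_right vector_smult_assoc)
    finally show ?thesis .
  qed
  moreover have "c 0 = coh a" "c p = coh b" by (simp_all add: c_def I(2))
  ultimately show thesis using that by blast
qed

lemma coh_continuous: "continuous_on UNIV coh"
proof (rule coh_polynomial)
  fix I :: "(complex^'n) set" and y w
  assume I: "finite I" "\<And>z. coh z = (\<Sum>i\<in>I. (cin z (y i)) ^ p *s w i)"
  have "coh = (\<lambda>z. \<chi> k. \<Sum>i\<in>I. (cin z (y i)) ^ p * w i $ k)"
    by (simp add: I(2) vec_eq_iff fun_eq_iff)
  then show "continuous_on UNIV coh"
    unfolding cin_def by (auto intro!: continuous_intros continuous_on_vec_lambda)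
qed

text \<open>Polarisation: the expectation of \<open>A\<close> at \<open>coh (a + u b)\<close>, \<open>\<bar>u\<bar> = 1\<close>, is a trigonometric polynomial
  in \<open>u\<close> with leading coefficient \<open>\<langle>A coh b, coh a\<rangle>\<close>.\<close>
lemma expectations_determine:
  assumes 0: "\<And>z. cin (A *v coh z) (coh z) = 0"
  shows "A = 0"
proof -
  have "cin (A *v coh b) (coh a) = 0" for a b
  proof -
    obtain c where c: "\<And>u. coh (a + u *s b) = (\<Sum>j\<le>p. u ^ j *s c j)" "c 0 = coh a" "c p = coh b"
      using coh_affine[of a b] by blast
    define C where "C j k = cin (A *v c j) (c k)" for j k
    \<comment> \<open>Multiplication by \<open>u ^ p\<close> turns the exponents j - k into natural
      numbers; the exponent 2 p arises only from j = p and k = 0.\<close>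
    define q where "q = (\<Sum>j\<le>p. \<Sum>k\<le>p. monom (C j k) (j + p - k))"
    have "poly q u = poly 0 u" if u: "cmod u = 1" for u
    proof -
      have uu: "u * cnj u = 1" using u by (simp flip: complex_norm_square)
      have "0 = u ^ p * cin (A *v coh (a + u *s b)) (coh (a + u *s b))" by (simp add: 0)
      also have "\<dots> = (\<Sum>k\<le>p. \<Sum>j\<le>p. u ^ p * (cnj u ^ k * (u ^ j * C j k)))"
        by (simp add: c(1) matrix_vector_mult_sum cin_sum_left cin_sum_right vector_smult_matrix_mult
            cin_scale_left cin_scale_right C_def sum_distrib_left mult_ac)
      also have "\<dots> = (\<Sum>j\<le>p. \<Sum>k\<le>p. u ^ p * (cnj u ^ k * (u ^ j * C j k)))" by (rule sum.swap)
      also have "\<dots> = (\<Sum>j\<le>p. \<Sum>k\<le>p. C j k * u ^ (j + p - k))"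
      proof (intro sum.cong refl)
        fix j k assume "k \<in> {..p}"
        then have "u ^ (j + p) = u ^ (j + p - k) * u ^ k" by (simp flip: power_add)
        then have "u ^ p * (cnj u ^ k * (u ^ j * C j k)) = C j k * u ^ (j + p - k) * (u * cnj u) ^ k"
          by (simp add: power_mult_distrib power_add mult_ac)
        then show "u ^ p * (cnj u ^ k * (u ^ j * C j k)) = C j k * u ^ (j + p - k)"
          by (simp add: uu)
      qed
      also have "\<dots> = poly q u" by (simp add: q_def poly_sum poly_monom)
      finally show ?thesis by simp
    qed
    then have "q = 0" by (rule poly_eq_on_circle)
    then have "0 = coeff q (2 * p)" by simp
    also have "\<dots> = (\<Sum>j\<le>p. \<Sum>k\<le>p. if j = p \<and> k = 0 then C j k else 0)"
      unfolding q_def coeff_sum coeff_monom by (intro sum.cong refl if_cong) auto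
    also have "\<dots> = (\<Sum>j\<le>p. if j = p then C j 0 else 0)"
      by (intro sum.cong refl) (simp add: sum.delta)
    also have "\<dots> = C p 0" by simp
    finally show ?thesis by (simp add: C_def c)
  qed
  then have A: "A *v coh b = 0" for b by (rule coh_total)
  have "A *v x = 0 *s x" for x
    by (rule eigenvector_span[of "range coh"]) (auto simp: A coh_span)
  then have "A *v x = 0 *v x" for x by simp
  then show "A = 0" using matrix_eq by blast
qed

lemma orbit_expectations_determine:
  assumes "\<And>g. g \<in> SU3 \<Longrightarrow> cin (A *v (\<rho> g *v v)) (\<rho> g *v v) = 0"
  shows "A = 0"
proof (rule expectations_determine)
  fix z :: "complex^3"
  obtain g c where g: "g \<in> SU3" "z = c *s (g *v axis 1 1)" by (rule vec3_polar)
  then show "cin (A *v coh z) (coh z) = 0"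
    using assms[OF g(1)]
    by (simp add: coh_scale coh_orbit vector_smult_matrix_mult cin_scale_left cin_scale_right)
qed

lemma isotropy_v:
  assumes h: "h \<in> isotropy"
  shows "\<rho> h *v v = (h $ 1 $ 1) ^ p *s v"
proof -
  have h': "h \<in> SU3" "cmod (h $ 1 $ 1) = 1" using h by (auto simp: isotropy_iff)
  have "h *v axis 1 1 = (h $ 1 $ 1) *s (mat 1 *v axis 1 1)"
    using SU3_fixes_line[OF h']
    by (simp only: mat1_axis) (simp add: vec_eq_iff forall_3 mat_def)
  then have "coh (h *v axis 1 1) = (h $ 1 $ 1) ^ p *s coh (mat 1 *v axis 1 1)"
    by (simp only: coh_scale)
  then show ?thesis
    using coh_orbit[OF h'(1)] coh_orbit[OF SU3_one] by (simp add: unitary_rep_one[OF rep])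
qed

definition line_pt :: "real \<Rightarrow> complex^3" where
  "line_pt x = axis 1 1 + of_real x *s axis 2 1"

text \<open>For isotropy-fixed \<open>K\<close> the expectation at \<open>coh (1, x, 0)\<close> is an even polynomial in \<open>x\<close> of degree
  at most \<open>2 p\<close>, and every line is moved by the isotropy group to one through some \<open>(1, x, 0)\<close>,
  up to closure.\<close>
lemma isotropy_fixed_determined:
  assumes fixed: "\<And>h. h \<in> isotropy \<Longrightarrow> \<rho> h ** K = K ** \<rho> h"
    and zero: "\<And>j. j \<le> p \<Longrightarrow> cin (K *v coh (line_pt (real j))) (coh (line_pt (real j))) = 0"
  shows "K = 0"
proof -
  define F where "F z = cin (K *v coh z) (coh z)" for z
  have F_inv: "F (h *v z) = F z" if h: "h \<in> isotropy" for h z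
  proof -
    have "F (h *v z) = cin (\<rho> h *v (K *v coh z)) (\<rho> h *v coh z)"
      using fixed[OF h] isotropy_SU3[OF h] by (simp add: F_def coh_equivariant matrix_vector_mul_assoc)
    also have "\<dots> = F z"
      using unitary_cin[OF unitary_rep_D(2)[OF rep isotropy_SU3[OF h]]] by (simp add: F_def)
    finally show ?thesis .
  qed
  have F_scale: "F (c *s z) = c ^ p * cnj c ^ p * F z" for c z
    by (simp add: F_def coh_scale vector_smult_matrix_mult cin_scale_left cin_scale_right)
  obtain c where c: "\<And>u. coh (axis 1 1 + u *s axis 2 1) = (\<Sum>j\<le>p. u ^ j *s c j)"
    using coh_affine[of "axis 1 1" "axis 2 1"] by blast
  define q where "q = (\<Sum>k\<le>p. \<Sum>j\<le>p. monom (cin (K *v c j) (c k)) (j + k))"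
  have q: "F (line_pt x) = poly q (of_real x)" for x
    by (simp add: F_def line_pt_def c matrix_vector_mult_sum cin_sum_left cin_sum_right vector_smult_matrix_mult
          cin_scale_left cin_scale_right q_def poly_sum poly_monom sum_distrib_left power_add mult_ac)
  have even: "F (line_pt (- x)) = F (line_pt x)" for x
  proof -
    have "diag3 1 (-1) (-1) \<in> isotropy" by (simp add: isotropy_iff diag3_SU3)
    moreover have "diag3 1 (-1) (-1) *v line_pt x = line_pt (- x)"
      by (simp add: line_pt_def vec_eq_iff forall_3 matrix_vector_mult_def sum_3 axis_def)
    ultimately show ?thesis using F_inv by metis
  qed
  have "q = 0"
  proof (rule ccontr)
    assume "q \<noteq> 0"
    \<comment> \<open>The hypothesis gives zeros at 0, ..., p; evenness mirrors them to 2 p + 1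
      zeros, one more than the degree allows.\<close>
    let ?R = "complex_of_int ` {- int p..int p}"
    have "?R \<subseteq> {x. poly q x = 0}"
    proof safe
      fix i assume i: "i \<in> {- int p..int p}"
      have "F (line_pt (real_of_int i)) = 0"
      proof (cases "i \<ge> 0")
        case True
        then show ?thesis using zero[of "nat i"] i by (simp add: F_def)
      next
        case False
        then show ?thesis using zero[of "nat (- i)"] i even[of "real_of_int i"] by (simp add: F_def)
      qed
      then show "poly q (of_int i) = 0" by (simp add: q)
    qed
    then have "card ?R \<le> card {x. poly q x = 0}"
      using \<open>q \<noteq> 0\<close> by (intro card_mono poly_roots_finite)
    also have "\<dots> \<le> degree q" using \<open>q \<noteq> 0\<close> by (rule card_poly_roots_bound)
    also have "\<dots> \<le> 2 * p"
      unfolding q_def by (intro degree_sum_le) (auto intro!: degree_sum_le order_trans[OF degree_monom_le])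
    finally show False by (simp add: card_image inj_on_def)
  qed
  then have line: "F (line_pt x) = 0" for x by (simp add: q)
  have chart: "F z = 0" if "z $ 1 \<noteq> 0" for z
  proof -
    define x y where "x = z $ 2 / z $ 1" and "y = z $ 3 / z $ 1"
    define r where "r = sqrt ((cmod x)\<^sup>2 + (cmod y)\<^sup>2)"
    have r2: "(cmod x)\<^sup>2 + (cmod y)\<^sup>2 = r\<^sup>2" by (simp add: r_def)
    have z: "z = z $ 1 *s vector [1, x, y]"
      using that by (simp add: vec_eq_iff forall_3 x_def y_def)
    have "F (vector [1, x, y]) = 0"
    proof (cases "r = 0")
      case True
      then have "vector [1, x, y] = line_pt 0" using r2
        by (simp add: vec_eq_iff forall_3 line_pt_def axis_def add_nonneg_eq_0_iff)
      then show ?thesis by (simp add: line)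
    next
      case False
      then have "r > 0" by (simp add: r_def add_nonneg_nonneg order_less_le)
      let ?k = "su2_23 (x / of_real r) (y / of_real r)"
      have "?k \<in> isotropy"
        using su2_23_SU3[OF su2_column(1)[OF \<open>r > 0\<close> r2]] by (simp add: isotropy_iff)
      moreover have "?k *v line_pt r = vector [1, x, y]"
        using \<open>r > 0\<close> by (simp add: vec_eq_iff forall_3 line_pt_def axis_def matrix_vector_mult_def sum_3)
      ultimately show ?thesis using F_inv line by metis
    qed
    then show ?thesis by (subst z) (simp add: F_scale)
  qed
  have "F z = 0" for z
  proof (cases "z $ 1 = 0")
    case True
    define f where "f t = F (z + of_real t *s axis 1 1)" for t :: real
    have "continuous_on UNIV (\<lambda>t. coh (z + of_real t *s axis 1 1))"
    proof (rule continuous_on_compose2[OF coh_continuous])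
      have "(\<lambda>t. z + of_real t *s axis 1 1) = (\<lambda>t. z + t *\<^sub>R (axis 1 1 :: complex^3))"
        by (simp add: vec_eq_iff fun_eq_iff scaleR_conv_of_real[where 'a = complex])
      then show "continuous_on UNIV (\<lambda>t. z + of_real t *s axis 1 1)"
        by (simp only:) (intro continuous_intros)
    qed auto
    then have "continuous_on UNIV f"
      unfolding f_def F_def cin_def matrix_vector_mult_def by (auto intro!: continuous_intros)
    then have "(f \<longlongrightarrow> f 0) (at 0)" by (simp add: continuous_on_def)
    moreover have "\<forall>\<^sub>F t in at 0. f t = 0"
      unfolding eventually_at_filter using True chart
      by (intro always_eventually) (auto simp: f_def axis_def)
    then have "(f \<longlongrightarrow> 0) (at 0)" by (rule tendsto_eventually)
    ultimately have "f 0 = 0" using tendsto_unique trivial_limit_at by blast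
    then show ?thesis by (simp add: f_def)
  qed (rule chart)
  then show "K = 0" by (intro expectations_determine) (simp add: F_def)
qed

end

section \<open>Smooth functions\<close>

text \<open>Uniqueness of the derivative frees the inductions from the choice inside
  \<open>frechet_derivative\<close>.\<close>

lemma Ck_Suc_I:
  assumes "\<And>x. (f has_derivative f' x) (at x)" "\<And>v. Ck k (\<lambda>x. f' x v)"
  shows "Ck (Suc k) f"
proof -
  have "frechet_derivative f (at x) = f' x" for x
    using frechet_derivative_at[OF assms(1)] by simp
  then show ?thesis using assms by (auto simp: differentiable_def)
qed

lemma Ck_Suc_D:
  assumes "Ck (Suc k) f"
  obtains f' where "\<And>x. (f has_derivative f' x) (at x)" "\<And>v. Ck k (\<lambda>x. f' x v)"
proof
  show "(f has_derivative frechet_derivative f (at x)) (at x)" for x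
    using assms by (simp add: frechet_derivative_works)
  show "Ck k (\<lambda>x. frechet_derivative f (at x) v)" for v
    using assms by simp
qed

lemma Ck_mono: "Ck (Suc k) f \<Longrightarrow> Ck k f"
proof (induction k arbitrary: f)
  case 0
  then show ?case
    by (auto intro!: continuous_at_imp_continuous_on differentiable_imp_continuous_within)
next
  case (Suc k)
  then show ?case by (meson Ck.simps(2))
qed

lemma Ck_const [simp]: "Ck k (\<lambda>x. c)"
proof (induction k arbitrary: c)
  case (Suc k)
  show ?case by (rule Ck_Suc_I[where f' = "\<lambda>x v. 0"]) (auto simp: Suc)
qed simp

lemma Ck_add: "Ck k f \<Longrightarrow> Ck k g \<Longrightarrow> Ck k (\<lambda>x. f x + g x)"
proof (induction k arbitrary: f g)
  case (Suc k)
  obtain f' where f: "\<And>x. (f has_derivative f' x) (at x)" "\<And>v. Ck k (\<lambda>x. f' x v)"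
    using Ck_Suc_D[OF Suc.prems(1)] by blast
  obtain g' where g: "\<And>x. (g has_derivative g' x) (at x)" "\<And>v. Ck k (\<lambda>x. g' x v)"
    using Ck_Suc_D[OF Suc.prems(2)] by blast
  show ?case
    by (rule Ck_Suc_I[where f' = "\<lambda>x v. f' x v + g' x v"])
      (intro has_derivative_add f g Suc.IH)+
qed (auto intro: continuous_intros)

lemma Ck_mult: "Ck k f \<Longrightarrow> Ck k g \<Longrightarrow> Ck k (\<lambda>x. f x * g x)"
  for f g :: "'a::real_normed_vector \<Rightarrow> 'b::real_normed_algebra"
proof (induction k arbitrary: f g)
  case (Suc k)
  obtain f' where f: "\<And>x. (f has_derivative f' x) (at x)" "\<And>v. Ck k (\<lambda>x. f' x v)"
    using Ck_Suc_D[OF Suc.prems(1)] by blast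
  obtain g' where g: "\<And>x. (g has_derivative g' x) (at x)" "\<And>v. Ck k (\<lambda>x. g' x v)"
    using Ck_Suc_D[OF Suc.prems(2)] by blast
  show ?case
    by (rule Ck_Suc_I[where f' = "\<lambda>x v. f x * g' x v + f' x v * g x"])
      (intro has_derivative_mult Ck_add f g Suc.IH Ck_mono[OF Suc.prems(1)] Ck_mono[OF Suc.prems(2)])+
qed (auto intro: continuous_intros)

lemma Ck_bounded_linear_compose: "bounded_linear h \<Longrightarrow> Ck k f \<Longrightarrow> Ck k (\<lambda>x. h (f x))"
proof (induction k arbitrary: f)
  case 0
  then show ?case by (simp add: bounded_linear.continuous_on)
next
  case (Suc k)
  obtain f' where f: "\<And>x. (f has_derivative f' x) (at x)" "\<And>v. Ck k (\<lambda>x. f' x v)"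
    using Ck_Suc_D[OF Suc.prems(2)] by blast
  show ?case
    by (rule Ck_Suc_I[where f' = "\<lambda>x v. h (f' x v)"])
      (intro bounded_linear.has_derivative[OF Suc.prems(1)] f Suc.IH Suc.prems(1))+
qed

lemma Ck_bounded_linear: "bounded_linear h \<Longrightarrow> Ck k h"
proof (cases k)
  case 0
  moreover assume "bounded_linear h"
  ultimately show ?thesis by (simp add: linear_continuous_on)
next
  case (Suc n)
  moreover assume "bounded_linear h"
  then have "Ck (Suc n) h"
    by (intro Ck_Suc_I[where f' = "\<lambda>x v. h v"] bounded_linear_imp_has_derivative Ck_const)
  ultimately show ?thesis by simp
qed

text \<open>The exponent varies in the induction because differentiation lowers it by one. The
  application is to exponent -1/2, the normalisation of the columns of
  \<open>chart_section\<close>.\<close>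

lemma Ck_powr:
  fixes q :: "'a::real_normed_vector \<Rightarrow> real"
  assumes pos: "\<And>x. q x > 0"
  shows "Ck k q \<Longrightarrow> Ck k (\<lambda>x. q x powr s)"
proof (induction k arbitrary: s)
  case 0
  have "q x \<noteq> 0" for x using pos[of x] by simp
  with 0 show ?case by (auto intro!: continuous_intros)
next
  case (Suc k)
  obtain q' where q: "\<And>x. (q has_derivative q' x) (at x)" "\<And>v. Ck k (\<lambda>x. q' x v)"
    using Ck_Suc_D[OF Suc.prems] by blast
  show ?case
  proof (rule Ck_Suc_I[where f' = "\<lambda>x v. q' x v * (s * q x powr (s - 1))"])
    show "((\<lambda>x. q x powr s) has_derivative (\<lambda>v. q' x v * (s * q x powr (s - 1)))) (at x)" for x
      by (rule DERIV_compose_FDERIV[OF has_real_derivative_powr[OF pos] q(1)])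
    show "Ck k (\<lambda>x. q' x v * (s * q x powr (s - 1)))" for v
      by (intro Ck_mult q(2) Ck_const Suc.IH Ck_mono[OF Suc.prems])
  qed
qed

lemma Cinf_const [simp]: "Cinf (\<lambda>x. c)"
  by (simp add: Cinf_def)

lemma Cinf_add: "Cinf f \<Longrightarrow> Cinf g \<Longrightarrow> Cinf (\<lambda>x. f x + g x)"
  by (simp add: Cinf_def Ck_add)

lemma Cinf_mult: "Cinf f \<Longrightarrow> Cinf g \<Longrightarrow> Cinf (\<lambda>x. f x * g x)"
  for f g :: "'a::real_normed_vector \<Rightarrow> 'b::real_normed_algebra"
  by (simp add: Cinf_def Ck_mult)

lemma Cinf_bounded_linear_compose: "bounded_linear h \<Longrightarrow> Cinf f \<Longrightarrow> Cinf (\<lambda>x. h (f x))"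
  by (simp add: Cinf_def Ck_bounded_linear_compose)

lemma Cinf_bounded_linear: "bounded_linear h \<Longrightarrow> Cinf h"
  by (simp add: Cinf_def Ck_bounded_linear)

lemma Cinf_minus: "Cinf f \<Longrightarrow> Cinf (\<lambda>x. - f x)"
  by (rule Cinf_bounded_linear_compose[OF bounded_linear_minus[OF bounded_linear_ident]])

lemma Cinf_cnj: "Cinf f \<Longrightarrow> Cinf (\<lambda>x. cnj (f x))"
  by (rule Cinf_bounded_linear_compose[OF bounded_linear_cnj])

lemma Cinf_of_real: "Cinf f \<Longrightarrow> Cinf (\<lambda>x. of_real (f x))"
  by (rule Cinf_bounded_linear_compose[OF bounded_linear_of_real])

lemma Cinf_powr: "(\<And>x. q x > 0) \<Longrightarrow> Cinf q \<Longrightarrow> Cinf (\<lambda>x. q x powr s)"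
  for q :: "'a::real_normed_vector \<Rightarrow> real"
  unfolding Cinf_def by (intro allI Ck_powr) auto

lemma Cinf_sum: "(\<And>i. i \<in> I \<Longrightarrow> Cinf (f i)) \<Longrightarrow> Cinf (\<lambda>x. \<Sum>i\<in>I. f i x)"
  by (induction I rule: infinite_finite_induct) (auto intro: Cinf_add)

lemma Cinf_power: "Cinf f \<Longrightarrow> Cinf (\<lambda>x. f x ^ n)"
  for f :: "'a::real_normed_vector \<Rightarrow> 'b::real_normed_algebra_1"
  by (induction n) (auto intro: Cinf_mult)

lemma Cinf_norm_square: "Cinf f \<Longrightarrow> Cinf (\<lambda>x. (cmod (f x))\<^sup>2)"
proof -
  assume "Cinf f"
  then have "Cinf (\<lambda>x. Re (f x * cnj (f x)))"
    by (intro Cinf_bounded_linear_compose[OF bounded_linear_Re] Cinf_mult Cinf_cnj)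
  moreover have "Re (z * cnj z) = (cmod z)\<^sup>2" for z
    by (simp add: cmod_power2) (simp add: power2_eq_square)
  ultimately show ?thesis by simp
qed

section \<open>A section of the affine chart\<close>

text \<open>The columns are obtained from \<open>(1, u, v)\<close>, \<open>(- cnj u, 1, 0)\<close> and the conjugate of their
  cross product by normalisation.\<close>
definition chart_section :: "complex \<Rightarrow> complex \<Rightarrow> complex^3^3" where
  "chart_section u v =
    (let q = 1 + (cmod u)\<^sup>2; a = of_real ((q + (cmod v)\<^sup>2) powr (- 1 / 2)); b = of_real (q powr (- 1 / 2))
     in vector [vector [a, - b * cnj u, - a * b * cnj v],
                vector [a * u, b, - a * b * u * cnj v],
                vector [a * v, 0, a * b * of_real q]])"

lemma powr_minus_half: "x > 0 \<Longrightarrow> x powr (- 1 / 2) * x powr (- 1 / 2) * x = (1 :: real)"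
proof -
  assume "x > 0"
  have "x powr (- 1 / 2) * x powr (- 1 / 2) = x powr (- 1 / 2 + - 1 / 2)" by (rule powr_add[symmetric])
  then show ?thesis using \<open>x > 0\<close> by (simp add: powr_minus)
qed

lemma chart_section_SU3: "chart_section u v \<in> SU3"
proof -
  define q where "q = 1 + (cmod u)\<^sup>2"
  define a where "a = complex_of_real ((q + (cmod v)\<^sup>2) powr (- 1 / 2))"
  define b where "b = complex_of_real (q powr (- 1 / 2))"
  define Q where "Q = complex_of_real q"
  have q: "q > 0" "q + (cmod v)\<^sup>2 > 0" unfolding q_def by (smt (verit) zero_le_power2)+
  have Q: "Q = 1 + u * cnj u" by (simp add: Q_def q_def complex_norm_square del: of_real_power)
  have aa: "a * a * (Q + v * cnj v) = 1"
    using arg_cong[OF powr_minus_half[OF q(2)], of complex_of_real]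
    by (simp only: a_def Q_def complex_norm_square of_real_mult of_real_add of_real_1)
  have bb: "b * b * Q = 1"
    using arg_cong[OF powr_minus_half[OF q(1)], of complex_of_real]
    by (simp only: b_def Q_def of_real_mult of_real_1)
  have [simp]: "cnj a = a" "cnj b = b" "cnj Q = Q" by (simp_all add: a_def b_def Q_def)
  have G: "chart_section u v = vector [vector [a, - b * cnj u, - a * b * cnj v],
      vector [a * u, b, - a * b * u * cnj v], vector [a * v, 0, a * b * Q]]"
    by (simp add: chart_section_def Let_def a_def b_def Q_def q_def)
  have ab: "(a * a * (Q + v * cnj v)) * (b * b * Q) = 1" by (simp add: aa bb)
  have "cadj (chart_section u v) ** chart_section u v =
      diag3 (a * a * (Q + v * cnj v)) (b * b * Q) ((a * a * (Q + v * cnj v)) * (b * b * Q))"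
    unfolding vec_eq_iff forall_3
    by (simp add: G matrix_matrix_mult_def sum_3) (simp add: Q algebra_simps)
  then have "cadj (chart_section u v) ** chart_section u v = mat 1"
    by (simp add: aa bb diag3_one)
  moreover have "det (chart_section u v) = (a * a * (Q + v * cnj v)) * (b * b * Q)"
    unfolding det_3 by (simp add: G) (simp add: Q algebra_simps)
  then have "det (chart_section u v) = 1" by (simp add: ab)
  ultimately show ?thesis by (simp add: SU3_def unitary_matI)
qed

lemma chart_section_column:
  "\<exists>a. a \<noteq> 0 \<and> chart_section u v *v axis 1 1 = a *s vector [1, u, v]"
proof -
  have "1 + (cmod u)\<^sup>2 + (cmod v)\<^sup>2 \<noteq> 0" by (smt (verit) zero_le_power2)
  then show ?thesis
    by (intro exI[of _ "complex_of_real ((1 + (cmod u)\<^sup>2 + (cmod v)\<^sup>2) powr (- 1 / 2))"])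
      (simp add: mat1_axis vec_eq_iff forall_3 chart_section_def Let_def)
qed

lemma Cinf_chart_section:
  fixes u v :: "'a::real_normed_vector \<Rightarrow> complex"
  assumes "Cinf u" "Cinf v"
  shows "Cinf (\<lambda>x. chart_section (u x) (v x) $ i $ j)"
proof -
  have pos: "1 + (cmod z)\<^sup>2 > 0" "1 + (cmod z)\<^sup>2 + (cmod w)\<^sup>2 > 0" for z w
    by (smt (verit) zero_le_power2)+
  have "\<forall>i j. Cinf (\<lambda>x. chart_section (u x) (v x) $ i $ j)"
    unfolding forall_3 chart_section_def Let_def vector_3
    by (intro conjI Cinf_const Cinf_mult Cinf_of_real Cinf_minus Cinf_add Cinf_cnj Cinf_powr Cinf_norm_square
        assms pos)
  then show ?thesis by blast
qed

section \<open>Representations of highest weight (p, 0) and (0, p)\<close>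

text \<open>What the classification of symbol correspondences uses of the representation; unlike
  \<^locale>\<open>sym_power_rep\<close> it is stable under complex conjugation of the group.\<close>
locale symbol_rep =
  fixes \<rho> :: "complex^3^3 \<Rightarrow> complex^'n^'n" and p :: nat and v :: "complex^'n" and bv :: "nat \<Rightarrow> complex^'n"
  assumes rep: "unitary_rep \<rho>"
    and irreducible: "\<And>U. vec.subspace U \<Longrightarrow> (\<And>g x. g \<in> SU3 \<Longrightarrow> x \<in> U \<Longrightarrow> \<rho> g *v x \<in> U) \<Longrightarrow>
      U = {0} \<or> U = UNIV"
    and isotropy_v: "\<And>h. h \<in> isotropy \<Longrightarrow> \<exists>c. cmod c = 1 \<and> \<rho> h *v v = c *s v"
    and orbit_expectations_determine:
      "\<And>A. (\<And>g. g \<in> SU3 \<Longrightarrow> cin (A *v (\<rho> g *v v)) (\<rho> g *v v) = 0) \<Longrightarrow> A = 0"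
    and isotropy_fixed_determined:
      "\<And>K. (\<And>h. h \<in> isotropy \<Longrightarrow> \<rho> h ** K = K ** \<rho> h) \<Longrightarrow>
        (\<And>j. j \<le> p \<Longrightarrow> cin (K *v bv j) (bv j) = 0) \<Longrightarrow> K = 0"
    and smooth: "\<And>(G :: complex \<times> complex \<Rightarrow> complex^3^3) i j. (\<And>e. G e \<in> SU3) \<Longrightarrow>
        (\<And>i j. Cinf (\<lambda>e. G e $ i $ j)) \<Longrightarrow> Cinf (\<lambda>e. \<rho> (G e) $ i $ j)"

lemma Cinf_matrix_vector:
  fixes G :: "'a::real_normed_vector \<Rightarrow> complex^'n^'m"
  assumes "\<And>i j. Cinf (\<lambda>e. G e $ i $ j)"
  shows "Cinf (\<lambda>e. (G e *v x) $ i)"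
  unfolding matrix_vector_mult_def by (simp, intro Cinf_sum Cinf_mult assms Cinf_const)

context sym_power_rep
begin

text \<open>By equivariance \<open>\<rho> (G e) *v coh z\<close> is \<open>coh (G e *v z)\<close>, a
  polynomial in the entries of \<open>G e\<close>. Coherent vectors span, so this reaches all matrix
  entries.\<close>

lemma smooth:
  fixes G :: "'a::real_normed_vector \<Rightarrow> complex^3^3"
  assumes G: "\<And>e. G e \<in> SU3" and C: "\<And>i j. Cinf (\<lambda>e. G e $ i $ j)"
  shows "Cinf (\<lambda>e. \<rho> (G e) $ i $ j)"
proof -
  have coh: "Cinf (\<lambda>e. (\<rho> (G e) *v coh z) $ i)" for z i
  proof (rule coh_polynomial)
    fix I :: "(complex^'n) set" and y w
    assume I: "finite I" "\<And>z. coh z = (\<Sum>b\<in>I. (cin z (y b)) ^ p *s w b)"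
    have "(\<rho> (G e) *v coh z) $ i = (\<Sum>b\<in>I. (\<Sum>k\<in>UNIV. (G e *v z) $ k * cnj (y b $ k)) ^ p * w b $ i)" for e
      by (subst coh_equivariant[OF G, symmetric]) (simp add: I(2) cin_def)
    then show "Cinf (\<lambda>e. (\<rho> (G e) *v coh z) $ i)"
      by (simp only:) (intro Cinf_sum Cinf_mult Cinf_power Cinf_const Cinf_matrix_vector C)
  qed
  have "\<forall>i. Cinf (\<lambda>e. (\<rho> (G e) *v x) $ i)" if "x \<in> vec.span (range coh)" for x
    using that
  proof (induction rule: vec.span_induct_alt)
    case (step c x y)
    then obtain z where "x = coh z" by blast
    with step coh show ?case
      by (simp add: matrix_vector_right_distrib vector_smult_matrix_mult)
        (intro allI Cinf_add Cinf_mult Cinf_const, auto)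
  qed simp
  then have "Cinf (\<lambda>e. (\<rho> (G e) *v axis j 1) $ i)" by (simp add: coh_span)
  moreover have "(A *v axis j 1) $ i = A $ i $ j" for A :: "complex^'n^'n"
    by (simp add: matrix_vector_mult_def axis_def if_distrib cong: if_cong)
  ultimately show ?thesis by simp
qed

lemma symbol_rep: "symbol_rep \<rho> p v (\<lambda>j. coh (line_pt (real j)))"
proof
  show "\<exists>c. cmod c = 1 \<and> \<rho> h *v v = c *s v" if "h \<in> isotropy" for h
    using isotropy_v[OF that] that by (intro exI[of _ "(h $ 1 $ 1) ^ p"]) (simp add: isotropy_iff norm_power)
  show "A = 0" if "\<And>g. g \<in> SU3 \<Longrightarrow> cin (A *v (\<rho> g *v v)) (\<rho> g *v v) = 0" for A
    using that by (rule orbit_expectations_determine)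
  show "K = 0" if "\<And>h. h \<in> isotropy \<Longrightarrow> \<rho> h ** K = K ** \<rho> h"
    "\<And>j. j \<le> p \<Longrightarrow> cin (K *v coh (line_pt (real j))) (coh (line_pt (real j))) = 0" for K
    using that by (rule isotropy_fixed_determined)
qed (use rep irreducible smooth in blast)+

end

text \<open>Each assumption of the locale ranges over SU(3) or the isotropy group; both are stable
  under conjugation, as is smoothness of matrix entries.\<close>

lemma symbol_rep_conj:
  assumes "symbol_rep (\<lambda>g. \<rho> (cnj_mat g)) p v bv" and rep: "unitary_rep \<rho>"
  shows "symbol_rep \<rho> p v bv"
proof -
  interpret c: symbol_rep "\<lambda>g. \<rho> (cnj_mat g)" p v bv by fact
  show ?thesis
  proof
    show "U = {0} \<or> U = UNIV"
      if "vec.subspace U" "\<And>g x. g \<in> SU3 \<Longrightarrow> x \<in> U \<Longrightarrow> \<rho> g *v x \<in> U" for U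
      using that(2)[OF SU3_cnj_mat] by (intro c.irreducible[OF that(1)])
    show "\<exists>c. cmod c = 1 \<and> \<rho> h *v v = c *s v" if "h \<in> isotropy" for h
      using c.isotropy_v[OF isotropy_cnj_mat[OF that]] by simp
    show "A = 0" if "\<And>g. g \<in> SU3 \<Longrightarrow> cin (A *v (\<rho> g *v v)) (\<rho> g *v v) = 0" for A
      using that[OF SU3_cnj_mat] by (rule c.orbit_expectations_determine)
    show "K = 0" if "\<And>h. h \<in> isotropy \<Longrightarrow> \<rho> h ** K = K ** \<rho> h"
      "\<And>j. j \<le> p \<Longrightarrow> cin (K *v bv j) (bv j) = 0" for K
      using that(1)[OF isotropy_cnj_mat] that(2) by (rule c.isotropy_fixed_determined)
    show "Cinf (\<lambda>e. \<rho> (G e) $ i $ j)"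
      if "\<And>e. G e \<in> SU3" "\<And>i j. Cinf (\<lambda>e. G e $ i $ j)" for G :: "complex \<times> complex \<Rightarrow> complex^3^3" and i j
      using c.smooth[of "\<lambda>e. cnj_mat (G e)" i j] that by (simp add: SU3_cnj_mat Cinf_cnj)
  qed (fact rep)
qed

lemma unitary_rep_conj:
  assumes rep: "unitary_rep \<rho>"
  shows "unitary_rep (\<lambda>g. \<rho> (cnj_mat g))"
proof -
  have "continuous_on SU3 (\<lambda>g. \<rho> (cnj_mat g))"
  proof (rule continuous_on_compose2[OF unitary_rep_D(1)[OF rep]])
    show "continuous_on SU3 (cnj_mat :: complex^3^3 \<Rightarrow> _)"
      unfolding cnj_mat_def by (intro continuous_on_vec_lambda continuous_intros)
  qed (auto simp: SU3_cnj_mat)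
  with rep show ?thesis by (simp add: unitary_rep_def SU3_cnj_mat cnj_mat_mult)
qed

section \<open>Weights as monomials and their rotation by the Weyl group\<close>

lemma weight_char_monomial:
  assumes t: "t \<in> torus"
  shows "weight_char (int k - int l, int l - int m) t = t $ 1 $ 1 ^ k * t $ 2 $ 2 ^ l * t $ 3 $ 3 ^ m"
proof -
  obtain a b c where abc: "t = diag3 a b c" "cmod a = 1" "cmod b = 1" "a * b * c = 1"
    using t by (auto simp: torus_def)
  then have nz: "a \<noteq> 0" "b \<noteq> 0" "c \<noteq> 0" by auto
  have c: "c = inverse (a * b)" using abc(4) nz by (simp add: field_simps)
  show ?thesis using nz
    by (simp add: weight_char_def abc(1) c power_int_diff power_int_mult_distrib power_mult_distrib field_simps)
qed

text \<open>Moving a torus element past \<open>cyc\<close> rotates its diagonal entries, so t_1^(a +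
  b) t_2^b becomes t_2^(a + b) t_3^b; the coordinates follow from t_1 t_2 t_3 = 1.\<close>

lemma weight_vec_cyc:
  assumes rep: "unitary_rep \<rho>" and x: "weight_vec \<rho> (a, b) x"
  shows "weight_vec \<rho> (- a - b, a) (\<rho> cyc *v x)"
  unfolding weight_vec_def
proof
  fix t assume t: "t \<in> torus"
  then obtain t1 t2 t3 where d: "t = diag3 t1 t2 t3" "cmod t1 = 1" "cmod t2 = 1" "cmod t3 = 1" "t1 * t2 * t3 = 1"
    by (auto simp: torus_def)
  then have nz: "t1 \<noteq> 0" "t2 \<noteq> 0" "t3 \<noteq> 0" by auto
  have t': "diag3 t2 t3 t1 \<in> torus" unfolding torus_def using d
    by (intro CollectI exI[of _ t2] exI[of _ t3] exI[of _ t1]) (simp add: mult_ac)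
  have "\<rho> t *v (\<rho> cyc *v x) = \<rho> cyc *v (\<rho> (diag3 t2 t3 t1) *v x)"
    using rep t t' torus_SU3 cyc_SU3 diag3_cyc[of t1 t2 t3] d(1)
    by (simp flip: unitary_rep_mult_vector)
  also have "\<dots> = weight_char (a, b) (diag3 t2 t3 t1) *s (\<rho> cyc *v x)"
    using x t' by (simp add: weight_vec_def vector_smult_matrix_mult)
  also have "weight_char (a, b) (diag3 t2 t3 t1) = weight_char (- a - b, a) t"
  proof -
    have t3: "t3 = inverse (t1 * t2)" using d(5) nz by (simp add: field_simps)
    have "t2 * t3 = inverse t1" using nz by (simp add: t3)
    then have "weight_char (a, b) (diag3 t2 t3 t1) = t2 powi a * t1 powi (- b)"
      by (simp add: weight_char_def power_int_minus power_int_inverse)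
    also have "t1 powi (- b) = t1 powi (- a - b) * t1 powi a"
      using power_int_add[of t1 "- a - b" a] nz by simp
    also have "t2 powi a * \<dots> = weight_char (- a - b, a) t"
      by (simp add: weight_char_def d(1) power_int_mult_distrib mult_ac)
    finally show ?thesis .
  qed
  finally show "\<rho> t *v (\<rho> cyc *v x) = weight_char (- a - b, a) t *s (\<rho> cyc *v x)" .
qed

lemma unitary_rep_mult_vector_nz:
  assumes "unitary_rep \<rho>" "g \<in> SU3" "x \<noteq> 0"
  shows "\<rho> g *v x \<noteq> 0"
  using unitary_norm[OF unitary_rep_D(2)[OF assms(1,2)], of x] assms(3) by (metis norm_eq_zero)

text \<open>For a monomial t_1^k t_2^l t_3^m of degree p the coordinates are a = k - l and b = l -
  m, so p + 2 a + b = 3 k. Thus \<open>dom\<close> says that the exponent of t_1 is a natural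
  number; applied to the two rotated weights it gives the other exponents.\<close>

lemma sym_power_repI:
  assumes rep: "unitary_rep \<rho>" and p: "p \<ge> 1"
    and irr: "\<And>U. vec.subspace U \<Longrightarrow> (\<And>g x. g \<in> SU3 \<Longrightarrow> x \<in> U \<Longrightarrow> \<rho> g *v x \<in> U) \<Longrightarrow>
      U = {0} \<or> U = UNIV"
    and dom: "\<And>a b x. x \<noteq> 0 \<Longrightarrow> weight_vec \<rho> (a, b) x \<Longrightarrow> \<exists>k::nat. 3 * int k = int p + 2 * a + b"
    and x: "x \<noteq> 0" "weight_vec \<rho> (int p, 0) x"
  shows "\<exists>v. sym_power_rep \<rho> p v"
proof -
  define v where "v = of_real (1 / norm x) *s x"
  have v_scale: "v = (1 / norm x) *\<^sub>R x"
    by (simp add: v_def vec_eq_iff scaleR_conv_of_real[where 'a = complex])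
  have "sym_power_rep \<rho> p v"
  proof
    fix y w assume y: "y \<noteq> 0" "weight_vec \<rho> w y"
    obtain a b where w: "w = (a, b)" by fastforce
    note cyc1 = weight_vec_cyc[OF rep y(2)[unfolded w]]
    note cyc2 = weight_vec_cyc[OF rep cyc1]
    note nz1 = unitary_rep_mult_vector_nz[OF rep cyc_SU3 y(1)]
    note nz2 = unitary_rep_mult_vector_nz[OF rep cyc_SU3 nz1]
    obtain k :: nat where k: "3 * int k = int p + 2 * a + b"
      using dom[OF y(1) y(2)[unfolded w]] by blast
    obtain m :: nat where m: "3 * int m = int p + 2 * (- a - b) + a"
      using dom[OF nz1 cyc1] by blast
    obtain l :: nat where l: "3 * int l = int p + 2 * (- (- a - b) - a) + (- a - b)"
      using dom[OF nz2 cyc2] by blast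
    have l': "3 * int l = int p - a + b" using l by simp
    have m': "3 * int m = int p - a - 2 * b" using m by simp
    have "3 * a = 3 * (int k - int l)" using k l' by simp
    then have "a = int k - int l" by simp
    moreover have "3 * b = 3 * (int l - int m)" using l' m' by simp
    then have "b = int l - int m" by simp
    moreover have "3 * int (k + l + m) = 3 * int p" using k l' m' by simp
    then have "int (k + l + m) = int p" by simp
    then have "k + l + m = p" by (simp only: of_nat_eq_iff)
    ultimately show "\<exists>k l m. k + l + m = p \<and>
        (\<forall>t\<in>torus. weight_char w t = t $ 1 $ 1 ^ k * t $ 2 $ 2 ^ l * t $ 3 $ 3 ^ m)"
      using w weight_char_monomial by metis
  next
    show "norm v = 1" using x by (simp add: v_scale)
    show "\<rho> t *v v = (t $ 1 $ 1) ^ p *s v" if "t \<in> torus" for t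
      using x(2) that by (simp add: weight_vec_def v_def vector_smult_matrix_mult vector_smult_assoc
          mult.commute weight_char_def)
  qed (use rep p irr in blast)+
  then show ?thesis ..
qed

lemma unitary_irrep_D:
  assumes "unitary_irrep \<rho> (p, q)"
  shows "unitary_rep \<rho>"
    "\<And>U. vec.subspace U \<Longrightarrow> (\<And>g x. g \<in> SU3 \<Longrightarrow> x \<in> U \<Longrightarrow> \<rho> g *v x \<in> U) \<Longrightarrow> U = {0} \<or> U = UNIV"
    "\<exists>x. x \<noteq> 0 \<and> weight_vec \<rho> (int p, int q) x"
    "\<And>a b x. x \<noteq> 0 \<Longrightarrow> weight_vec \<rho> (a, b) x \<Longrightarrow>
      \<exists>k l :: nat. a = int p - 2 * int k + int l \<and> b = int q + int k - 2 * int l"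
proof -
  have irr: "unitary_rep \<rho>" "irreducible_on (*s) (\<lambda>g v. \<rho> g *v v) UNIV"
    "highest_weight (*s) (\<lambda>g v. \<rho> g *v v) UNIV (int p, int q)"
    using assms by (auto simp: unitary_irrep_def irrep_with_highest_weight_def)
  show "unitary_rep \<rho>" by fact
  show "U = {0} \<or> U = UNIV"
    if "vec.subspace U" "\<And>g x. g \<in> SU3 \<Longrightarrow> x \<in> U \<Longrightarrow> \<rho> g *v x \<in> U" for U
    using irr(2) that by (auto simp: irreducible_on_def invariant_subspace_def)
  show "\<exists>x. x \<noteq> 0 \<and> weight_vec \<rho> (int p, int q) x"
    using irr(3) by (auto simp: highest_weight_def is_weight_def weight_vec_def)
  show "\<exists>k l :: nat. a = int p - 2 * int k + int l \<and> b = int q + int k - 2 * int l"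
    if "x \<noteq> 0" "weight_vec \<rho> (a, b) x" for a b x
  proof -
    have "is_weight (*s) (\<lambda>g v. \<rho> g *v v) UNIV (a, b)"
      using that by (auto simp: is_weight_def weight_vec_def)
    then show ?thesis using irr(3) by (simp add: highest_weight_def)
  qed
qed

lemma unitary_irrep_symbol_rep:
  assumes p: "p \<ge> 1" and irr: "unitary_irrep \<rho> (p, 0) \<or> unitary_irrep \<rho> (0, p)"
  shows "\<exists>v bv. symbol_rep \<rho> p v bv"
  using irr
proof
  assume irr: "unitary_irrep \<rho> (p, 0)"
  note D = unitary_irrep_D[OF irr]
  obtain x where x: "x \<noteq> 0" "weight_vec \<rho> (int p, 0) x" using D(3) by auto
  have "\<exists>k::nat. 3 * int k = int p + 2 * a + b" if y: "y \<noteq> 0" "weight_vec \<rho> (a, b) y" for a b y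
  proof -
    \<comment> \<open>Two rotations lead to the weight (b, - a - b). Comparing it with the highest
      weight (p, 0), the multiple \<open>l\<close> of the second simple root is the wanted exponent
      of t_1.\<close>
    note cyc2 = weight_vec_cyc[OF D(1) weight_vec_cyc[OF D(1) y(2)]]
    note nz2 = unitary_rep_mult_vector_nz[OF D(1) cyc_SU3 unitary_rep_mult_vector_nz[OF D(1) cyc_SU3 y(1)]]
    obtain k l :: nat where "- (- a - b) - a = int p - 2 * int k + int l" "- a - b = int 0 + int k - 2 * int l"
      using D(4)[OF nz2 cyc2] by blast
    then have "3 * int l = int p + 2 * a + b" by simp
    then show ?thesis by blast
  qed
  then obtain v where "sym_power_rep \<rho> p v"
    using sym_power_repI[OF D(1) p D(2) _ x] by blast
  then show ?thesis using sym_power_rep.symbol_rep by blast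
next
  assume irr: "unitary_irrep \<rho> (0, p)"
  note D = unitary_irrep_D[OF irr]
  let ?\<rho> = "\<lambda>g. \<rho> (cnj_mat g)"
  have rep: "unitary_rep ?\<rho>" by (rule unitary_rep_conj[OF D(1)])
  \<comment> \<open>Conjugation inverts torus elements, hence negates weights.\<close>
  have conj: "weight_vec \<rho>2 (- a, - b) y"
    if "weight_vec \<rho>1 (a, b) y" "\<And>g. \<rho>2 g = \<rho>1 (cnj_mat g)" for \<rho>1 \<rho>2 :: "complex^3^3 \<Rightarrow> complex^'n^'n" and a b y
    unfolding weight_vec_def
  proof
    fix t assume t: "t \<in> torus"
    then obtain t1 t2 t3 where d: "t = diag3 t1 t2 t3" "cmod t1 = 1" "cmod t2 = 1" by (auto simp: torus_def)
    have "t1 * cnj t1 = 1" "t2 * cnj t2 = 1" using d by (simp_all flip: complex_norm_square)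
    then have "cnj t1 = inverse t1" "cnj t2 = inverse t2" by (simp_all add: inverse_unique)
    then have "weight_char (a, b) (cnj_mat t) = weight_char (- a, - b) t"
      by (simp add: weight_char_def d(1) power_int_minus power_int_inverse flip: inverse_mult_distrib)
    then show "\<rho>2 t *v y = weight_char (- a, - b) t *s y"
      using that torus_cnj_mat[OF t] by (simp add: weight_vec_def)
  qed
  have irr': "U = {0} \<or> U = UNIV"
    if "vec.subspace U" "\<And>g x. g \<in> SU3 \<Longrightarrow> x \<in> U \<Longrightarrow> ?\<rho> g *v x \<in> U" for U
  proof (rule D(2)[OF that(1)])
    fix g x assume "g \<in> SU3" "x \<in> U"
    then show "\<rho> g *v x \<in> U" using that(2)[OF SU3_cnj_mat] by fastforce
  qed
  have dom: "\<exists>k::nat. 3 * int k = int p + 2 * a + b" if y: "y \<noteq> 0" "weight_vec ?\<rho> (a, b) y" for a b y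
  proof -
    have "weight_vec \<rho> (- a, - b) y" by (rule conj[OF y(2)]) simp
    then obtain k l :: nat where "- a = int 0 - 2 * int k + int l" "- b = int p + int k - 2 * int l"
      using D(4)[OF y(1)] by blast
    then have "3 * int k = int p + 2 * a + b" by simp
    then show ?thesis by blast
  qed
  obtain x where x: "x \<noteq> 0" "weight_vec \<rho> (int 0, int p) x" using D(3) by blast
  then have "weight_vec ?\<rho> (- int 0, - int p) x" by (intro conj[of \<rho>]) simp_all
  \<comment> \<open>The former highest weight (0, p) has become (0, -p), and one rotation takes it
    to (p, 0).\<close>
  then have "weight_vec ?\<rho> (int p, 0) (?\<rho> cyc *v x)"
    using weight_vec_cyc[OF rep, of 0 "- int p" x] by simp
  moreover have "?\<rho> cyc *v x \<noteq> 0" by (rule unitary_rep_mult_vector_nz[OF rep cyc_SU3 x(1)])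
  ultimately have "\<exists>v. sym_power_rep ?\<rho> p v"
  proof (intro sym_power_repI[OF rep p])
    show "U = {0} \<or> U = UNIV"
      if "vec.subspace U" "\<And>g x. g \<in> SU3 \<Longrightarrow> x \<in> U \<Longrightarrow> ?\<rho> g *v x \<in> U" for U
      using that by (rule irr')
    show "\<exists>k::nat. 3 * int k = int p + 2 * a + b" if "y \<noteq> 0" "weight_vec ?\<rho> (a, b) y" for a b y
      using that by (rule dom)
  qed
  then obtain v where "sym_power_rep ?\<rho> p v" ..
  from symbol_rep_conj[OF sym_power_rep.symbol_rep[OF this] D(1)] show ?thesis by blast
qed

section \<open>The projective plane as a homogeneous space\<close>

lemma Rep_cp2_pt: "z \<noteq> 0 \<Longrightarrow> Rep_cp2 (cp2_pt z) = range (\<lambda>c. c *s z)"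
  unfolding cp2_pt_def by (rule Abs_cp2_inverse) blast

lemma cp2_pt_eq_iff:
  assumes "z \<noteq> 0" "w \<noteq> 0"
  shows "cp2_pt z = cp2_pt w \<longleftrightarrow> (\<exists>c. c \<noteq> 0 \<and> w = c *s z)"
proof
  assume "cp2_pt z = cp2_pt w"
  then have "range (\<lambda>c. c *s z) = range (\<lambda>c. c *s w)" using assms by (metis Rep_cp2_pt)
  moreover have "w \<in> range (\<lambda>c. c *s w)" by (rule range_eqI[of _ _ 1]) simp
  ultimately obtain c where "w = c *s z" by (auto elim: rangeE)
  then show "\<exists>c. c \<noteq> 0 \<and> w = c *s z" using assms by auto
next
  assume "\<exists>c. c \<noteq> 0 \<and> w = c *s z"
  then obtain c where c: "c \<noteq> 0" "w = c *s z" by blast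
  have "range (\<lambda>c. c *s z) = range (\<lambda>c. c *s w)"
  proof (intro subset_antisym image_subsetI)
    fix a
    have "a *s z = (a / c) *s w" using c by (simp add: vector_smult_assoc)
    then show "a *s z \<in> range (\<lambda>c. c *s w)" by (rule range_eqI)
    have "a *s w = (a * c) *s z" using c by (simp add: vector_smult_assoc)
    then show "a *s w \<in> range (\<lambda>c. c *s z)" by (rule range_eqI)
  qed
  then show "cp2_pt z = cp2_pt w" by (simp add: cp2_pt_def)
qed

lemma cp2_pt_scale: "c \<noteq> 0 \<Longrightarrow> z \<noteq> 0 \<Longrightarrow> cp2_pt (c *s z) = cp2_pt z"
  by (subst eq_commute) (auto simp: cp2_pt_eq_iff)

lemma cp2_pt_cases:
  obtains z where "z \<noteq> 0" "x = cp2_pt z"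
proof -
  obtain z where "z \<noteq> 0" "Rep_cp2 x = range (\<lambda>c. c *s z)" using Rep_cp2[of x] by blast
  then have "x = cp2_pt z" by (metis Rep_cp2_inverse cp2_pt_def)
  with \<open>z \<noteq> 0\<close> that show thesis by blast
qed

lemma SU3_mult_nz: "g \<in> SU3 \<Longrightarrow> z \<noteq> 0 \<Longrightarrow> g *v z \<noteq> 0"
  using unitary_norm[OF SU3_D(1)] by (metis norm_eq_zero)

lemma cp2_act_pt:
  assumes "g \<in> SU3" "z \<noteq> 0"
  shows "cp2_act g (cp2_pt z) = cp2_pt (g *v z)"
  using assms by (simp add: cp2_act_def Rep_cp2_pt image_image vector_smult_matrix_mult)
    (simp add: cp2_pt_def)

lemma cp2_base_eq: "cp2_base = cp2_pt (axis 1 1)"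
proof -
  have "vector [1, 0, 0] = (axis 1 1 :: complex^3)" by (simp add: vec_eq_iff forall_3 axis_def)
  then show ?thesis by (simp add: cp2_base_def)
qed

lemma axis_nz [simp]: "axis i (1::complex) \<noteq> 0"
  by (simp add: axis_eq_0_iff)

lemma cp2_act_base: "g \<in> SU3 \<Longrightarrow> cp2_act g cp2_base = cp2_pt (g *v axis 1 1)"
  by (simp add: cp2_base_eq cp2_act_pt)

lemma cp2_act_mult:
  assumes "g \<in> SU3" "h \<in> SU3"
  shows "cp2_act (g ** h) x = cp2_act g (cp2_act h x)"
proof -
  obtain z where "z \<noteq> 0" "x = cp2_pt z" by (rule cp2_pt_cases)
  then show ?thesis using assms by (simp add: cp2_act_pt SU3_mult SU3_mult_nz matrix_vector_mul_assoc)
qed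

lemma cp2_transitive: "\<exists>g\<in>SU3. cp2_act g cp2_base = x"
proof -
  obtain z where z: "z \<noteq> 0" "x = cp2_pt z" by (rule cp2_pt_cases)
  obtain g c where g: "g \<in> SU3" "z = c *s (g *v axis 1 1)" by (rule vec3_polar)
  have "c \<noteq> 0" using z g by auto
  then have "cp2_act g cp2_base = x"
    using z g by (simp add: cp2_act_base cp2_pt_scale SU3_mult_nz)
  with g show ?thesis by blast
qed

lemma isotropy_fixes_base:
  assumes "h \<in> isotropy"
  shows "cp2_act h cp2_base = cp2_base"
proof -
  have h: "h \<in> SU3" "cmod (h $ 1 $ 1) = 1" using assms by (simp_all add: isotropy_iff)
  have "h *v axis 1 1 = (h $ 1 $ 1) *s axis 1 1"
    using SU3_fixes_line[OF h] by (simp only: mat1_axis) (simp add: vec_eq_iff forall_3 axis_def)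
  moreover have "h $ 1 $ 1 \<noteq> 0" using h by auto
  ultimately have "cp2_pt (h *v axis 1 1) = cp2_pt (axis 1 1)" by (simp add: cp2_pt_scale)
  then show ?thesis using cp2_act_base[OF h(1)] by (simp add: cp2_base_eq)
qed

text \<open>The first columns are proportional unit vectors. The factor has modulus one and is the
  corner of \<open>cadj h ** g\<close>.\<close>

lemma cp2_act_base_eq:
  assumes g: "g \<in> SU3" and h: "h \<in> SU3" and eq: "cp2_act g cp2_base = cp2_act h cp2_base"
  shows "cadj h ** g \<in> isotropy"
proof -
  have "cp2_pt (h *v axis 1 1) = cp2_pt (g *v axis 1 1)" using assms by (simp add: cp2_act_base)
  then obtain c where c: "g *v axis 1 1 = c *s (h *v axis 1 1)"
    using cp2_pt_eq_iff[OF SU3_mult_nz[OF h] SU3_mult_nz[OF g]] by auto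
  have "norm (g *v axis 1 1 :: complex^3) = 1" "norm (h *v axis 1 1 :: complex^3) = 1"
    using unitary_norm[OF SU3_D(1)] g h by simp_all
  then have "complex_of_real 1 = c * cnj c * of_real 1"
    using cin_self[of "g *v axis 1 1"] cin_self[of "h *v axis 1 1"]
    by (simp add: c cin_scale_left cin_scale_right mult.commute)
  then have "complex_of_real ((cmod c)\<^sup>2) = of_real 1" by (simp add: complex_norm_square del: of_real_power)
  then have "cmod c = 1" by (intro cmod_eq_1I) (simp only: of_real_eq_iff)
  moreover have "(cadj h ** g) *v axis 1 1 = cadj h *v (g *v axis 1 1)"
    by (simp add: matrix_vector_mul_assoc)
  then have "(cadj h ** g) *v axis 1 1 = c *s ((cadj h ** h) *v axis 1 1)"
    by (simp only: c vector_smult_matrix_mult matrix_vector_mul_assoc)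
  then have "(cadj h ** g) *v axis 1 1 = c *s axis 1 1" using h by (simp add: SU3_cancel)
  then have "((cadj h ** g) *v axis 1 1) $ 1 = (c *s axis 1 1) $ 1" by simp
  then have "(cadj h ** g) $ 1 $ 1 = c" by (simp only: mat1_axis) (simp add: axis_def)
  ultimately show ?thesis using g h by (simp add: isotropy_iff SU3_mult SU3_cadj)
qed

lemma cp2_act_continuous:
  assumes g: "g \<in> SU3"
  shows "continuous_on UNIV (cp2_act g)"
proof (subst continuous_on_open_vimage[OF open_UNIV], intro allI impI)
  fix S :: "cp2 set" assume "open S"
  then have S: "open {z. z \<noteq> 0 \<and> cp2_pt z \<in> S}" by (simp add: open_cp2_def)
  have "{z. z \<noteq> 0 \<and> cp2_pt z \<in> cp2_act g -` S} = (\<lambda>z. g *v z) -` {z. z \<noteq> 0 \<and> cp2_pt z \<in> S}"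
  proof (rule set_eqI)
    fix z :: "complex^3"
    show "z \<in> {z. z \<noteq> 0 \<and> cp2_pt z \<in> cp2_act g -` S} \<longleftrightarrow>
        z \<in> (\<lambda>z. g *v z) -` {z. z \<noteq> 0 \<and> cp2_pt z \<in> S}"
      by (cases "z = 0") (simp_all add: cp2_act_pt[OF g] SU3_mult_nz[OF g])
  qed
  moreover have "open ((\<lambda>z. g *v z) -` {z. z \<noteq> 0 \<and> cp2_pt z \<in> S})"
    by (rule open_vimage[OF S]) (rule linear_continuous_on[OF matrix_vector_mul_bounded_linear])
  ultimately show "open (cp2_act g -` S \<inter> UNIV)" by (simp add: open_cp2_def)
qed

lemma Cinf_continuous: "Cinf f \<Longrightarrow> continuous_on UNIV f"
  unfolding Cinf_def by (drule spec[of _ 0]) simp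

text \<open>Makes symbols measurable. The topology is a quotient while smoothness is stated in
  charts, so the preimage in z-space is cut into the three open sets where a coordinate is nonzero;
  there f is a chart function of the coordinate ratios.\<close>

lemma cp2_smooth_continuous:
  assumes "cp2_smooth f"
  shows "continuous_on UNIV f"
proof (subst continuous_on_open_vimage[OF open_UNIV], intro allI impI)
  fix S :: "complex set" assume S: "open S"
  have C: "continuous_on UNIV (\<lambda>(u, v). f (cp2_pt (vector [1, u, v])))"
    "continuous_on UNIV (\<lambda>(u, v). f (cp2_pt (vector [u, 1, v])))"
    "continuous_on UNIV (\<lambda>(u, v). f (cp2_pt (vector [u, v, 1])))"
    using assms by (simp_all add: cp2_smooth_def Cinf_continuous)
  have chart: "open {z. z $ i \<noteq> 0 \<and> f (cp2_pt z) \<in> S}"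
    if F: "continuous_on UNIV F"
      and eq: "\<And>z. z $ i \<noteq> 0 \<Longrightarrow> f (cp2_pt (inverse (z $ i) *s z)) = F (z $ j / z $ i, z $ k / z $ i)"
    for F i j k
  proof -
    have 1: "open {z :: complex^3. z $ i \<noteq> 0}"
      by (intro open_Collect_neq continuous_intros)
    have 2: "continuous_on {z :: complex^3. z $ i \<noteq> 0} (\<lambda>z. F (z $ j / z $ i, z $ k / z $ i))"
      by (rule continuous_on_compose2[OF F]) (auto intro!: continuous_intros)
    have "f (cp2_pt z) = F (z $ j / z $ i, z $ k / z $ i)" if "z $ i \<noteq> 0" for z
    proof -
      have "cp2_pt (inverse (z $ i) *s z) = cp2_pt z" using that by (intro cp2_pt_scale) auto
      then show ?thesis using eq[OF that] by simp
    qed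
    then have "{z. z $ i \<noteq> 0 \<and> f (cp2_pt z) \<in> S} =
        {z. z $ i \<noteq> 0} \<inter> (\<lambda>z. F (z $ j / z $ i, z $ k / z $ i)) -` S"
      by auto
    then show ?thesis using continuous_open_preimage[OF 2 1 S] by simp
  qed
  have vec: "z $ 1 \<noteq> 0 \<Longrightarrow> inverse (z $ 1) *s z = vector [1, z $ 2 / z $ 1, z $ 3 / z $ 1]"
    "z $ 2 \<noteq> 0 \<Longrightarrow> inverse (z $ 2) *s z = vector [z $ 1 / z $ 2, 1, z $ 3 / z $ 2]"
    "z $ 3 \<noteq> 0 \<Longrightarrow> inverse (z $ 3) *s z = vector [z $ 1 / z $ 3, z $ 2 / z $ 3, 1]"
    for z :: "complex^3"
    by (simp_all add: vec_eq_iff forall_3 field_simps)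
  have "{z. z \<noteq> 0 \<and> cp2_pt z \<in> f -` S} = {z. z $ 1 \<noteq> 0 \<and> f (cp2_pt z) \<in> S} \<union>
      {z. z $ 2 \<noteq> 0 \<and> f (cp2_pt z) \<in> S} \<union> {z. z $ 3 \<noteq> 0 \<and> f (cp2_pt z) \<in> S}"
    by (auto simp: vec_eq_iff forall_3)
  moreover have "open \<dots>"
    by (intro open_Un chart[OF C(1), of 1 2 3] chart[OF C(2), of 2 1 3] chart[OF C(3), of 3 1 2])
      (simp_all add: vec)
  ultimately have "open {z. z \<noteq> 0 \<and> cp2_pt z \<in> f -` S}" by simp
  then show "open (f -` S \<inter> UNIV)" by (simp add: open_cp2_def)
qed

section \<open>The conjugation action on operators\<close>

lemma trace_eqI:
  fixes X Y :: "complex^'n^'n"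
  assumes "\<And>A. trace (A ** X) = trace (A ** Y)"
  shows "X = Y"
proof -
  let ?Z = "X - Y"
  have "cadj ?Z ** X = cadj ?Z ** ?Z + cadj ?Z ** Y" by (simp flip: matrix_add_ldistrib)
  then have "trace (cadj ?Z ** ?Z) = 0" using assms[of "cadj ?Z"] by (simp add: trace_add)
  then have "trace (?Z ** cadj ?Z) = 0" by (simp add: trace_mul_sym[of ?Z])
  then have "inner ?Z ?Z = 0" by (simp add: inner_matrix)
  then show ?thesis by simp
qed

lemma trace_functional:
  fixes L :: "complex^'n^'n \<Rightarrow> complex"
  assumes add: "\<And>A B. L (A + B) = L A + L B" and scale: "\<And>c A. L (mscale c A) = c * L A"
  shows "\<exists>M. \<forall>A. L A = trace (A ** M)"
proof -
  define U :: "'n \<Rightarrow> 'n \<Rightarrow> complex^'n^'n" where "U i j = outer (axis i 1) (axis j 1)" for i j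
  have "mscale 0 0 = (0 :: complex^'n^'n)" by (simp add: vec_eq_iff)
  then have "L 0 = 0" using scale[of 0 0] by simp
  then have sum: "L (\<Sum>i\<in>I. f i) = (\<Sum>i\<in>I. L (f i))" for I :: "'n set" and f
    by (induction I rule: infinite_finite_induct) (simp_all add: add)
  have U: "U i j $ a $ b = (if a = i \<and> b = j then 1 else 0)" for i j a b
    by (simp add: U_def outer_def axis_def)
  have A: "A = (\<Sum>i\<in>UNIV. \<Sum>j\<in>UNIV. mscale (A $ i $ j) (U i j))" for A
  proof -
    have "(\<Sum>j\<in>UNIV. A $ i $ j * (if a = i \<and> b = j then 1 else 0)) = (if a = i then A $ i $ b else 0)" for i a b
      by (cases "a = i") (simp_all add: if_distrib cong: if_cong)
    then show ?thesis by (simp add: vec_eq_iff U)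
  qed
  define M :: "complex^'n^'n" where "M = (\<chi> j i. L (U i j))"
  have "L A = trace (A ** M)" for A
  proof -
    have "L A = (\<Sum>i\<in>UNIV. \<Sum>j\<in>UNIV. A $ i $ j * L (U i j))"
      by (subst A) (simp add: sum scale)
    then show ?thesis by (simp add: trace_def matrix_matrix_mult_def M_def)
  qed
  then show ?thesis by blast
qed

context symbol_rep
begin

abbreviation act :: "complex^3^3 \<Rightarrow> complex^'n^'n \<Rightarrow> complex^'n^'n" where
  "act \<equiv> conj_act \<rho>"

lemma unit: "g \<in> SU3 \<Longrightarrow> cadj (\<rho> g) ** \<rho> g = mat 1" "g \<in> SU3 \<Longrightarrow> \<rho> g ** cadj (\<rho> g) = mat 1"
  using unitary_rep_D(2)[OF rep] by (auto simp: unitary_mat_def)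

lemma act_eq: "g \<in> SU3 \<Longrightarrow> act g A = \<rho> g ** A ** cadj (\<rho> g)"
  by (simp add: conj_act_def matrix_inv_unitary unitary_rep_D(2)[OF rep])

lemma act_add: "g \<in> SU3 \<Longrightarrow> act g (A + B) = act g A + act g B"
  by (simp add: act_eq matrix_add_ldistrib matrix_add_rdistrib)

lemma act_mscale: "g \<in> SU3 \<Longrightarrow> act g (mscale c A) = mscale c (act g A)"
  by (simp add: act_eq mscale_mult_left mscale_mult_right)

lemma act_scaleR: "g \<in> SU3 \<Longrightarrow> act g (c *\<^sub>R A) = c *\<^sub>R act g A"
  by (metis act_mscale mscale_of_real)

lemma act_zero: "g \<in> SU3 \<Longrightarrow> act g 0 = 0"
  using act_scaleR[of g 0 0] by simp

lemma act_sum: "g \<in> SU3 \<Longrightarrow> act g (\<Sum>i\<in>I. f i) = (\<Sum>i\<in>I. act g (f i))"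
  by (induction I rule: infinite_finite_induct) (simp_all add: act_add act_zero)

lemma act_mult: "g \<in> SU3 \<Longrightarrow> h \<in> SU3 \<Longrightarrow> act (g ** h) A = act g (act h A)"
  by (simp add: act_eq SU3_mult unitary_rep_D(3)[OF rep] cadj_mult matrix_mul_assoc)

lemma act_one: "act (mat 1) A = A"
  by (simp add: act_eq SU3_one unitary_rep_one[OF rep])

lemma act_inverse: "g \<in> SU3 \<Longrightarrow> act (cadj g) (act g A) = A" "g \<in> SU3 \<Longrightarrow> act g (act (cadj g) A) = A"
  by (simp_all add: act_mult[symmetric] SU3_cadj SU3_cancel act_one)

lemma act_cadj: "g \<in> SU3 \<Longrightarrow> act g (cadj A) = cadj (act g A)"
  by (simp add: act_eq cadj_mult matrix_mul_assoc)

lemma act_prod: "g \<in> SU3 \<Longrightarrow> act g A ** act g B = act g (A ** B)"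
proof -
  assume g: "g \<in> SU3"
  have "\<rho> g ** A ** cadj (\<rho> g) ** (\<rho> g ** B ** cadj (\<rho> g)) = \<rho> g ** A ** (cadj (\<rho> g) ** \<rho> g) ** B ** cadj (\<rho> g)"
    by (simp only: matrix_mul_assoc)
  then show ?thesis using g by (simp add: act_eq unit matrix_mul_assoc)
qed

lemma trace_act: "g \<in> SU3 \<Longrightarrow> trace (act g A) = trace A"
proof -
  assume g: "g \<in> SU3"
  have "trace (\<rho> g ** A ** cadj (\<rho> g)) = trace (cadj (\<rho> g) ** (\<rho> g ** A))" by (rule trace_mul_sym)
  then show ?thesis using g by (simp add: act_eq unit matrix_mul_assoc)
qed

lemma trace_act_left: "g \<in> SU3 \<Longrightarrow> trace (act g A ** B) = trace (A ** act (cadj g) B)"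
  using trace_act[of "cadj g" "act g A ** B"] act_prod[of "cadj g" "act g A" B]
  by (simp add: SU3_cadj act_inverse)

lemma norm_act: "g \<in> SU3 \<Longrightarrow> norm (act g A) = norm A"
  by (simp add: norm_eq_sqrt_inner inner_matrix act_prod trace_act flip: act_cadj)

lemma act_outer: "g \<in> SU3 \<Longrightarrow> act g (outer x y) = outer (\<rho> g *v x) (\<rho> g *v y)"
  by (simp add: act_eq mult_outer outer_mult)

lemma isotropy_fixed_commute:
  assumes "isotropy_fixed \<rho> K" "h \<in> isotropy"
  shows "\<rho> h ** K = K ** \<rho> h"
proof -
  have h: "h \<in> SU3" using assms by (simp add: isotropy_SU3)
  have "act h K = K" using assms by (simp add: isotropy_fixed_def)
  then have "\<rho> h ** K ** cadj (\<rho> h) ** \<rho> h = K ** \<rho> h" by (simp add: act_eq[OF h])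
  then show ?thesis using h by (simp add: unit flip: matrix_mul_assoc)
qed

lemma isotropy_fixed_outer: "isotropy_fixed \<rho> (outer v v)"
  unfolding isotropy_fixed_def
proof
  fix h assume h: "h \<in> isotropy"
  then obtain c where c: "cmod c = 1" "\<rho> h *v v = c *s v" using isotropy_v by blast
  have "outer (c *s v) (c *s v) = mscale (c * cnj c) (outer v v)"
    by (simp add: vec_eq_iff outer_def)
  also have "\<dots> = outer v v"
    using c(1) by (simp add: vec_eq_iff flip: complex_norm_square)
  finally show "act h (outer v v) = outer v v" using h c by (simp add: act_outer isotropy_SU3)
qed

text \<open>Schur's lemma; the intertwiner has an eigenvalue.\<close>
lemma commutant_scalar:
  assumes "\<And>g. g \<in> SU3 \<Longrightarrow> act g M = M"
  obtains c where "M = mscale c (mat 1)"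
proof -
  have "(mat 1 :: complex^'n^'n) *v axis undefined 1 \<noteq> 0" by simp
  then obtain x :: "complex^'n" where "x \<noteq> 0" by blast
  then obtain y c where y: "y \<noteq> 0" "M *v y = c *s y"
    using eigenvector_in_subspace[of UNIV M x] by (auto simp: vec.subspace_UNIV)
  define U where "U = {x. M *v x = c *s x}"
  have "vec.subspace U"
    by (auto simp: U_def vec.subspace_def matrix_vector_right_distrib vec.scale_right_distrib
          vector_smult_matrix_mult vector_smult_assoc mult.commute)
  moreover have "\<rho> g *v x \<in> U" if g: "g \<in> SU3" and x: "x \<in> U" for g x
  proof -
    have "\<rho> g ** M ** cadj (\<rho> g) ** \<rho> g = M ** \<rho> g" using assms[OF g] by (simp add: act_eq g)
    then have "\<rho> g ** M = M ** \<rho> g" using g by (simp add: unit flip: matrix_mul_assoc)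
    then have "M *v (\<rho> g *v x) = \<rho> g *v (M *v x)" by (simp add: matrix_vector_mul_assoc)
    then show ?thesis using x by (simp add: U_def vector_smult_matrix_mult)
  qed
  ultimately have "U = {0} \<or> U = UNIV" by (rule irreducible)
  then have "U = UNIV" using y by (auto simp: U_def)
  then have "M *v x = mscale c (mat 1) *v x" for x by (auto simp: U_def mscale_vector_mult)
  then have "M = mscale c (mat 1)" using matrix_eq by blast
  with that show thesis by blast
qed

text \<open>Orthogonal projection onto S for the Hilbert-Schmidt product. Described by its residual,
  so that linearity and equivariance follow from uniqueness.\<close>

definition mproj :: "(complex^'n^'n) set \<Rightarrow> complex^'n^'n \<Rightarrow> complex^'n^'n" where
  "mproj S A = (THE y. y \<in> S \<and> (\<forall>B\<in>S. trace ((A - y) ** cadj B) = 0))"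

lemma matrix_diff_rdistrib: "(A - B) ** C = A ** C - B ** C" for A B C :: "complex^'n^'n"
  by (simp add: vec_eq_iff matrix_matrix_mult_def left_diff_distrib sum_subtractf)

text \<open>The real orthogonal projection serves: S also contains \<open>mscale \<i> B\<close>, and
  testing against it removes the imaginary part of the pairing.\<close>

lemma mproj_ex1:
  fixes S :: "(complex^'n^'n) set"
  assumes S: "module.subspace mscale S"
  shows "\<exists>!y. y \<in> S \<and> (\<forall>B\<in>S. trace ((A - y) ** cadj B) = 0)"
proof (rule ex_ex1I)
  have sub: "subspace S" by (rule mscale_subspace_imp_subspace[OF S])
  then have span: "span S = S" by (rule span_eq_iff[THEN iffD2])
  obtain y z where yz: "y \<in> span S" "A = y + z" "\<And>w. w \<in> span S \<Longrightarrow> orthogonal z w"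
    using orthogonal_subspace_decomp_exists[of S A] by blast
  have "trace (z ** cadj B) = 0" if B: "B \<in> S" for B
  proof -
    have iB: "mscale \<i> B \<in> S" using S B by (simp add: mscale_subspace_iff)
    have orth: "inner z X = 0" if "X \<in> S" for X using yz(3)[of X] that span by (simp add: orthogonal_def)
    have "Re (trace (z ** cadj B)) = 0" using orth[OF B] by (simp only: inner_matrix[of z B])
    moreover have "Re (trace (z ** cadj (mscale \<i> B))) = 0"
      using orth[OF iB] by (simp only: inner_matrix[of z "mscale \<i> B"])
    then have "Im (trace (z ** cadj B)) = 0" by (simp add: cadj_mscale mscale_mult_right trace_mscale)
    ultimately show ?thesis by (simp add: complex_eq_iff)
  qed
  then show "\<exists>y. y \<in> S \<and> (\<forall>B\<in>S. trace ((A - y) ** cadj B) = 0)"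
    using yz span by (intro exI[of _ y]) simp
next
  fix y y' assume *: "y \<in> S \<and> (\<forall>B\<in>S. trace ((A - y) ** cadj B) = 0)"
    "y' \<in> S \<and> (\<forall>B\<in>S. trace ((A - y') ** cadj B) = 0)"
  have "y - y' \<in> S" using * mscale_subspace_imp_subspace[OF S] by (simp add: subspace_diff)
  then have "trace ((A - y) ** cadj (y - y')) = 0" "trace ((A - y') ** cadj (y - y')) = 0" using * by auto
  then have "trace ((y - y') ** cadj (y - y')) = 0" by (simp add: matrix_diff_rdistrib trace_sub)
  then have "inner (y - y') (y - y') = 0" by (simp add: inner_matrix)
  then show "y = y'" by simp
qed

lemma mproj:
  assumes "module.subspace mscale S"
  shows "mproj S A \<in> S" "B \<in> S \<Longrightarrow> trace (mproj S A ** cadj B) = trace (A ** cadj B)"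
  using theI'[OF mproj_ex1[OF assms, of A]] unfolding mproj_def[symmetric]
  by (auto simp: matrix_diff_rdistrib trace_sub)

lemma mproj_eqI:
  assumes "module.subspace mscale S" "y \<in> S" "\<And>B. B \<in> S \<Longrightarrow> trace (y ** cadj B) = trace (A ** cadj B)"
  shows "mproj S A = y"
  unfolding mproj_def using assms(2,3)
  by (intro the1_equality[OF mproj_ex1[OF assms(1)]]) (auto simp: matrix_diff_rdistrib trace_sub)

lemma mproj_add:
  assumes S: "module.subspace mscale S"
  shows "mproj S (A + B) = mproj S A + mproj S B"
  using S mproj[OF S] by (intro mproj_eqI) (simp_all add: mscale_subspace_iff matrix_add_rdistrib trace_add)

lemma mproj_mscale:
  assumes S: "module.subspace mscale S"
  shows "mproj S (mscale c A) = mscale c (mproj S A)"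
  using S mproj[OF S] by (intro mproj_eqI) (simp_all add: mscale_subspace_iff mscale_mult_left trace_mscale)

lemma mproj_act:
  assumes S: "invariant_subspace mscale act S" and g: "g \<in> SU3"
  shows "mproj S (act g A) = act g (mproj S A)"
proof (rule mproj_eqI)
  have S': "module.subspace mscale S" "\<And>g A. g \<in> SU3 \<Longrightarrow> A \<in> S \<Longrightarrow> act g A \<in> S"
    using S by (auto simp: invariant_subspace_def)
  show "module.subspace mscale S" by (rule S')
  show "act g (mproj S A) \<in> S" using mproj[OF S'(1)] S' g by blast
  fix B assume B: "B \<in> S"
  have "act (cadj g) B \<in> S" using S' B SU3_cadj[OF g] by blast
  then have "trace (mproj S A ** cadj (act (cadj g) B)) = trace (A ** cadj (act (cadj g) B))"
    by (rule mproj(2)[OF S'(1)])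
  then show "trace (act g (mproj S A) ** cadj B) = trace (act g A ** cadj B)"
    using g by (simp add: trace_act_left act_cadj SU3_cadj)
qed

lemma mproj_adjoint:
  assumes S: "module.subspace mscale S"
  shows "trace (mproj S A ** cadj B) = trace (A ** cadj (mproj S B))"
proof -
  have sym: "trace (X ** cadj Y) = cnj (trace (Y ** cadj X))" for X Y :: "complex^'n^'n"
    by (simp add: cadj_mult flip: trace_cadj)
  have "trace (mproj S A ** cadj B) = cnj (trace (B ** cadj (mproj S A)))" by (rule sym)
  also have "\<dots> = cnj (trace (mproj S B ** cadj (mproj S A)))"
    using mproj[OF S] by simp
  also have "\<dots> = trace (mproj S A ** cadj (mproj S B))" by (rule sym[symmetric])
  also have "\<dots> = trace (A ** cadj (mproj S B))" using mproj[OF S] by simp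
  finally show ?thesis .
qed

text \<open>A nonzero intertwiner \<open>V \<rightarrow> V'\<close> is injective and carries the highest weight of \<open>V\<close> to a
  weight of \<open>V'\<close>.\<close>
lemma intertwiner_weight_le:
  assumes V: "irrep_with_highest_weight mscale act V (int n, int n)"
    and V': "irrep_with_highest_weight mscale act V' (int m, int m)"
    and T_add: "\<And>A B. T (A + B) = T A + T B" and T_mscale: "\<And>c A. T (mscale c A) = mscale c (T A)"
    and T_act: "\<And>g A. g \<in> SU3 \<Longrightarrow> T (act g A) = act g (T A)"
    and A: "A \<in> V" and B: "B \<in> V'" and nz: "trace (T A ** cadj B) \<noteq> 0"
  shows "n \<le> m"
proof -
  have iV: "invariant_subspace mscale act V" "invariant_subspace mscale act V'"
    and irr: "\<And>U. invariant_subspace mscale act U \<Longrightarrow> U \<subseteq> V \<Longrightarrow> U = {0} \<or> U = V"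
    using V V' by (auto simp: irrep_with_highest_weight_def irreducible_on_def)
  have sV: "module.subspace mscale V" and sV': "module.subspace mscale V'"
    and aV: "\<And>g A. g \<in> SU3 \<Longrightarrow> A \<in> V \<Longrightarrow> act g A \<in> V"
    using iV by (auto simp: invariant_subspace_def)
  define f where "f X = mproj V' (T X)" for X
  have f_add: "f (X + Y) = f X + f Y" and f_mscale: "f (mscale c X) = mscale c (f X)" for X Y c
    by (simp_all add: f_def T_add T_mscale mproj_add[OF sV'] mproj_mscale[OF sV'])
  have f_act: "f (act g X) = act g (f X)" if "g \<in> SU3" for g X
    using that by (simp add: f_def T_act mproj_act[OF iV(2)])
  have zero: "mscale c 0 = (0 :: complex^'n^'n)" "mscale 0 X = (0 :: complex^'n^'n)" for c X
    by (simp_all add: vec_eq_iff)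
  have f0: "f 0 = 0" using f_mscale[of 0 0] by (simp add: zero)
  have "trace (f A ** cadj B) \<noteq> 0" using nz mproj(2)[OF sV' B, of "T A"] by (simp add: f_def)
  then have fA: "f A \<noteq> 0" by auto
  have "invariant_subspace mscale act {X \<in> V. f X = 0}"
    unfolding invariant_subspace_def mscale_subspace_iff
    using sV aV by (auto simp: mscale_subspace_iff f_add f_mscale f_act f0 act_zero zero)
  then have "{X \<in> V. f X = 0} = {0} \<or> {X \<in> V. f X = 0} = V" by (rule irr) auto
  then have inj: "X = 0" if "X \<in> V" "f X = 0" for X using that fA A by blast
  obtain X where X: "X \<in> V" "X \<noteq> 0" "\<And>t. t \<in> torus \<Longrightarrow> act t X = mscale (weight_char (int n, int n) t) X"
    using V by (auto simp: irrep_with_highest_weight_def highest_weight_def is_weight_def)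
  then have "f X \<noteq> 0" using inj by blast
  moreover have "act t (f X) = mscale (weight_char (int n, int n) t) (f X)" if "t \<in> torus" for t
    using X(3)[OF that] f_act[OF torus_SU3[OF that], of X] by (simp add: f_mscale)
  moreover have "f X \<in> V'" by (simp add: f_def mproj(1)[OF sV'])
  ultimately have "is_weight mscale act V' (int n, int n)" by (auto simp: is_weight_def)
  moreover have "\<And>a b. is_weight mscale act V' (a, b) \<Longrightarrow>
      \<exists>k l :: nat. a = int m - 2 * int k + int l \<and> b = int m + int k - 2 * int l"
    using V' by (simp add: irrep_with_highest_weight_def highest_weight_def)
  ultimately obtain k l :: nat
    where "int n = int m - 2 * int k + int l" "int n = int m + int k - 2 * int l" by blast
  \<comment> \<open>The sum of the two equations is 2 n = 2 m - k - l.\<close>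
  then show "n \<le> m" by linarith
qed

text \<open>Self-adjointness of T turns a nonzero pairing into a nonzero intertwiner in each
  direction, so n and m bound each other. It is applied to the identity and to projections onto
  invariant subspaces.\<close>

lemma schur_orthogonal:
  assumes V: "irrep_with_highest_weight mscale act V (int n, int n)"
    and V': "irrep_with_highest_weight mscale act V' (int m, int m)" and "n \<noteq> m"
    and T: "\<And>A B. T (A + B) = T A + T B" "\<And>c A. T (mscale c A) = mscale c (T A)"
      "\<And>g A. g \<in> SU3 \<Longrightarrow> T (act g A) = act g (T A)"
    and adj: "\<And>A B. trace (T A ** cadj B) = trace (A ** cadj (T B))"
    and A: "A \<in> V" and B: "B \<in> V'"
  shows "trace (T A ** cadj B) = 0"
proof (rule ccontr)
  assume nz: "trace (T A ** cadj B) \<noteq> 0"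
  have "trace (T B ** cadj A) = cnj (trace (A ** cadj (T B)))"
    by (simp add: cadj_mult flip: trace_cadj)
  with nz have nz': "trace (T B ** cadj A) \<noteq> 0" by (simp flip: adj)
  have "m \<le> n" by (rule intertwiner_weight_le[where T = T, OF V' V T B A nz'])
  moreover have "n \<le> m" by (rule intertwiner_weight_le[where T = T, OF V V' T A B nz])
  ultimately show False using \<open>n \<noteq> m\<close> by simp
qed

end

section \<open>Symbols\<close>

lemma Cinf_matrix_mult:
  fixes F :: "'a::real_normed_vector \<Rightarrow> complex^'n^'m" and G :: "'a \<Rightarrow> complex^'k^'n"
  assumes "\<And>i j. Cinf (\<lambda>e. F e $ i $ j)" "\<And>i j. Cinf (\<lambda>e. G e $ i $ j)"
  shows "Cinf (\<lambda>e. (F e ** G e) $ i $ j)"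
  unfolding matrix_matrix_mult_def by (simp, intro Cinf_sum Cinf_mult assms)

text \<open>Rotating the coordinates carries the first chart to the other two, so one smooth section
  is enough. The rotation is also the reason for the exchange of u and v in the second
  chart.\<close>

lemma cp2_pt_charts:
  "cp2_pt (vector [1, u, v]) = cp2_act (chart_section u v) cp2_base"
  "cp2_pt (vector [u, 1, v]) = cp2_act (cyc ** chart_section v u) cp2_base"
  "cp2_pt (vector [u, v, 1]) = cp2_act (cyc ** (cyc ** chart_section u v)) cp2_base"
proof -
  have 1: "cp2_pt (vector [1, u, v]) = cp2_act (chart_section u v) cp2_base" for u v
  proof -
    obtain a where a: "a \<noteq> 0" "chart_section u v *v axis 1 1 = a *s vector [1, u, v]"
      using chart_section_column by blast
    have "vector [1, u, v] \<noteq> (0 :: complex^3)" by (auto simp: vec_eq_iff forall_3)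
    then show ?thesis using a by (simp add: cp2_act_base chart_section_SU3 cp2_pt_scale)
  qed
  have cyc: "cp2_act cyc (cp2_pt (vector [x, y, z])) = cp2_pt (vector [z, x, y])"
    if "vector [x, y, z] \<noteq> (0 :: complex^3)" for x y z
  proof -
    have "cyc *v vector [x, y, z] = vector [z, x, y]"
      by (simp add: vec_eq_iff forall_3 matrix_vector_mult_def sum_3)
    then show ?thesis using that by (simp add: cp2_act_pt cyc_SU3)
  qed
  have nz: "vector [1, x, y] \<noteq> (0 :: complex^3)" "vector [x, 1, y] \<noteq> (0 :: complex^3)" for x y
    by (auto simp: vec_eq_iff forall_3)
  show "cp2_pt (vector [1, u, v]) = cp2_act (chart_section u v) cp2_base" by (rule 1)
  show "cp2_pt (vector [u, 1, v]) = cp2_act (cyc ** chart_section v u) cp2_base"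
    using cyc[OF nz(1), of v u] 1[of v u] by (simp add: cp2_act_mult cyc_SU3 chart_section_SU3)
  show "cp2_pt (vector [u, v, 1]) = cp2_act (cyc ** (cyc ** chart_section u v)) cp2_base"
    using cyc[OF nz(1), of u v] cyc[OF nz(2), of v u] 1[of u v]
    by (simp add: cp2_act_mult cyc_SU3 chart_section_SU3 SU3_mult)
qed

context symbol_rep
begin

text \<open>Some representative of the coset over x is chosen; by \<open>symbol_at\<close> the value
  does not depend on it when K is isotropy-fixed.\<close>

definition symbol :: "complex^'n^'n \<Rightarrow> complex^'n^'n \<Rightarrow> cp2 \<Rightarrow> complex" where
  "symbol K A x = trace (A ** act (SOME g. g \<in> SU3 \<and> cp2_act g cp2_base = x) K)"

lemma symbol_at:
  assumes K: "isotropy_fixed \<rho> K" and g: "g \<in> SU3"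
  shows "symbol K A (cp2_act g cp2_base) = trace (A ** act g K)"
proof -
  define h where "h = (SOME h. h \<in> SU3 \<and> cp2_act h cp2_base = cp2_act g cp2_base)"
  have h: "h \<in> SU3" "cp2_act h cp2_base = cp2_act g cp2_base"
    using someI_ex[of "\<lambda>h. h \<in> SU3 \<and> cp2_act h cp2_base = cp2_act g cp2_base"] g
    unfolding h_def[symmetric] by blast+
  have "cadj g ** h \<in> isotropy" by (rule cp2_act_base_eq[OF h(1) g h(2)])
  then have "act (cadj g ** h) K = K" using K by (simp add: isotropy_fixed_def)
  then have "act g (act (cadj g) (act h K)) = act g K" using g h by (simp add: act_mult SU3_cadj)
  then have "act h K = act g K" using g by (simp add: act_inverse)
  then show ?thesis by (simp add: symbol_def flip: h_def)
qed

lemma symbol_smooth: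
  assumes K: "isotropy_fixed \<rho> K"
  shows "cp2_smooth (symbol K A)"
proof -
  have C: "Cinf (\<lambda>e. symbol K A (cp2_act (G e) cp2_base))"
    if G: "\<And>e. G e \<in> SU3" "\<And>i j. Cinf (\<lambda>e. G e $ i $ j)" for G :: "complex \<times> complex \<Rightarrow> complex^3^3"
  proof -
    have "symbol K A (cp2_act (G e) cp2_base)
        = (\<Sum>i\<in>UNIV. (A ** (\<rho> (G e) ** K ** cadj (\<rho> (G e)))) $ i $ i)" for e
      by (simp add: symbol_at[OF K G(1)] act_eq[OF G(1)] trace_def)
    moreover have "Cinf (\<lambda>e. cadj (\<rho> (G e)) $ i $ j)" for i j
      by (simp add: Cinf_cnj smooth[OF G])
    ultimately show ?thesis
      by (simp only:) (intro Cinf_sum Cinf_matrix_mult Cinf_const smooth[OF G])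
  qed
  have sec: "Cinf (\<lambda>e. chart_section (fst e) (snd e) $ i $ j)"
    "Cinf (\<lambda>e. chart_section (snd e) (fst e) $ i $ j)" for i j
    by (intro Cinf_chart_section Cinf_bounded_linear bounded_linear_fst bounded_linear_snd)+
  show ?thesis
    unfolding cp2_smooth_def cp2_pt_charts case_prod_beta
    by (intro conjI C SU3_mult cyc_SU3 chart_section_SU3 Cinf_matrix_mult Cinf_const sec)
qed

lemma symbol_add: "symbol K (A + B) x = symbol K A x + symbol K B x"
  by (simp add: symbol_def matrix_add_rdistrib trace_add)

lemma symbol_mscale: "symbol K (mscale c A) x = c * symbol K A x"
  by (simp add: symbol_def mscale_mult_left trace_mscale)

lemma symbol_act:
  assumes K: "isotropy_fixed \<rho> K" and g: "g \<in> SU3"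
  shows "symbol K (act g A) x = symbol K A (cp2_act (cadj g) x)"
proof -
  obtain h where h: "h \<in> SU3" "cp2_act h cp2_base = x" using cp2_transitive by blast
  have "symbol K A (cp2_act (cadj g ** h) cp2_base) = trace (A ** act (cadj g ** h) K)"
    using g h by (intro symbol_at[OF K] SU3_mult SU3_cadj)
  then show ?thesis
    using g h symbol_at[OF K h(1), of "act g A"]
    by (simp add: cp2_act_mult SU3_cadj act_mult trace_act_left)
qed

lemma symbol_cadj:
  assumes K: "isotropy_fixed \<rho> K" "cadj K = K"
  shows "symbol K (cadj A) x = cnj (symbol K A x)"
proof -
  obtain h where h: "h \<in> SU3" "cp2_act h cp2_base = x" using cp2_transitive by blast
  have "cnj (trace (A ** act h K)) = trace (cadj (act h K) ** cadj A)"
    by (simp flip: trace_cadj cadj_mult)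
  also have "\<dots> = trace (cadj A ** act h K)"
    using K h by (simp add: trace_mul_sym[of "act h K"] flip: act_cadj)
  finally show ?thesis using symbol_at[OF K(1) h(1)] h by simp
qed

text \<open>Provides integrability. The action is isometric, so Cauchy-Schwarz bounds the real part;
  the imaginary part is the real part for \<open>mscale (- \<i>) A\<close>.\<close>

lemma symbol_bound:
  assumes K: "isotropy_fixed \<rho> K"
  shows "cmod (symbol K A x) \<le> (norm A + norm (mscale (- \<i>) A)) * norm (cadj K)"
proof -
  obtain h where h: "h \<in> SU3" "cp2_act h cp2_base = x" using cp2_transitive by blast
  have Re: "\<bar>Re (trace (A ** act h K))\<bar> \<le> norm A * norm (cadj K)" for A
  proof -
    have "Re (trace (A ** act h K)) = inner A (act h (cadj K))"
      using h by (simp add: inner_matrix act_cadj)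
    then show ?thesis
      using Cauchy_Schwarz_ineq2[of A "act h (cadj K)"] h by (simp add: norm_act)
  qed
  have "Im (trace (A ** act h K)) = Re (trace (mscale (- \<i>) A ** act h K))"
    by (simp add: mscale_mult_left trace_mscale)
  then have "\<bar>Im (trace (A ** act h K))\<bar> \<le> norm (mscale (- \<i>) A) * norm (cadj K)"
    using Re[of "mscale (- \<i>) A"] by simp
  then have "cmod (trace (A ** act h K)) \<le> (norm A + norm (mscale (- \<i>) A)) * norm (cadj K)"
    using Re[of A] cmod_le[of "trace (A ** act h K)"] by (simp add: distrib_right)
  then show ?thesis using symbol_at[OF K h(1), of A] h by simp
qed

lemma symbol_one:
  assumes K: "isotropy_fixed \<rho> K"
  shows "symbol K (mat 1) x = trace K"
proof -
  obtain h where h: "h \<in> SU3" "cp2_act h cp2_base = x" using cp2_transitive by blast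
  then show ?thesis using symbol_at[OF K h(1), of "mat 1"] by (simp add: trace_act)
qed

text \<open>The integral of the symbol is an invariant linear functional of A, hence A \<mapsto>
  tr(A M) with M fixed by the action. By Schur's lemma M is scalar, and the identity operator, with
  constant symbol \<open>trace K\<close>, determines the scalar.\<close>

lemma symbol_integral:
  assumes K: "isotropy_fixed \<rho> K" and tr: "trace K = 1" and \<mu>: "invariant_probability \<mu>"
  shows "integral\<^sup>L \<mu> (symbol K A) = trace A / of_nat CARD('n)"
proof -
  interpret prob_space \<mu> using \<mu> by (simp add: invariant_probability_def)
  have sets: "sets \<mu> = sets borel" and inv: "\<And>g. g \<in> SU3 \<Longrightarrow> distr \<mu> \<mu> (cp2_act g) = \<mu>"
    using \<mu> by (auto simp: invariant_probability_def)
  have meas: "symbol K A \<in> borel_measurable \<mu>" for A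
    using borel_measurable_continuous_onI[OF cp2_smooth_continuous[OF symbol_smooth[OF K]]]
    by (simp cong: measurable_cong_sets add: sets)
  have act_meas: "cp2_act g \<in> measurable \<mu> \<mu>" if "g \<in> SU3" for g
    using borel_measurable_continuous_onI[OF cp2_act_continuous[OF that]]
    by (simp cong: measurable_cong_sets add: sets)
  have int: "integrable \<mu> (symbol K A)" for A
    by (rule integrable_const_bound[OF AE_I2[OF symbol_bound[OF K]] meas])
  define L where "L A = integral\<^sup>L \<mu> (symbol K A)" for A
  have "L (A + B) = L A + L B" for A B
  proof -
    have "symbol K (A + B) = (\<lambda>x. symbol K A x + symbol K B x)" by (simp add: fun_eq_iff symbol_add)
    then show ?thesis by (simp add: L_def int)
  qed
  moreover have "L (mscale c A) = c * L A" for c A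
  proof -
    have "symbol K (mscale c A) = (\<lambda>x. c * symbol K A x)" by (simp add: fun_eq_iff symbol_mscale)
    then show ?thesis by (simp add: L_def)
  qed
  ultimately obtain M where M: "\<And>A. L A = trace (A ** M)" using trace_functional[of L] by blast
  have L_act: "L (act g A) = L A" if g: "g \<in> SU3" for g A
  proof -
    have "symbol K (act g A) = (\<lambda>x. symbol K A (cp2_act (cadj g) x))"
      by (simp add: fun_eq_iff symbol_act[OF K g])
    then have "L (act g A) = integral\<^sup>L \<mu> (\<lambda>x. symbol K A (cp2_act (cadj g) x))"
      by (simp add: L_def)
    also have "\<dots> = integral\<^sup>L (distr \<mu> \<mu> (cp2_act (cadj g))) (symbol K A)"
      by (rule integral_distr[symmetric, OF act_meas[OF SU3_cadj[OF g]] meas])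
    also have "\<dots> = L A" by (simp add: inv SU3_cadj g L_def)
    finally show ?thesis .
  qed
  have "act g M = M" if g: "g \<in> SU3" for g
  proof (rule trace_eqI)
    fix A
    have "trace (A ** act g M) = trace (act (cadj g) A ** M)"
      using trace_act_left[OF SU3_cadj[OF g], of A M] by simp
    also have "\<dots> = trace (A ** M)" using L_act[OF SU3_cadj[OF g], of A] by (simp add: M)
    finally show "trace (A ** act g M) = trace (A ** M)" .
  qed
  then obtain c where c: "M = mscale c (mat 1)" using commutant_scalar by blast
  have Lc: "L A = c * trace A" for A by (simp add: M c mscale_mult_right trace_mscale)
  have "symbol K (mat 1) = (\<lambda>x. 1)" by (simp add: fun_eq_iff symbol_one[OF K] tr)
  then have "L (mat 1) = 1" by (simp add: L_def prob_space)
  then have "c * of_nat CARD('n) = 1" by (simp add: Lc trace_I)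
  then have "c = 1 / of_nat CARD('n)" by (simp add: field_simps)
  then show ?thesis using Lc[of A] by (simp add: L_def)
qed

section \<open>Existence and uniqueness of operator kernels\<close>

lemma act_fixed_if_kernel:
  assumes W: "symbol_correspondence \<rho> \<mu> W" and K: "\<And>A. W A cp2_base = trace (A ** K)"
  shows "operator_kernel \<rho> W K"
proof -
  have W_act: "W (act g A) x = W A (cp2_act (cadj g) x)" if "g \<in> SU3" for g A x
    using W that by (simp add: symbol_correspondence_def SU3_matrix_inv)
  have at: "W A (cp2_act g cp2_base) = trace (A ** act g K)" if g: "g \<in> SU3" for g A
  proof -
    have "W A (cp2_act g cp2_base) = W (act (cadj g) A) cp2_base"
      using W_act[OF SU3_cadj[OF g], of A cp2_base] by simp
    also have "\<dots> = trace (A ** act g K)"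
      using trace_act_left[OF SU3_cadj[OF g], of A K] by (simp add: K)
    finally show ?thesis .
  qed
  have "act h K = K" if h: "h \<in> isotropy" for h
  proof (rule trace_eqI)
    show "trace (A ** act h K) = trace (A ** K)" for A
      using at[OF isotropy_SU3[OF h], of A] K[of A] by (simp add: isotropy_fixes_base[OF h])
  qed
  then show ?thesis using at by (simp add: operator_kernel_def isotropy_fixed_def)
qed

lemma operator_kernel_base:
  assumes "operator_kernel \<rho> W K"
  shows "W A cp2_base = trace (A ** K)"
proof -
  have "W A (cp2_act (mat 1) cp2_base) = trace (A ** act (mat 1) K)"
    using assms SU3_one by (simp add: operator_kernel_def)
  moreover have "cp2_act (mat 1) cp2_base = cp2_base"
    by (simp add: cp2_act_base[OF SU3_one] cp2_base_eq[symmetric])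
  ultimately show ?thesis by (simp add: act_one)
qed

lemma operator_kernel_ex1:
  assumes W: "symbol_correspondence \<rho> \<mu> W"
  shows "\<exists>!K. operator_kernel \<rho> W K"
proof (rule ex_ex1I)
  obtain K where "\<And>A. W A cp2_base = trace (A ** K)"
    using trace_functional[of "\<lambda>A. W A cp2_base"] W by (auto simp: symbol_correspondence_def)
  then show "\<exists>K. operator_kernel \<rho> W K" using act_fixed_if_kernel[OF W] by blast
next
  fix K K' assume "operator_kernel \<rho> W K" "operator_kernel \<rho> W K'"
  then show "K = K'" by (intro trace_eqI) (simp flip: operator_kernel_base)
qed

lemma operator_kernel_symbol:
  assumes "operator_kernel \<rho> W K"
  shows "W = symbol K"
proof (intro ext)
  fix A x
  obtain h where h: "h \<in> SU3" "cp2_act h cp2_base = x" using cp2_transitive by blast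
  then show "W A x = symbol K A x"
    using assms symbol_at[of K h A] by (auto simp: operator_kernel_def)
qed

lemma symbol_kernel: "isotropy_fixed \<rho> K \<Longrightarrow> operator_kernel \<rho> (symbol K) K"
  by (simp add: operator_kernel_def symbol_at)

end

section \<open>The fixed basis\<close>

locale symbol_basis = symbol_rep \<rho> p v bv
  for \<rho> :: "complex^3^3 \<Rightarrow> complex^'n^'n" and p v bv +
  fixes E :: "nat \<Rightarrow> complex^'n^'n"
  assumes basis: "fixed_basis \<rho> p E"
begin

lemma E:
  assumes "n \<le> p"
  shows "isotropy_fixed \<rho> (E n)" "cadj (E n) = E n" "trace (E n ** E n) = 1"
  using basis assms by (auto simp: fixed_basis_def)

lemma E_0: "E 0 = (1 / sqrt (real CARD('n))) *\<^sub>R mat 1"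
  using basis by (simp add: fixed_basis_def)

lemma E_irrep:
  assumes "n \<le> p"
  obtains V where "irrep_with_highest_weight mscale act V (int n, int n)" "E n \<in> V"
  using basis assms by (auto simp: fixed_basis_def)

lemma E_act_orthogonal:
  assumes n: "n \<le> p" and m: "m \<le> p" and "n \<noteq> m" and g: "g \<in> SU3"
  shows "trace (E n ** act g (E m)) = 0"
proof -
  obtain V where V: "irrep_with_highest_weight mscale act V (int n, int n)" "E n \<in> V"
    using E_irrep[OF n] by blast
  obtain V' where V': "irrep_with_highest_weight mscale act V' (int m, int m)" "E m \<in> V'"
    using E_irrep[OF m] by blast
  have "act g (E m) \<in> V'"
    using V' g by (auto simp: irrep_with_highest_weight_def irreducible_on_def invariant_subspace_def)
  then have "trace (E n ** cadj (act g (E m))) = 0"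
    using schur_orthogonal[OF V(1) V'(1) \<open>n \<noteq> m\<close>, of "\<lambda>A. A"] V(2) by blast
  then show ?thesis using g by (simp add: E(2)[OF m] flip: act_cadj)
qed

lemma E_orthonormal:
  assumes n: "n \<le> p" and m: "m \<le> p"
  shows "trace (E n ** E m) = (if n = m then 1 else 0)"
  using E_act_orthogonal[OF n m _ SU3_one] E(3)[OF n] by (auto simp: act_one)

lemma E_mproj_orthogonal:
  assumes n: "n \<le> p" and m: "m \<le> p" and "n \<noteq> m" and S: "invariant_subspace mscale act S"
  shows "trace (mproj S (E n) ** E m) = 0"
proof -
  obtain V where V: "irrep_with_highest_weight mscale act V (int n, int n)" "E n \<in> V"
    using E_irrep[OF n] by blast
  obtain V' where V': "irrep_with_highest_weight mscale act V' (int m, int m)" "E m \<in> V'"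
    using E_irrep[OF m] by blast
  have S': "module.subspace mscale S" using S by (simp add: invariant_subspace_def)
  have "trace (mproj S (E n) ** cadj (E m)) = 0"
    by (rule schur_orthogonal[OF V(1) V'(1) \<open>n \<noteq> m\<close> _ _ _ mproj_adjoint[OF S'] V(2) V'(2)])
      (simp_all add: mproj_add[OF S'] mproj_mscale[OF S'] mproj_act[OF S])
  then show ?thesis by (simp add: E(2)[OF m])
qed

definition coef :: "complex^'n^'n \<Rightarrow> nat \<Rightarrow> real" where
  "coef K n = Re (trace (K ** E n))"

lemma coef_sum:
  assumes "m \<le> p"
  shows "coef (\<Sum>n=0..p. a n *\<^sub>R E n) m = a m"
proof -
  have "trace ((\<Sum>n=0..p. a n *\<^sub>R E n) ** E m) = (\<Sum>n=0..p. of_real (a n) * trace (E n ** E m))"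
    by (simp add: matrix_mult_sum_left trace_sum scaleR_matrix_mult_left trace_scaleR
        scaleR_conv_of_real[where 'a = complex])
  also have "\<dots> = (\<Sum>n=0..p. if n = m then of_real (a n) else 0)"
    using assms by (intro sum.cong refl) (simp add: E_orthonormal)
  also have "\<dots> = of_real (a m)" using assms by simp
  finally show ?thesis by (simp add: coef_def)
qed

section \<open>Isotropy-fixed Hermitian operators\<close>

definition fixed_herm :: "(complex^'n^'n) set" where
  "fixed_herm = {K. isotropy_fixed \<rho> K \<and> cadj K = K}"

lemma subspace_fixed_herm: "subspace fixed_herm"
  unfolding subspace_def fixed_herm_def isotropy_fixed_def
  by (auto simp: act_add act_scaleR act_zero isotropy_SU3 cadj_add cadj_scaleR)

lemma E_fixed_herm: "n \<le> p \<Longrightarrow> E n \<in> fixed_herm"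
  by (simp add: fixed_herm_def E)

lemma inner_E: "n \<le> p \<Longrightarrow> inner K (E n) = coef K n"
  by (simp add: inner_matrix coef_def E)

text \<open>Expectations at the p + 1 test vectors \<open>bv j\<close> determine an element of the
  space, and they are real because it is Hermitian. They are packed into a map \<open>T\<close> with
  values in the span of p + 1 rank-one operators, so that injectivity of \<open>T\<close> bounds the
  dimension.\<close>

lemma dim_fixed_herm: "dim fixed_herm \<le> p + 1"
proof -
  define D where "D j = outer (bv j) (bv j)" for j
  define T where "T K = (\<Sum>j\<le>p. inner K (D j) *\<^sub>R D j)" for K
  have lin: "linear T"
    unfolding T_def
    by (intro linear_compose_sum) (auto intro!: linearI simp: inner_add_left scaleR_left_distrib)
  have "K = 0" if K: "K \<in> fixed_herm" and 0: "T K = 0" for K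
  proof (rule isotropy_fixed_determined)
    show "\<rho> h ** K = K ** \<rho> h" if "h \<in> isotropy" for h
      using K that by (intro isotropy_fixed_commute) (simp add: fixed_herm_def)
    have "(\<Sum>j\<le>p. (inner K (D j))\<^sup>2) = inner K (T K)"
      by (simp add: T_def inner_sum_right power2_eq_square)
    then have "(\<Sum>j\<le>p. (inner K (D j))\<^sup>2) = 0" using 0 by simp
    then have *: "inner K (D j) = 0" if "j \<le> p" for j
      using that by (simp add: sum_nonneg_eq_0_iff)
    show "cin (K *v bv j) (bv j) = 0" if "j \<le> p" for j
    proof -
      have "Re (cin (K *v bv j) (bv j)) = 0"
        using *[OF that] by (simp add: inner_matrix D_def cadj_outer trace_mult_outer)
      moreover have "cnj (cin (K *v bv j) (bv j)) = cin (K *v bv j) (bv j)"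
        using K by (simp add: fixed_herm_def cin_mult_left[of K] flip: cin_commute)
      then have "Im (cin (K *v bv j) (bv j)) = 0" by (simp add: complex_eq_iff)
      ultimately show ?thesis by (simp add: complex_eq_iff)
    qed
  qed
  then have "inj_on T fixed_herm"
    using linear_injective_on_subspace_0[OF lin subspace_fixed_herm] by blast
  then have "inj_on T (span fixed_herm)"
    using subspace_fixed_herm by (simp add: span_eq_iff[THEN iffD2])
  then have "dim fixed_herm = dim (T ` fixed_herm)"
    using dim_image_eq[OF lin] by simp
  also have "\<dots> \<le> card (D ` {..p})"
  proof (intro dim_le_card image_subsetI)
    show "T K \<in> span (D ` {..p})" for K
      unfolding T_def by (intro span_sum span_scale span_base) simp
  qed simp
  also have "\<dots> \<le> p + 1" using card_image_le[of "{..p}" D] by simp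
  finally show ?thesis .
qed

lemma fixed_expansion:
  assumes K: "isotropy_fixed \<rho> K" "cadj K = K"
  shows "K = (\<Sum>n=0..p. coef K n *\<^sub>R E n)"
proof -
  have orth: "inner (E n) (E m) = (if n = m then 1 else 0)" if "n \<le> p" "m \<le> p" for n m
    using that by (simp add: inner_E coef_def E_orthonormal)
  have inj: "inj_on E {0..p}"
    by (rule inj_onI) (metis atLeastAtMost_iff orth zero_neq_one)
  have "independent (E ` {0..p})"
  proof (rule pairwise_orthogonal_independent)
    show "pairwise orthogonal (E ` {0..p})"
      unfolding pairwise_def orthogonal_def using orth by auto
    show "0 \<notin> E ` {0..p}" using orth by (metis atLeastAtMost_iff imageE inner_zero_left zero_neq_one)
  qed
  then have "dim (span (E ` {0..p})) = p + 1"
    using inj by (simp add: dim_span_eq_card_independent card_image del: dim_span)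
  moreover have "span (E ` {0..p}) \<subseteq> fixed_herm"
    by (rule span_minimal) (auto simp: E_fixed_herm subspace_fixed_herm)
  ultimately have span: "span (E ` {0..p}) = fixed_herm"
    using dim_fixed_herm by (intro subspace_dim_equal subspace_span subspace_fixed_herm) auto
  define X where "X = K - (\<Sum>n=0..p. coef K n *\<^sub>R E n)"
  have "inner X (E m) = 0" if "m \<le> p" for m
  proof -
    have "inner (\<Sum>n=0..p. coef K n *\<^sub>R E n) (E m) = coef K m"
      using that by (simp only: inner_E coef_sum)
    then show ?thesis using that by (simp add: X_def inner_diff_left inner_E)
  qed
  then have E0: "orthogonal X y" if "y \<in> E ` {0..p}" for y using that by (auto simp: orthogonal_def)
  have "X \<in> fixed_herm"
    unfolding X_def using K
    by (intro subspace_diff subspace_sum subspace_scale subspace_fixed_herm E_fixed_herm)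
      (auto simp: fixed_herm_def)
  then have "orthogonal X X" using orthogonal_to_span[of X "E ` {0..p}" X] E0 span by blast
  then show ?thesis by (simp add: X_def orthogonal_self)
qed

text \<open>The operators annihilated by all \<open>K\<^sup>g\<close> form an invariant space \<open>S\<close>.  By Schur's lemma the
  projection of \<open>E n\<close> to \<open>S\<close> pairs with \<open>K\<close> as \<open>coef K n\<close> times its pairing with \<open>E n\<close>, so \<open>S\<close> is
  orthogonal to all \<open>E n\<close>, hence to the orbit of the rank-one projection at \<open>v\<close>.\<close>
lemma kernel_nondegenerate:
  assumes K: "isotropy_fixed \<rho> K" "cadj K = K" and nz: "\<And>n. n \<le> p \<Longrightarrow> coef K n \<noteq> 0"
    and A: "\<And>g. g \<in> SU3 \<Longrightarrow> trace (A ** act g K) = 0"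
  shows "A = 0"
proof -
  define S where "S = {A. \<forall>g\<in>SU3. trace (A ** act g K) = 0}"
  have S: "module.subspace mscale S"
    unfolding mscale_subspace_iff S_def
    by (auto simp: matrix_add_rdistrib trace_add mscale_mult_left trace_mscale)
  have S_act: "act h X \<in> S" if "h \<in> SU3" "X \<in> S" for h X
    using that by (auto simp: S_def trace_act_left SU3_cadj SU3_mult simp flip: act_mult)
  have S_inv: "invariant_subspace mscale act S"
    using S S_act by (simp add: invariant_subspace_def)
  have E_S: "trace (E n ** cadj X) = 0" if n: "n \<le> p" and X: "X \<in> S" for n X
  proof -
    define y where "y = mproj S (E n)"
    have y: "y \<in> S" by (simp add: y_def mproj[OF S])
    then have "trace (y ** act (mat 1) K) = 0" using SU3_one by (auto simp: S_def)
    then have "0 = trace (y ** K)" by (simp add: act_one)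
    also have "\<dots> = trace (y ** (\<Sum>m=0..p. coef K m *\<^sub>R E m))" using fixed_expansion[OF K] by simp
    also have "\<dots> = (\<Sum>m=0..p. coef K m *\<^sub>R trace (y ** E m))"
      by (simp add: matrix_mult_sum_right trace_sum scaleR_matrix_mult_right trace_scaleR)
    also have "\<dots> = (\<Sum>m=0..p. if m = n then coef K n *\<^sub>R trace (y ** E n) else 0)"
      using E_mproj_orthogonal[OF n _ _ S_inv] by (intro sum.cong refl) (auto simp: y_def)
    also have "\<dots> = coef K n *\<^sub>R trace (y ** E n)" using n by simp
    finally have "trace (y ** E n) = 0" using nz[OF n] by simp
    then have "trace (cadj (y ** E n)) = 0" by (simp add: trace_cadj)
    then have "trace (E n ** cadj y) = 0" by (simp add: cadj_mult E(2)[OF n])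
    then have "trace (y ** cadj y) = 0" using mproj(2)[OF S y, of "E n"] by (simp add: y_def)
    then have "inner y y = 0" by (simp add: inner_matrix)
    then have "y = 0" by simp
    then show ?thesis using mproj(2)[OF S X, of "E n"] by (simp add: y_def)
  qed
  let ?P = "outer v v"
  have P_S: "trace (?P ** cadj X) = 0" if X: "X \<in> S" for X
  proof -
    have "trace (?P ** cadj X) = trace ((\<Sum>n=0..p. coef ?P n *\<^sub>R E n) ** cadj X)"
      using fixed_expansion[OF isotropy_fixed_outer cadj_outer] by simp
    also have "\<dots> = (\<Sum>n=0..p. coef ?P n *\<^sub>R trace (E n ** cadj X))"
      by (simp add: matrix_mult_sum_left trace_sum scaleR_matrix_mult_left trace_scaleR)
    also have "\<dots> = 0" by (simp add: E_S[OF _ X])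
    finally show ?thesis .
  qed
  show "A = 0"
  proof (rule orbit_expectations_determine)
    fix g assume g: "g \<in> SU3"
    have "A \<in> S" using A by (simp add: S_def)
    then have "trace (cadj (?P ** cadj (act (cadj g) A))) = 0"
      using P_S[OF S_act[OF SU3_cadj[OF g]]] by (simp add: trace_cadj)
    then have "trace (act (cadj g) A ** ?P) = 0" by (simp add: cadj_mult cadj_outer)
    then have "trace (A ** act g ?P) = 0" using trace_act_left[OF SU3_cadj[OF g], of A ?P] by simp
    then show "cin (A *v (\<rho> g *v v)) (\<rho> g *v v) = 0"
      by (simp add: act_outer[OF g] trace_mult_outer)
  qed
qed

section \<open>Operator kernels in coordinates\<close>

lemma trace_coef_0:
  assumes K: "isotropy_fixed \<rho> K" "cadj K = K"
  shows "trace K = of_real (sqrt (real CARD('n)) * coef K 0)"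
proof -
  have "K ** E 0 = (1 / sqrt (real CARD('n))) *\<^sub>R K" by (simp add: E_0 scaleR_matrix_mult_right)
  then have "coef K 0 = Re (trace K) / sqrt (real CARD('n))"
    by (simp add: coef_def trace_scaleR)
  moreover have "cnj (trace K) = trace K" using K(2) by (metis trace_cadj)
  then have "Im (trace K) = 0" by (simp add: complex_eq_iff)
  ultimately show ?thesis by (simp add: complex_eq_iff)
qed

text \<open>By \<open>trace_coef_0\<close> the condition on the coefficient of index 0 says that K
  has trace one.\<close>

definition kernels :: "(complex^'n^'n) set" where
  "kernels = {K. isotropy_fixed \<rho> K \<and> cadj K = K \<and> coef K 0 = 1 / sqrt (real CARD('n)) \<and>
    (\<forall>n\<in>{1..p}. coef K n \<noteq> 0)}"

text \<open>Reality of the symbols makes K Hermitian, the integral of the constant symbol of the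
  identity gives trace one, and injectivity prevents a coefficient from vanishing.\<close>

lemma kernel_in_kernels:
  assumes W: "symbol_correspondence \<rho> \<mu> W" and \<mu>: "invariant_probability \<mu>"
    and WK: "operator_kernel \<rho> W K"
  shows "K \<in> kernels"
proof -
  have K: "isotropy_fixed \<rho> K" using WK by (simp add: operator_kernel_def)
  have base: "W A cp2_base = trace (A ** K)" for A by (rule operator_kernel_base[OF WK])
  have herm: "cadj K = K"
  proof (rule trace_eqI)
    fix A
    have "trace (A ** cadj K) = cnj (trace (K ** cadj A))"
      by (simp add: cadj_mult flip: trace_cadj)
    also have "\<dots> = cnj (W (cadj A) cp2_base)" by (simp add: base trace_mul_sym[of K])
    also have "\<dots> = W A cp2_base" using W by (simp add: symbol_correspondence_def)
    also have "\<dots> = trace (A ** K)" by (rule base)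
    finally show "trace (A ** cadj K) = trace (A ** K)" .
  qed
  have WS: "W = symbol K" by (rule operator_kernel_symbol[OF WK])
  have "trace K = 1"
  proof -
    interpret prob_space \<mu> using \<mu> by (simp add: invariant_probability_def)
    have "W (mat 1) = (\<lambda>x. trace K)" by (simp add: WS fun_eq_iff symbol_one[OF K])
    moreover have "integral\<^sup>L \<mu> (W (mat 1)) = trace (mat 1 :: complex^'n^'n) / of_nat CARD('n)"
      using W by (simp add: symbol_correspondence_def)
    ultimately show ?thesis by (simp add: prob_space trace_I)
  qed
  then have "sqrt (real CARD('n)) * coef K 0 = 1"
    using trace_coef_0[OF K herm] by (metis of_real_eq_1_iff)
  then have c0: "coef K 0 = 1 / sqrt (real CARD('n))"
    by (simp add: field_simps)
  have "coef K n \<noteq> 0" if n: "n \<le> p" for n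
  proof
    assume 0: "coef K n = 0"
    \<comment> \<open>Without its n-th component K has an orbit orthogonal to \<open>E n\<close>,
      whose symbol would then be zero.\<close>
    have "symbol K (E n) x = symbol K 0 x" for x
    proof -
      obtain g where g: "g \<in> SU3" "cp2_act g cp2_base = x" using cp2_transitive by blast
      have "trace (E n ** act g K) = trace (E n ** act g (\<Sum>m=0..p. coef K m *\<^sub>R E m))"
        using fixed_expansion[OF K herm] by simp
      also have "\<dots> = (\<Sum>m=0..p. coef K m *\<^sub>R trace (E n ** act g (E m)))"
        using g by (simp add: act_sum act_scaleR matrix_mult_sum_right trace_sum scaleR_matrix_mult_right trace_scaleR)
      also have "\<dots> = (\<Sum>m=0..p. 0)"
      proof (intro sum.cong refl)
        fix m assume "m \<in> {0..p}"
        then show "coef K m *\<^sub>R trace (E n ** act g (E m)) = 0"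
          using E_act_orthogonal[OF n _ _ g(1), of m] 0 by (cases "m = n") auto
      qed
      finally have "trace (E n ** act g K) = 0" by simp
      then show ?thesis using symbol_at[OF K g(1)] g by simp
    qed
    then have "W (E n) = W 0" by (simp add: WS fun_eq_iff)
    moreover have "inj W" using W by (simp add: symbol_correspondence_def)
    ultimately have "E n = 0" by (simp add: inj_eq)
    then show False using E(3)[OF n] by simp
  qed
  with K herm c0 show ?thesis by (simp add: kernels_def)
qed

lemma kernels_coef_nz: "K \<in> kernels \<Longrightarrow> n \<le> p \<Longrightarrow> coef K n \<noteq> 0"
  by (cases "n = 0") (auto simp: kernels_def)

lemma kernels_symbol_correspondence:
  assumes K: "K \<in> kernels" and \<mu>: "invariant_probability \<mu>"
  shows "symbol_correspondence \<rho> \<mu> (symbol K)"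
proof -
  have K': "isotropy_fixed \<rho> K" "cadj K = K" "coef K 0 = 1 / sqrt (real CARD('n))"
    using K by (auto simp: kernels_def)
  have "trace K = 1" by (simp add: trace_coef_0[OF K'(1,2)] K'(3))
  have "inj (symbol K)"
  proof (rule injI)
    fix A B assume eq: "symbol K A = symbol K B"
    have "A - B = 0"
    proof (rule kernel_nondegenerate[OF K'(1,2) kernels_coef_nz[OF K]])
      fix g assume g: "g \<in> SU3"
      have "trace (A ** act g K) = trace (B ** act g K)"
        using symbol_at[OF K'(1) g, of A] symbol_at[OF K'(1) g, of B] eq by simp
      then show "trace ((A - B) ** act g K) = 0" by (simp add: matrix_diff_rdistrib trace_sub)
    qed
    then show "A = B" by simp
  qed
  then show ?thesis
    using \<open>trace K = 1\<close> \<mu>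
    by (simp add: symbol_correspondence_def symbol_smooth[OF K'(1)] symbol_add symbol_mscale
        symbol_act[OF K'(1)] symbol_cadj[OF K'(1,2)] symbol_integral[OF K'(1)] SU3_matrix_inv)
qed

lemma moduli_space_eq:
  assumes \<mu>: "invariant_probability \<mu>"
  shows "moduli_space \<rho> \<mu> = kernels"
proof (intro subset_antisym subsetI)
  fix K assume "K \<in> moduli_space \<rho> \<mu>"
  then show "K \<in> kernels" using kernel_in_kernels[OF _ \<mu>] by (auto simp: moduli_space_def)
next
  fix K assume K: "K \<in> kernels"
  then have "isotropy_fixed \<rho> K" by (simp add: kernels_def)
  then show "K \<in> moduli_space \<rho> \<mu>"
    using kernels_symbol_correspondence[OF K \<mu>] symbol_kernel[of K] by (auto simp: moduli_space_def)
qed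

section \<open>Characteristic numbers\<close>

definition char_scale :: "nat \<Rightarrow> real" where
  "char_scale n = sqrt ((real n + 1) ^ 3 / real CARD('n))"

lemma char_scale_nz: "char_scale n \<noteq> 0"
  by (simp add: char_scale_def)

lemma char_scale_0: "char_scale 0 = 1 / sqrt (real CARD('n))"
  by (simp add: char_scale_def real_sqrt_divide)

text \<open>Tuples are indexed from 1, so their value at 0 carries no information; c_0 = 1 is put in
  its place.\<close>

definition of_chars :: "(nat \<Rightarrow> real) \<Rightarrow> complex^'n^'n" where
  "of_chars c = (\<Sum>n=0..p. ((if n = 0 then 1 else c n) * char_scale n) *\<^sub>R E n)"

lemma coef_of_chars: "n \<le> p \<Longrightarrow> coef (of_chars c) n = (if n = 0 then 1 else c n) * char_scale n"
  by (simp only: of_chars_def coef_sum)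

lemma of_chars_kernels:
  assumes "c \<in> {1..p} \<rightarrow>\<^sub>E (UNIV - {0})"
  shows "of_chars c \<in> kernels"
proof -
  have "of_chars c \<in> fixed_herm"
    unfolding of_chars_def
    by (intro subspace_sum subspace_scale subspace_fixed_herm E_fixed_herm) auto
  moreover have "coef (of_chars c) n \<noteq> 0" if "n \<in> {1..p}" for n
    using that assms char_scale_nz by (auto simp: coef_of_chars PiE_iff)
  ultimately show ?thesis by (simp add: kernels_def fixed_herm_def coef_of_chars char_scale_0)
qed

lemma characteristic_numbers_iff:
  assumes K: "K \<in> kernels"
  shows "characteristic_numbers p E K c \<longleftrightarrow> c = restrict (\<lambda>n. coef K n / char_scale n) {0..p}"
proof
  assume c: "characteristic_numbers p E K c"
  then have Ksum: "K = (\<Sum>n=0..p. (c n * char_scale n) *\<^sub>R E n)"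
    by (simp add: characteristic_numbers_def char_scale_def)
  have "coef K n = c n * char_scale n" if "n \<le> p" for n
    by (subst Ksum) (rule coef_sum[OF that])
  then have eq: "c n = coef K n / char_scale n" if "n \<le> p" for n
    using that char_scale_nz by (simp add: field_simps)
  moreover have "c \<in> extensional {0..p}" using c by (simp add: characteristic_numbers_def)
  ultimately show "c = restrict (\<lambda>n. coef K n / char_scale n) {0..p}"
    by (intro extensionalityI[of _ "{0..p}"]) auto
next
  assume c: "c = restrict (\<lambda>n. coef K n / char_scale n) {0..p}"
  have K': "isotropy_fixed \<rho> K" "cadj K = K" "coef K 0 = 1 / sqrt (real CARD('n))"
    using K by (auto simp: kernels_def)
  have "K = (\<Sum>n=0..p. coef K n *\<^sub>R E n)" by (rule fixed_expansion[OF K'(1,2)])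
  also have "\<dots> = (\<Sum>n=0..p. (c n * char_scale n) *\<^sub>R E n)"
    using char_scale_nz by (intro sum.cong refl) (simp add: c)
  finally have "K = (\<Sum>n=0..p. (c n * char_scale n) *\<^sub>R E n)" .
  moreover have "c 0 = 1" by (simp add: c K'(3) char_scale_0)
  moreover have "c \<in> extensional {0..p}" by (simp add: c)
  ultimately show "characteristic_numbers p E K c"
    unfolding characteristic_numbers_def char_scale_def by blast
qed

lemma char_tuple_eq:
  assumes K: "K \<in> kernels"
  shows "char_tuple p E K = restrict (\<lambda>n. coef K n / char_scale n) {1..p}"
  unfolding char_tuple_def characteristic_numbers_iff[OF K] the_eq_trivial
  by (auto simp: fun_eq_iff restrict_def)

lemma char_tuple_in:
  assumes K: "K \<in> kernels"
  shows "char_tuple p E K \<in> {1..p} \<rightarrow>\<^sub>E (UNIV - {0})"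
  using kernels_coef_nz[OF K] char_scale_nz by (auto simp: char_tuple_eq[OF K])

lemma char_tuple_of_chars:
  assumes c: "c \<in> {1..p} \<rightarrow>\<^sub>E (UNIV - {0})"
  shows "char_tuple p E (of_chars c) = c"
proof (rule extensionalityI[of _ "{1..p}"])
  show "char_tuple p E (of_chars c) \<in> extensional {1..p}"
    by (simp add: char_tuple_eq[OF of_chars_kernels[OF c]])
  show "c \<in> extensional {1..p}" using c by (simp add: PiE_iff)
  show "char_tuple p E (of_chars c) n = c n" if "n \<in> {1..p}" for n
    using that char_scale_nz by (simp add: char_tuple_eq[OF of_chars_kernels[OF c]] coef_of_chars)
qed

lemma of_chars_char_tuple:
  assumes K: "K \<in> kernels"
  shows "of_chars (char_tuple p E K) = K"
proof -
  have K': "isotropy_fixed \<rho> K" "cadj K = K" "coef K 0 = 1 / sqrt (real CARD('n))"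
    using K by (auto simp: kernels_def)
  have "of_chars (char_tuple p E K) = (\<Sum>n=0..p. coef K n *\<^sub>R E n)"
    unfolding of_chars_def using char_scale_nz
    by (intro sum.cong refl) (auto simp: char_tuple_eq[OF K] K'(3) char_scale_0)
  then show ?thesis using fixed_expansion[OF K'(1,2)] by simp
qed

lemma char_tuple_homeomorphic:
  "homeomorphic_map (top_of_set kernels) (product_topology (\<lambda>_. top_of_set (UNIV - {0})) {1..p})
    (char_tuple p E)"
proof -
  let ?Y = "product_topology (\<lambda>_. top_of_set (UNIV - {0::real})) {1..p}"
  have topY: "topspace ?Y = {1..p} \<rightarrow>\<^sub>E (UNIV - {0})" by simp
  have "continuous_map (top_of_set kernels) ?Y (char_tuple p E)"
    unfolding continuous_map_componentwise
  proof (intro conjI ballI)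
    show "char_tuple p E ` topspace (top_of_set kernels) \<subseteq> extensional {1..p}"
      by (auto simp: char_tuple_eq)
    fix k assume k: "k \<in> {1..p}"
    have "continuous_on kernels (\<lambda>K. inner K (E k) / char_scale k)"
      by (intro continuous_intros) (simp add: char_scale_nz)
    then have "continuous_on kernels (\<lambda>K. char_tuple p E K k)"
      by (rule continuous_on_eq) (use k in \<open>auto simp: char_tuple_eq inner_E\<close>)
    moreover have "char_tuple p E K k \<noteq> 0" if "K \<in> kernels" for K
      using char_tuple_in[OF that] k by (auto simp: PiE_iff)
    ultimately show "continuous_map (top_of_set kernels) (top_of_set (UNIV - {0})) (\<lambda>K. char_tuple p E K k)"
      by (intro continuous_map_into_subtopology) auto
  qed
  moreover have "continuous_map ?Y (top_of_set kernels) of_chars"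
  proof (intro continuous_map_into_subtopology)
    have "continuous_map ?Y euclidean (\<lambda>c. ((if n = 0 then 1 else c n) * char_scale n) *\<^sub>R E n)"
      if n: "n \<in> {0..p}" for n
    proof (cases "n = 0")
      case False
      then have "continuous_map ?Y (top_of_set (UNIV - {0})) (\<lambda>c. c n)"
        using n by (intro continuous_map_product_projection) auto
      then have "continuous_map ?Y euclidean (\<lambda>c. c n)" by (rule continuous_map_into_fulltopology)
      moreover have "continuous_map euclidean euclidean (\<lambda>r. (r * char_scale n) *\<^sub>R E n)"
        by (simp add: continuous_intros)
      ultimately have "continuous_map ?Y euclidean ((\<lambda>r. (r * char_scale n) *\<^sub>R E n) \<circ> (\<lambda>c. c n))"
        by (rule continuous_map_compose)
      then show ?thesis using False by (simp add: o_def)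
    qed simp
    then show "continuous_map ?Y euclidean of_chars"
      unfolding of_chars_def by (intro continuous_map_sum) auto
    show "of_chars \<in> topspace ?Y \<rightarrow> kernels" using of_chars_kernels by auto
  qed
  ultimately have "homeomorphic_maps (top_of_set kernels) ?Y (char_tuple p E) of_chars"
    unfolding homeomorphic_maps_def topY by (simp add: of_chars_char_tuple char_tuple_of_chars)
  then show ?thesis by (auto simp: homeomorphic_map_maps)
qed

lemma bij_betw_char_tuple:
  assumes \<mu>: "invariant_probability \<mu>"
  shows "bij_betw (\<lambda>W. char_tuple p E (THE K. operator_kernel \<rho> W K))
    {W. symbol_correspondence \<rho> \<mu> W} ({1..p} \<rightarrow>\<^sub>E (UNIV - {0}))"
proof (rule bij_betw_byWitness[where f' = "\<lambda>c. symbol (of_chars c)"])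
  have ker: "operator_kernel \<rho> W (THE K. operator_kernel \<rho> W K)" if "symbol_correspondence \<rho> \<mu> W" for W
    using theI'[OF operator_kernel_ex1[OF that]] .
  have in_ker: "(THE K. operator_kernel \<rho> W K) \<in> kernels" if "symbol_correspondence \<rho> \<mu> W" for W
    by (rule kernel_in_kernels[OF that \<mu> ker[OF that]])
  have the: "(THE K'. operator_kernel \<rho> (symbol K) K') = K" if "K \<in> kernels" for K
  proof (rule the1_equality[OF operator_kernel_ex1])
    show "symbol_correspondence \<rho> \<mu> (symbol K)" by (rule kernels_symbol_correspondence[OF that \<mu>])
    show "operator_kernel \<rho> (symbol K) K" using that by (simp add: kernels_def symbol_kernel)
  qed
  show "\<forall>W\<in>{W. symbol_correspondence \<rho> \<mu> W}.
      symbol (of_chars (char_tuple p E (THE K. operator_kernel \<rho> W K))) = W"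
    using in_ker operator_kernel_symbol[OF ker] by (simp add: of_chars_char_tuple)
  show "\<forall>c\<in>{1..p} \<rightarrow>\<^sub>E (UNIV - {0}). char_tuple p E (THE K. operator_kernel \<rho> (symbol (of_chars c)) K) = c"
    by (simp add: the of_chars_kernels char_tuple_of_chars)
  show "(\<lambda>W. char_tuple p E (THE K. operator_kernel \<rho> W K)) ` {W. symbol_correspondence \<rho> \<mu> W}
      \<subseteq> {1..p} \<rightarrow>\<^sub>E (UNIV - {0})"
    using char_tuple_in[OF in_ker] by blast
  show "(\<lambda>c. symbol (of_chars c)) ` ({1..p} \<rightarrow>\<^sub>E (UNIV - {0})) \<subseteq> {W. symbol_correspondence \<rho> \<mu> W}"
    using kernels_symbol_correspondence[OF of_chars_kernels \<mu>] by blast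
qed

end

text \<open>Extensional functions into the nonzero reals encode the p-fold product of \<real>
  without 0. The identification is made both for the correspondences and, topologically, for their
  kernels with the topology inherited from the operators.\<close>

theorem corollary4p9:
  fixes p :: nat
    and \<rho> :: "complex^3^3 \<Rightarrow> complex^'n^'n"
    and E :: "nat \<Rightarrow> complex^'n^'n"
    and \<mu> :: "cp2 measure"
  assumes "p \<ge> 1"
    and "unitary_irrep \<rho> (p, 0) \<or> unitary_irrep \<rho> (0, p)"
    and "invariant_probability \<mu>"
    and "fixed_basis \<rho> p E"
  shows "(\<forall>W. symbol_correspondence \<rho> \<mu> W \<longrightarrow> (\<exists>!K. operator_kernel \<rho> W K)) \<and>
    (\<forall>K\<in>moduli_space \<rho> \<mu>. \<exists>!c. characteristic_numbers p E K c) \<and>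
    bij_betw (\<lambda>W. char_tuple p E (THE K. operator_kernel \<rho> W K))
      {W. symbol_correspondence \<rho> \<mu> W} ({1..p} \<rightarrow>\<^sub>E (UNIV - {0})) \<and>
    homeomorphic_map (top_of_set (moduli_space \<rho> \<mu>))
      (product_topology (\<lambda>_. top_of_set (UNIV - {0})) {1..p}) (char_tuple p E)"
proof -
  obtain v b where "symbol_rep \<rho> p v b" using unitary_irrep_symbol_rep[OF assms(1,2)] by blast
  then interpret symbol_basis \<rho> p v b E
    by (intro symbol_basis.intro symbol_basis_axioms.intro assms(4))
  show ?thesis
    using operator_kernel_ex1 bij_betw_char_tuple[OF assms(3)] char_tuple_homeomorphic
      characteristic_numbers_iff
    by (simp add: moduli_space_eq[OF assms(3)])
qed

end
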